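(* Let $f\in K[x_1,x_2,x_3,x_4]$ be a homogeneous polynomial of degree at least $2$ with zero Hessian. Then $f$ can be transformed into a form in three variables by a linear transformation of the variables $x_1,x_2,x_3,x_4$; that is, there is $A\in \mathrm{GL}(4,K)$ such that the polynomial $f(A^{-1}x)$, $x=(x_1,x_2,x_3,x_4)$, lies in $K[x_1,x_2,x_3]$.
   Context: $K$ is an algebraically closed field of characteristic zero. A homogeneous polynomial $f\in K[x_1,\ldots,x_n]$ has zero Hessian if $\det\left(\frac{\partial^2 f}{\partial x_i\partial x_j}\right)_{1\le i,j\le n}=0$ as a polynomial. *)

theory Defs
  imports "HOL-Analysis.Analysis" "HOL-Computational_Algebra.Polynomial"
    "HOL-Library.Poly_Mapping"
begin

text \<open>
  A polynomial over \<^typ>\<open>'a\<close> in variables indexed by \<^typ>\<open>'n\<close> is a finitely supported function from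
  exponent vectors to coefficients. For $K[x_1,\ldots,x_n]$ the index type is the numeral type \<open>n\<close>, whose
  elements are $1, \ldots, n$; arithmetic there is modulo $n$, so that $n = 0$.
\<close>

type_synonym ('n, 'a) mpoly = "('n \<Rightarrow>\<^sub>0 nat) \<Rightarrow>\<^sub>0 'a"

definition mpoly_const :: "'a::zero \<Rightarrow> ('n, 'a) mpoly" where
  "mpoly_const c = Poly_Mapping.single 0 c"

definition mpoly_var :: "'n \<Rightarrow> ('n, 'a::zero_neq_one) mpoly" where
  "mpoly_var i = Poly_Mapping.single (Poly_Mapping.single i 1) 1"

text \<open>The subset $K[x_i : i \in V]$ of the polynomial ring.\<close>

definition mpolys_in :: "'n set \<Rightarrow> ('n, 'a::zero) mpoly set" where
  "mpolys_in V = {p. \<forall>m \<in> Poly_Mapping.keys p. Poly_Mapping.keys m \<subseteq> V}"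

text \<open>As usual, the zero polynomial is homogeneous of every degree.\<close>

definition homogeneous_mpoly :: "nat \<Rightarrow> ('n::finite, 'a::zero) mpoly \<Rightarrow> bool" where
  "homogeneous_mpoly d p \<longleftrightarrow>
     (\<forall>m \<in> Poly_Mapping.keys p. (\<Sum>i\<in>UNIV. Poly_Mapping.lookup m i) = d)"

text \<open>
  Subtraction of exponents truncates, but whenever it does the coefficient is \<open>0\<close>.
\<close>

definition mpoly_pderiv :: "'n \<Rightarrow> ('n, 'a::comm_semiring_1) mpoly \<Rightarrow> ('n, 'a) mpoly" where
  "mpoly_pderiv i p =
     (\<Sum>m \<in> Poly_Mapping.keys p.
        Poly_Mapping.single (m - Poly_Mapping.single i 1)
          (of_nat (Poly_Mapping.lookup m i) * Poly_Mapping.lookup p m))"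

definition hessian_matrix ::
    "('n::finite, 'a::comm_ring_1) mpoly \<Rightarrow> ('n, 'a) mpoly ^ 'n ^ 'n" where
  "hessian_matrix p = (\<chi> i j. mpoly_pderiv i (mpoly_pderiv j p))"

definition zero_hessian :: "('n::finite, 'a::comm_ring_1) mpoly \<Rightarrow> bool" where
  "zero_hessian p \<longleftrightarrow> det (hessian_matrix p) = 0"

definition mpoly_subst ::
    "('n::finite \<Rightarrow> ('k, 'a::comm_semiring_1) mpoly) \<Rightarrow> ('n, 'a) mpoly \<Rightarrow> ('k, 'a) mpoly" where
  "mpoly_subst g p =
     (\<Sum>m \<in> Poly_Mapping.keys p.
        mpoly_const (Poly_Mapping.lookup p m) * (\<Prod>i\<in>UNIV. g i ^ Poly_Mapping.lookup m i))"

text \<open>The polynomial $p(Bx)$: the variable $x_i$ is replaced by $\sum_j B_{ij} x_j$.\<close>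

definition mpoly_linear_subst ::
    "'a::comm_semiring_1 ^ 'n::finite ^ 'n \<Rightarrow> ('n, 'a) mpoly \<Rightarrow> ('n, 'a) mpoly" where
  "mpoly_linear_subst B = mpoly_subst (\<lambda>i. \<Sum>j\<in>UNIV. mpoly_const (B $ i $ j) * mpoly_var j)"

end

theory Submission
  imports Defs "Berlekamp_Zassenhaus.Unique_Factorization_Poly"
begin

text \<open>
  Write $f_i$ for the partial derivatives. As the Hessian vanishes, the $f_i$ are algebraically dependent, and the
  gradient of a relation of least degree, evaluated at the $f_i$, gives a non-zero polynomial vector field
  $h$ whose derivation $D = \sum h_i \partial_i$ kills all $f_i$ and all $h_i$ (Gordan and Noether). Its top
  component divided by the common factors is homogeneous of some degree $e$ and primitive. If $e = 0$,
  then $D f = 0$ is a linear relation between the $f_i$.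

  Let $e > 0$. Then $h(x + t h(x)) = h(x)$, hence $h(h(x)) = 0$. Take two linear combinations $u$, $v$ of the $h_i$
  without common factor. Eliminating a variable from $u(h) = v(h) = 0$ gives homogeneous relations, so that modulo a
  prime factor $G$ of $v - \kappa u$ the vector $h$ is proportional to a constant vector $c$, for almost all $\kappa$.
  From $D G = 0$ one gets $G \mid \partial_c G$, hence $\partial_c G = 0$ and $G(x + t c) = G(x)$. It follows that
  $h(a + t h(z))$ is parallel to $h(z)$ whenever $h(a) = 0$, and then that $h$ vanishes on the linear span of its
  values. This span has dimension at most 2, as $h$ is primitive, so $h = p b + q b'$ with constant
  $b$, $b'$. Differentiating $D f = 0$ yields $\partial_b f = 0$, since otherwise $p$ and $q$ would be proportional.
\<close>

no_notation Matrix.vec_index (infixl "$" 100)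

subsection \<open>Substitution, derivatives and derivations\<close>

text \<open>The number four enters twice. Eliminating one variable leaves a relation between three
  quantities \<open>u\<close>, \<open>v\<close>, \<open>w\<close>; putting
  \<open>v = \<kappa> u\<close> turns it into a binary form, and binary forms split into linear
  factors, unlike forms in more variables. Later, a proper subspace other than a hyperplane has
  dimension at most 2. In five variables the statement fails: the partial derivatives of
  \<open>x1 x4^2 + x2 x4 x5 + x3 x5^2\<close> satisfy \<open>f1 f3 = f2^2\<close> but no linear
  relation. No dimension theory of varieties is involved. Statements about the image and the zeros
  of \<open>h\<close> are replaced by divisibility by prime polynomials: a zero of \<open>h\<close>
  lies on every member \<open>v - \<kappa> u\<close> of the pencil, hence on one of its prime
  factors, and a polynomial divisible by primes from infinitely many members is 0. For this, two
  members must not share a prime, which is why the common factors of the \<open>h i\<close> have to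
  be removed.\<close>

definition ring_hom_fun :: "('a::comm_ring_1 \<Rightarrow> 'b::comm_ring_1) \<Rightarrow> bool" where
  "ring_hom_fun \<phi> \<longleftrightarrow> \<phi> 1 = 1 \<and> (\<forall>x y. \<phi> (x + y) = \<phi> x + \<phi> y) \<and> (\<forall>x y. \<phi> (x * y) = \<phi> x * \<phi> y)"

text \<open>The target is an arbitrary commutative ring, reached by \<open>c\<close> on the
  coefficients. Evaluation at a point, nested polynomials, the grading by degree, the flow along
  \<open>h\<close> and restriction to a line are all instances, so one homomorphism proof serves
  them all.\<close>

definition msub ::
    "('a::comm_ring_1 \<Rightarrow> 'r::comm_ring_1) \<Rightarrow> ('n::finite \<Rightarrow> 'r) \<Rightarrow> ('n, 'a) mpoly \<Rightarrow> 'r" where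
  "msub c g p = (\<Sum>m \<in> Poly_Mapping.keys p.
     c (Poly_Mapping.lookup p m) * (\<Prod>i\<in>UNIV. g i ^ Poly_Mapping.lookup m i))"

lemma ring_hom_funD:
  assumes "ring_hom_fun \<phi>"
  shows "\<phi> 1 = 1" "\<phi> (x + y) = \<phi> x + \<phi> y" "\<phi> (x * y) = \<phi> x * \<phi> y"
    "\<phi> 0 = 0" "\<phi> (- x) = - \<phi> x" "\<phi> (x - y) = \<phi> x - \<phi> y"
    "\<phi> (x ^ n) = \<phi> x ^ n" "\<phi> (sum f A) = (\<Sum>a\<in>A. \<phi> (f a))" "\<phi> (prod f A) = (\<Prod>a\<in>A. \<phi> (f a))"
    "\<phi> (of_nat n) = of_nat n"
proof -
  note h = assms[unfolded ring_hom_fun_def]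
  show 1: "\<phi> 1 = 1" and add: "\<And>x y. \<phi> (x + y) = \<phi> x + \<phi> y" and mult: "\<And>x y. \<phi> (x * y) = \<phi> x * \<phi> y"
    using h by auto
  show zero: "\<phi> 0 = 0" using add[of 0 0] by simp
  show minus: "\<phi> (- x) = - \<phi> x" for x
    using add[of x "- x"] zero by (simp add: eq_neg_iff_add_eq_0 add.commute)
  show "\<phi> (x - y) = \<phi> x - \<phi> y" using add[of x "- y"] minus[of y] by simp
  show "\<phi> (x ^ n) = \<phi> x ^ n" by (induction n) (auto simp: 1 mult)
  show "\<phi> (sum f A) = (\<Sum>a\<in>A. \<phi> (f a))"
    by (induction A rule: infinite_finite_induct) (auto simp: zero add)
  show "\<phi> (prod f A) = (\<Prod>a\<in>A. \<phi> (f a))"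
    by (induction A rule: infinite_finite_induct) (auto simp: 1 mult)
  show "\<phi> (of_nat n) = of_nat n" by (induction n) (auto simp: zero 1 add)
qed

lemma ring_hom_fun_id [simp]: "ring_hom_fun (\<lambda>x. x)" by (simp add: ring_hom_fun_def)

lemma ring_hom_fun_comp: "ring_hom_fun f \<Longrightarrow> ring_hom_fun g \<Longrightarrow> ring_hom_fun (\<lambda>x. f (g x))"
  by (simp add: ring_hom_fun_def)

lemma ring_hom_fun_mpoly_const [simp]:
  "ring_hom_fun (mpoly_const :: 'a::comm_ring_1 \<Rightarrow> ('n, 'a) mpoly)"
  by (simp add: ring_hom_fun_def mpoly_const_def single_add mult_single)

lemma ring_hom_fun_pCons [simp]: "ring_hom_fun (\<lambda>x::'a::comm_ring_1. [:x:])"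
  by (simp add: ring_hom_fun_def)

lemma ring_hom_fun_poly [simp]: "ring_hom_fun (\<lambda>p::'a::comm_ring_1 poly. poly p a)"
  by (simp add: ring_hom_fun_def)

lemma mpoly_sum_monomials:
  "p = (\<Sum>m\<in>Poly_Mapping.keys p. Poly_Mapping.single m (Poly_Mapping.lookup p m))"
proof (rule poly_mapping_eqI)
  fix k
  show "Poly_Mapping.lookup p k =
      Poly_Mapping.lookup (\<Sum>m\<in>Poly_Mapping.keys p. Poly_Mapping.single m (Poly_Mapping.lookup p m)) k"
  proof -
    have "Poly_Mapping.lookup (\<Sum>m\<in>Poly_Mapping.keys p. Poly_Mapping.single m (Poly_Mapping.lookup p m)) k
       = (\<Sum>m\<in>Poly_Mapping.keys p. if m = k then Poly_Mapping.lookup p m else 0)"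
      unfolding lookup_sum by (intro sum.cong) (auto simp: lookup_single when_def)
    thus ?thesis by (simp add: in_keys_iff)
  qed
qed

lemma var_power: "(mpoly_var i :: ('n, 'a::comm_ring_1) mpoly) ^ k = Poly_Mapping.single (Poly_Mapping.single i k) 1"
proof (induction k)
  case (Suc k)
  thus ?case by (simp add: mpoly_var_def mult_single flip: single_add)
qed (simp flip: single_one)

lemma prod_single: "(\<Prod>i\<in>A. Poly_Mapping.single (f i) (1::'a::comm_ring_1)) = Poly_Mapping.single (sum f A) 1"
  by (induction A rule: infinite_finite_induct) (auto simp: mult_single simp flip: single_one)

lemma sum_single_lookup:
  fixes m :: "'n::finite \<Rightarrow>\<^sub>0 nat"
  shows "(\<Sum>i\<in>UNIV. Poly_Mapping.single i (Poly_Mapping.lookup m i)) = m"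
proof (rule poly_mapping_eqI)
  fix k
  have "Poly_Mapping.lookup (\<Sum>i\<in>UNIV. Poly_Mapping.single i (Poly_Mapping.lookup m i)) k
     = (\<Sum>i\<in>UNIV. if i = k then Poly_Mapping.lookup m i else 0)"
    unfolding lookup_sum by (intro sum.cong) (auto simp: lookup_single when_def)
  thus "Poly_Mapping.lookup (\<Sum>i\<in>UNIV. Poly_Mapping.single i (Poly_Mapping.lookup m i)) k = Poly_Mapping.lookup m k"
    by simp
qed

lemma single_eq_const_mult_vars:
  fixes m :: "'n::finite \<Rightarrow>\<^sub>0 nat"
  shows "Poly_Mapping.single m (a::'a::comm_ring_1) =
     mpoly_const a * (\<Prod>i\<in>UNIV. mpoly_var i ^ Poly_Mapping.lookup m i)"
  by (simp add: var_power prod_single sum_single_lookup mpoly_const_def mult_single)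

lemma mpoly_induct [case_names const var add mult]:
  fixes p :: "('n::finite, 'a::comm_ring_1) mpoly"
  assumes const: "\<And>c. P (mpoly_const c)" and var: "\<And>i. P (mpoly_var i)"
    and add: "\<And>p q. P p \<Longrightarrow> P q \<Longrightarrow> P (p + q)" and mult: "\<And>p q. P p \<Longrightarrow> P q \<Longrightarrow> P (p * q)"
  shows "P p"
proof -
  have P0: "P 0" and P1: "P 1" using const[of 0] const[of 1] by (auto simp: mpoly_const_def)
  have pow: "P (q ^ k)" if "P q" for q k using that by (induction k) (auto simp: P1 mult)
  have prd: "P (prod f A)" if "\<And>i. P (f i)" for f :: "'n \<Rightarrow> _" and A
    using that by (induction A rule: infinite_finite_induct) (auto simp: P1 mult)
  have sm: "P (sum f A)" if "\<And>i. P (f i)" for f :: "_ \<Rightarrow> ('n,'a) mpoly" and A :: "('n \<Rightarrow>\<^sub>0 nat) set"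
    using that by (induction A rule: infinite_finite_induct) (auto simp: P0 add)
  have "P (Poly_Mapping.single m a)" for m a
    unfolding single_eq_const_mult_vars by (intro mult const prd pow var)
  thus ?thesis by (subst mpoly_sum_monomials) (rule sm)
qed

lemma mpoly_mult_monomials:
  "p * q = (\<Sum>m\<in>Poly_Mapping.keys p. \<Sum>n\<in>Poly_Mapping.keys q.
     Poly_Mapping.single m (Poly_Mapping.lookup p m) * Poly_Mapping.single n (Poly_Mapping.lookup q n))"
proof -
  have "p * q = (\<Sum>m\<in>Poly_Mapping.keys p. Poly_Mapping.single m (Poly_Mapping.lookup p m)) *
      (\<Sum>n\<in>Poly_Mapping.keys q. Poly_Mapping.single n (Poly_Mapping.lookup q n))"
    by (simp only: mpoly_sum_monomials[symmetric])
  thus ?thesis by (simp only: sum_product)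
qed

text \<open>Cancellation can make the keys of a sum fewer than the union of the keys; summing over a
  common larger set makes additivity immediate.\<close>

lemma msub_superset:
  assumes "ring_hom_fun c" "finite A" "Poly_Mapping.keys p \<subseteq> A"
  shows "msub c g p = (\<Sum>m\<in>A. c (Poly_Mapping.lookup p m) * (\<Prod>i\<in>UNIV. g i ^ Poly_Mapping.lookup m i))"
  unfolding msub_def using assms(2,3)
  by (intro sum.mono_neutral_left) (auto simp: in_keys_iff ring_hom_funD(4)[OF assms(1)])

lemma msub_single:
  assumes "ring_hom_fun c"
  shows "msub c g (Poly_Mapping.single m a) = c a * (\<Prod>i\<in>UNIV. g i ^ Poly_Mapping.lookup m i)"
  by (subst msub_superset[OF assms, of "{m}"]) auto

lemma msub_add:
  assumes "ring_hom_fun c"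
  shows "msub c g (p + q) = msub c g p + msub c g q"
proof -
  let ?A = "Poly_Mapping.keys p \<union> Poly_Mapping.keys q"
  have "Poly_Mapping.keys (p + q) \<subseteq> ?A" by (rule keys_add)
  thus ?thesis
    by (simp add: msub_superset[OF assms, of ?A] lookup_add ring_hom_funD(2)[OF assms]
        distrib_right sum.distrib)
qed

lemma msub_sum:
  assumes "ring_hom_fun c"
  shows "msub c g (sum f A) = (\<Sum>a\<in>A. msub c g (f a))"
  by (induction A rule: infinite_finite_induct) (auto simp: msub_add[OF assms], simp_all add: msub_def)

lemma ring_hom_fun_msub:
  fixes g :: "'n::finite \<Rightarrow> 'r::comm_ring_1"
  assumes c: "ring_hom_fun (c :: 'a::comm_ring_1 \<Rightarrow> 'r)"
  shows "ring_hom_fun (msub c g)"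
  unfolding ring_hom_fun_def
proof (intro conjI allI)
  show "msub c g 1 = 1"
    using msub_single[OF c, of g 0 1] by (simp add: ring_hom_funD(1)[OF c])
  show "msub c g (p + q) = msub c g p + msub c g q" for p q by (rule msub_add[OF c])
  fix p q :: "('n, 'a) mpoly"
  have s: "msub c g (Poly_Mapping.single m a * Poly_Mapping.single n b) =
     msub c g (Poly_Mapping.single m a) * msub c g (Poly_Mapping.single n b)" for m n a b
    by (simp add: mult_single msub_single[OF c] ring_hom_funD(3)[OF c] lookup_add power_add
        prod.distrib mult_ac)
  have "msub c g (p * q) = msub c g (\<Sum>m\<in>Poly_Mapping.keys p. \<Sum>n\<in>Poly_Mapping.keys q.
     Poly_Mapping.single m (Poly_Mapping.lookup p m) * Poly_Mapping.single n (Poly_Mapping.lookup q n))"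
    by (subst mpoly_mult_monomials) (rule refl)
  also have "\<dots> = (\<Sum>m\<in>Poly_Mapping.keys p. \<Sum>n\<in>Poly_Mapping.keys q.
     msub c g (Poly_Mapping.single m (Poly_Mapping.lookup p m)) * msub c g (Poly_Mapping.single n (Poly_Mapping.lookup q n)))"
    by (simp only: msub_sum[OF c] s)
  also have "\<dots> = msub c g p * msub c g q"
    by (simp only: msub_single[OF c] sum_product msub_def[of c g p] msub_def[of c g q])
  finally show "msub c g (p * q) = msub c g p * msub c g q" .
qed

lemma msub_const: "ring_hom_fun c \<Longrightarrow> msub c g (mpoly_const a) = c a"
  by (simp add: mpoly_const_def msub_single)

lemma msub_var: "ring_hom_fun c \<Longrightarrow> msub c g (mpoly_var i) = g i"
proof -
  assume c: "ring_hom_fun c"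
  have "(\<Prod>j\<in>UNIV. g j ^ Poly_Mapping.lookup (Poly_Mapping.single i (1::nat)) j) = (\<Prod>j\<in>UNIV. if j = i then g j else 1)"
    by (intro prod.cong) (auto simp: lookup_single when_def)
  thus ?thesis using c by (simp add: mpoly_var_def msub_single ring_hom_funD)
qed

lemmas msub_hom = ring_hom_funD[OF ring_hom_fun_msub]

lemma ring_hom_fun_eqI:
  assumes "ring_hom_fun \<phi>" "ring_hom_fun \<psi>"
    "\<And>a. \<phi> (mpoly_const a) = \<psi> (mpoly_const a)" "\<And>i. \<phi> (mpoly_var i) = \<psi> (mpoly_var i)"
  shows "\<phi> (p :: ('n::finite, 'a::comm_ring_1) mpoly) = \<psi> p"
  by (induction p rule: mpoly_induct)
     (auto simp: assms(3,4) ring_hom_funD[OF assms(1)] ring_hom_funD[OF assms(2)])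

lemma hom_msub:
  assumes "ring_hom_fun \<phi>" "ring_hom_fun c"
  shows "\<phi> (msub c g p) = msub (\<lambda>a. \<phi> (c a)) (\<lambda>i. \<phi> (g i)) p"
  by (rule ring_hom_fun_eqI[OF ring_hom_fun_comp[OF assms(1) ring_hom_fun_msub[OF assms(2)]]])
     (auto intro!: ring_hom_fun_msub ring_hom_fun_comp[OF assms] simp: msub_const msub_var assms ring_hom_fun_comp[OF assms])

lemma msub_id [simp]: "msub mpoly_const mpoly_var p = p"
  by (rule ring_hom_fun_eqI[where \<psi> = "\<lambda>x. x"]) (auto simp: ring_hom_fun_msub msub_const msub_var)

lemma mpoly_subst_eq_msub: "mpoly_subst g p = msub mpoly_const g p"
  by (simp add: mpoly_subst_def msub_def)

section \<open>Formal partial derivatives and derivations\<close>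

lemma lookup_mpoly_pderiv:
  fixes p :: "('n, 'a::comm_ring_1) mpoly"
  shows "Poly_Mapping.lookup (mpoly_pderiv i p) m =
     of_nat (Poly_Mapping.lookup m i + 1) * Poly_Mapping.lookup p (m + Poly_Mapping.single i 1)"
proof -
  let ?e = "Poly_Mapping.single i (1::nat)"
  have "(of_nat (Poly_Mapping.lookup n i) * Poly_Mapping.lookup p n when n - ?e = m) =
    (if n = m + ?e then of_nat (Poly_Mapping.lookup m i + 1) * Poly_Mapping.lookup p (m + ?e) else 0)" for n
  proof (cases "Poly_Mapping.lookup n i = 0")
    case True
    hence "n \<noteq> m + ?e" by (auto simp: lookup_add)
    thus ?thesis using True by simp
  next
    case False
    have "n - ?e + ?e = n"
      by (rule poly_mapping_eqI) (use False in \<open>auto simp: lookup_add lookup_minus lookup_single when_def\<close>)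
    hence "n - ?e = m \<longleftrightarrow> n = m + ?e" by (metis add_diff_cancel_right')
    thus ?thesis by (auto simp: lookup_add)
  qed
  thus ?thesis
    by (simp add: mpoly_pderiv_def lookup_sum lookup_single in_keys_iff)
qed

lemma mpoly_pderiv_add: "mpoly_pderiv i (p + q) = mpoly_pderiv i p + mpoly_pderiv i (q :: ('n, 'a::comm_ring_1) mpoly)"
  by (rule poly_mapping_eqI) (simp add: lookup_mpoly_pderiv lookup_add algebra_simps)

lemma mpoly_pderiv_0 [simp]: "mpoly_pderiv i 0 = 0"
  by (simp add: mpoly_pderiv_def)

lemma mpoly_pderiv_sum: "mpoly_pderiv i (sum f A) = (\<Sum>a\<in>A. mpoly_pderiv i (f a :: ('n, 'a::comm_ring_1) mpoly))"
  by (induction A rule: infinite_finite_induct) (auto simp: mpoly_pderiv_add)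

lemma mpoly_pderiv_single:
  "mpoly_pderiv i (Poly_Mapping.single m (a::'a::comm_ring_1)) =
     Poly_Mapping.single (m - Poly_Mapping.single i 1) (of_nat (Poly_Mapping.lookup m i) * a)"
  by (cases "a = 0") (auto simp: mpoly_pderiv_def)

lemma mpoly_pderiv_mult:
  "mpoly_pderiv i (p * q) = mpoly_pderiv i p * q + p * mpoly_pderiv i (q :: ('n, 'a::comm_ring_1) mpoly)"
proof -
  let ?e = "Poly_Mapping.single i (1::nat)"
  have s: "mpoly_pderiv i (Poly_Mapping.single m a * Poly_Mapping.single n b) =
     mpoly_pderiv i (Poly_Mapping.single m a) * Poly_Mapping.single n b +
     Poly_Mapping.single m a * mpoly_pderiv i (Poly_Mapping.single n (b::'a))" for m n a b
  proof -
    have shift: "k + l - ?e = (k - ?e) + l" if "Poly_Mapping.lookup k i \<noteq> 0" for k l :: "'n \<Rightarrow>\<^sub>0 nat"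
      by (rule poly_mapping_eqI) (use that in \<open>auto simp: lookup_add lookup_minus lookup_single when_def\<close>)
    show ?thesis
      using shift[of m n] shift[of n m]
      by (cases "Poly_Mapping.lookup m i = 0"; cases "Poly_Mapping.lookup n i = 0")
         (auto simp: mult_single mpoly_pderiv_single lookup_add algebra_simps single_add)
  qed
  have "mpoly_pderiv i (p * q) = mpoly_pderiv i (\<Sum>m\<in>Poly_Mapping.keys p. \<Sum>n\<in>Poly_Mapping.keys q.
     Poly_Mapping.single m (Poly_Mapping.lookup p m) * Poly_Mapping.single n (Poly_Mapping.lookup q n))"
    by (subst mpoly_mult_monomials) (rule refl)
  also have "\<dots> = mpoly_pderiv i (\<Sum>m\<in>Poly_Mapping.keys p. Poly_Mapping.single m (Poly_Mapping.lookup p m)) *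
      (\<Sum>n\<in>Poly_Mapping.keys q. Poly_Mapping.single n (Poly_Mapping.lookup q n)) +
      (\<Sum>m\<in>Poly_Mapping.keys p. Poly_Mapping.single m (Poly_Mapping.lookup p m)) *
      mpoly_pderiv i (\<Sum>n\<in>Poly_Mapping.keys q. Poly_Mapping.single n (Poly_Mapping.lookup q n))"
    by (simp only: mpoly_pderiv_sum s sum.distrib sum_product)
  finally show ?thesis by (simp only: mpoly_sum_monomials[symmetric])
qed

lemma mpoly_pderiv_const [simp]: "mpoly_pderiv i (mpoly_const (a::'a::comm_ring_1)) = 0"
  by (simp add: mpoly_const_def mpoly_pderiv_single)

lemma mpoly_pderiv_var: "mpoly_pderiv i (mpoly_var j) = (if i = j then 1 else (0 :: ('n, 'a::comm_ring_1) mpoly))"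
  by (simp add: mpoly_var_def mpoly_pderiv_single lookup_single)

lemma mpoly_pderiv_commute:
  "mpoly_pderiv i (mpoly_pderiv j p) = mpoly_pderiv j (mpoly_pderiv i (p :: ('n, 'a::comm_ring_1) mpoly))"
  by (rule poly_mapping_eqI) (auto simp: lookup_mpoly_pderiv lookup_add lookup_single when_def algebra_simps)

text \<open>The product rule is twisted by \<open>\<phi>\<close> because composites such as
  \<open>\<lambda>p. pderiv (flow h p)\<close> are derivations only over the homomorphism
  \<open>flow h\<close>.\<close>

definition derivation_along :: "('r::comm_ring_1 \<Rightarrow> 's::comm_ring_1) \<Rightarrow> ('r \<Rightarrow> 's) \<Rightarrow> bool" where
  "derivation_along \<phi> \<delta> \<longleftrightarrow> (\<forall>p q. \<delta> (p + q) = \<delta> p + \<delta> q) \<and> (\<forall>p q. \<delta> (p * q) = \<delta> p * \<phi> q + \<phi> p * \<delta> q)"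

text \<open>Both sides are additive, obey the same product rule, and agree on constants and
  variables. Euler's identity, the chain rule for substitutions and the differential equation of the
  flow are instances.\<close>

lemma derivation_chain_rule:
  fixes p :: "('n::finite, 'a::comm_ring_1) mpoly"
  assumes \<phi>: "ring_hom_fun \<phi>" and \<delta>: "derivation_along \<phi> \<delta>" and c: "\<And>a. \<delta> (mpoly_const a) = 0"
  shows "\<delta> p = (\<Sum>i\<in>UNIV. \<phi> (mpoly_pderiv i p) * \<delta> (mpoly_var i))"
proof (induction p rule: mpoly_induct)
  case (const a)
  thus ?case by (simp add: c ring_hom_funD[OF \<phi>])
next
  case (var j)
  have "(\<Sum>i\<in>UNIV. \<phi> (mpoly_pderiv i (mpoly_var j)) * \<delta> (mpoly_var i)) = (\<Sum>i\<in>UNIV. if i = j then \<delta> (mpoly_var i) else 0)"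
    by (intro sum.cong) (auto simp: mpoly_pderiv_var ring_hom_funD[OF \<phi>])
  thus ?case by simp
next
  case (add p q)
  thus ?case using \<delta> by (simp add: derivation_along_def mpoly_pderiv_add ring_hom_funD[OF \<phi>] algebra_simps sum.distrib)
next
  case (mult p q)
  have "\<delta> (p * q) = \<delta> p * \<phi> q + \<phi> p * \<delta> q" using \<delta> by (simp add: derivation_along_def)
  thus ?case
    unfolding mult
    by (simp add: mpoly_pderiv_mult ring_hom_funD[OF \<phi>] algebra_simps sum.distrib sum_distrib_left)
qed

text \<open>Reduction modulo \<open>G\<close> without a quotient ring. Congruence passes to products
  by \<open>\<phi> p \<phi> q - \<psi> p \<psi> q = (\<phi> p - \<psi> p) \<phi> q + \<psi> p
  (\<phi> q - \<psi> q)\<close>.\<close>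

lemma hom_cong_dvd:
  fixes p :: "('n::finite, 'a::comm_ring_1) mpoly"
  assumes \<phi>: "ring_hom_fun \<phi>" and \<psi>: "ring_hom_fun \<psi>"
    and "\<And>a. \<phi> (mpoly_const a) = \<psi> (mpoly_const a)" and "\<And>i. G dvd \<phi> (mpoly_var i) - \<psi> (mpoly_var i)"
  shows "G dvd \<phi> p - \<psi> p"
proof (induction p rule: mpoly_induct)
  case (add p q)
  have "\<phi> (p + q) - \<psi> (p + q) = (\<phi> p - \<psi> p) + (\<phi> q - \<psi> q)"
    by (simp add: ring_hom_funD[OF \<phi>] ring_hom_funD[OF \<psi>])
  thus ?case using add by (metis dvd_add)
next
  case (mult p q)
  have "\<phi> (p * q) - \<psi> (p * q) = (\<phi> p - \<psi> p) * \<phi> q + \<psi> p * (\<phi> q - \<psi> q)"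
    by (simp add: ring_hom_funD[OF \<phi>] ring_hom_funD[OF \<psi>] algebra_simps)
  thus ?case using mult by (metis dvd_add dvd_mult dvd_mult2)
qed (use assms in auto)

subsection \<open>Unique factorisation and elimination in four variables\<close>

definition peval :: "('n::finite \<Rightarrow> 'a) \<Rightarrow> ('n, 'a::comm_ring_1) mpoly \<Rightarrow> 'a" where
  "peval a = msub (\<lambda>x. x) a"

lemma ring_hom_fun_peval [simp]: "ring_hom_fun (peval a)"
  unfolding peval_def by (rule ring_hom_fun_msub) simp

lemma peval_const [simp]: "peval a (mpoly_const c) = c"
  by (simp add: peval_def msub_const)

lemma peval_var [simp]: "peval a (mpoly_var i) = a i"
  by (simp add: peval_def msub_var)

lemmas peval_hom [simp] = ring_hom_funD[OF ring_hom_fun_peval]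

lemma peval_msub: "peval a (msub mpoly_const g p) = peval (\<lambda>i. peval a (g i)) p"
  by (subst hom_msub) (auto simp: peval_def[of "\<lambda>i. peval a (g i)"])

text \<open>Transport to iterated univariate polynomials, where unique factorisation is available.
  The outermost indeterminate is \<open>x_4\<close>, so that eliminating \<open>x_4\<close> is a
  statement about univariate polynomials over a factorial ring.\<close>

definition nested_poly :: "(4, 'a::comm_ring_1) mpoly \<Rightarrow> 'a poly poly poly poly" where
  "nested_poly = msub (\<lambda>c. [:[:[:[:c:]:]:]:])
     (\<lambda>i. if i = 1 then [:[:[:[:0, 1:]:]:]:] else if i = 2 then [:[:[:0, 1:]:]:]
          else if i = 3 then [:[:0, 1:]:] else [:0, 1:])"

lemma ring_hom_fun_pCons4: "ring_hom_fun (\<lambda>c::'a::comm_ring_1. [:[:[:[:c:]:]:]:])"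
  by (simp add: ring_hom_fun_def)

lemma ring_hom_fun_nested_poly [simp]: "ring_hom_fun nested_poly"
  unfolding nested_poly_def by (rule ring_hom_fun_msub[OF ring_hom_fun_pCons4])

lemmas nested_poly_hom = ring_hom_funD[OF ring_hom_fun_nested_poly]

lemma neq_4: "(1::4) \<noteq> 2" "(1::4) \<noteq> 3" "(1::4) \<noteq> 4" "(2::4) \<noteq> 3" "(2::4) \<noteq> 4" "(3::4) \<noteq> 4"
  "(2::4) \<noteq> 1" "(3::4) \<noteq> 1" "(4::4) \<noteq> 1" "(3::4) \<noteq> 2" "(4::4) \<noteq> 2" "(4::4) \<noteq> 3"
  by simp_all

lemma prod_4: "(\<Prod>i\<in>UNIV. f (i::4)) = f 1 * f 2 * f 3 * (f 4 :: 'b::comm_monoid_mult)"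
  unfolding UNIV_4 by (simp add: ac_simps)

lemma nested_poly_single:
  "nested_poly (Poly_Mapping.single m a) =
     monom (monom (monom (monom a (Poly_Mapping.lookup m 1)) (Poly_Mapping.lookup m 2))
       (Poly_Mapping.lookup m 3)) (Poly_Mapping.lookup m 4)"
proof -
  have X: "pCons 0 1 = monom (1::'b::comm_ring_1) 1" by (simp add: monom_altdef)
  have C: "[:x:] = monom x 0" for x :: "'b::zero" by (simp add: monom_0)
  have 1: "1 = monom (1::'b::comm_ring_1) 0" by simp
  show ?thesis
    unfolding nested_poly_def msub_single[OF ring_hom_fun_pCons4] prod_4
    by (simp add: X C monom_power mult_monom neq_4 del: One_nat_def)
qed

lemma coeff_nested_poly:
  "coeff (coeff (coeff (coeff (nested_poly p) (Poly_Mapping.lookup m 4)) (Poly_Mapping.lookup m 3))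
     (Poly_Mapping.lookup m 2)) (Poly_Mapping.lookup m 1) = Poly_Mapping.lookup p m"
proof -
  have m: "k = m \<longleftrightarrow> Poly_Mapping.lookup k 4 = Poly_Mapping.lookup m 4 \<and> Poly_Mapping.lookup k 3 = Poly_Mapping.lookup m 3 \<and>
     Poly_Mapping.lookup k 2 = Poly_Mapping.lookup m 2 \<and> Poly_Mapping.lookup k 1 = Poly_Mapping.lookup m 1" for k
    unfolding poly_mapping_eq_iff fun_eq_iff forall_4 by auto
  have "nested_poly p = (\<Sum>k\<in>Poly_Mapping.keys p. nested_poly (Poly_Mapping.single k (Poly_Mapping.lookup p k)))"
    by (subst mpoly_sum_monomials) (rule nested_poly_hom)
  hence "coeff (coeff (coeff (coeff (nested_poly p) (Poly_Mapping.lookup m 4)) (Poly_Mapping.lookup m 3))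
     (Poly_Mapping.lookup m 2)) (Poly_Mapping.lookup m 1) =
     (\<Sum>k\<in>Poly_Mapping.keys p. if k = m then Poly_Mapping.lookup p k else 0)"
    by (simp add: nested_poly_single coeff_sum m if_distrib[where f = "\<lambda>q. coeff q _"] if_distribR cong: if_cong)
       (intro sum.cong, auto)
  thus ?thesis by (simp add: in_keys_iff)
qed

lemma nested_poly_inj: "nested_poly p = nested_poly q \<Longrightarrow> p = q"
  by (rule poly_mapping_eqI) (metis coeff_nested_poly)

lemma poly_subring_eq_UNIV:
  assumes "\<And>c. [:c:] \<in> S" "[:0, 1::'a::comm_ring_1:] \<in> S"
    "\<And>p q. p \<in> S \<Longrightarrow> q \<in> S \<Longrightarrow> p + q \<in> S" "\<And>p q. p \<in> S \<Longrightarrow> q \<in> S \<Longrightarrow> p * q \<in> S"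
  shows "p \<in> S"
proof (induction p)
  case 0
  show ?case using assms(1)[of 0] by simp
next
  case (pCons a p)
  have "pCons a p = [:a:] + [:0, 1:] * p" by simp
  thus ?case using pCons assms by metis
qed

text \<open>The image is a subring containing the constants and the four indeterminates; it is
  filled layer by layer, starting with the innermost coefficients.\<close>

lemma nested_poly_surj: "\<exists>p. nested_poly p = q"
proof -
  let ?S = "range (nested_poly :: (4, 'a) mpoly \<Rightarrow> _)"
  have add: "p + q \<in> ?S" if "p \<in> ?S" "q \<in> ?S" for p q
    using that by (auto simp flip: nested_poly_hom)
  have mult: "p * q \<in> ?S" if "p \<in> ?S" "q \<in> ?S" for p q
    using that by (auto simp flip: nested_poly_hom)
  have add3: "[:p + q:] \<in> ?S" if "[:p:] \<in> ?S" "[:q:] \<in> ?S" for p q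
    using add[OF that] by simp
  have mult3: "[:p * q:] \<in> ?S" if "[:p:] \<in> ?S" "[:q:] \<in> ?S" for p q
    using mult[OF that] by (simp add: mult.commute)
  have c: "[:[:[:[:c:]:]:]:] \<in> ?S" for c
    by (rule range_eqI[of _ _ "mpoly_const c"]) (simp add: nested_poly_def msub_const[OF ring_hom_fun_pCons4])
  have v: "nested_poly (mpoly_var i) \<in> ?S" for i by simp
  note v = v[unfolded nested_poly_def msub_var[OF ring_hom_fun_pCons4], folded nested_poly_def]
  have 1: "[:[:[:p:]:]:] \<in> ?S" for p
    by (rule poly_subring_eq_UNIV[of "{p. [:[:[:p:]:]:] \<in> ?S}", simplified mem_Collect_eq])
       (use c v[of 1] add3 mult3 add3[of "[:_:]" "[:_:]"] mult3[of "[:_:]" "[:_:]"] add3[of "[:[:_:]:]" "[:[:_:]:]"] mult3[of "[:[:_:]:]" "[:[:_:]:]"] in \<open>auto\<close>)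
  have 2: "[:[:p:]:] \<in> ?S" for p
    by (rule poly_subring_eq_UNIV[of "{p. [:[:p:]:] \<in> ?S}", simplified mem_Collect_eq])
       (use 1 v[of 2] add3[of "[:_:]" "[:_:]"] mult3[of "[:_:]" "[:_:]"] in \<open>auto\<close>)
  have 3: "[:p:] \<in> ?S" for p
    by (rule poly_subring_eq_UNIV[of "{p. [:p:] \<in> ?S}", simplified mem_Collect_eq])
       (use 2 v[of 3] add3 mult3 in \<open>auto\<close>)
  have "q \<in> ?S"
    by (rule poly_subring_eq_UNIV[of ?S]) (use 3 v[of 4] add mult in \<open>auto\<close>)
  thus ?thesis by auto
qed

lemma nested_poly_dvd_iff: "nested_poly p dvd nested_poly q \<longleftrightarrow> p dvd q"
proof
  assume "nested_poly p dvd nested_poly q"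
  then obtain k where "nested_poly q = nested_poly p * k" ..
  moreover obtain l where "k = nested_poly l" using nested_poly_surj by metis
  ultimately have "q = p * l" by (intro nested_poly_inj) (simp add: nested_poly_hom)
  thus "p dvd q" by simp
qed (auto simp: nested_poly_hom elim!: dvdE)

lemma nested_poly_prime_elem_iff: "prime_elem (nested_poly p) \<longleftrightarrow> prime_elem p"
proof -
  have all: "(\<forall>q. P q) \<longleftrightarrow> (\<forall>p. P (nested_poly p))" for P :: "'a poly poly poly poly \<Rightarrow> bool"
    using nested_poly_surj by metis
  have "(\<forall>a b. nested_poly p dvd a * b \<longrightarrow> nested_poly p dvd a \<or> nested_poly p dvd b) \<longleftrightarrow>
        (\<forall>a b. p dvd a * b \<longrightarrow> p dvd a \<or> p dvd b)"
    by (simp only: all flip: nested_poly_hom(3)) (simp only: nested_poly_dvd_iff)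
  moreover have "nested_poly p = 0 \<longleftrightarrow> p = 0"
    by (metis nested_poly_inj nested_poly_hom(4))
  moreover have "nested_poly p dvd 1 \<longleftrightarrow> p dvd 1"
    by (metis nested_poly_dvd_iff nested_poly_hom(1))
  ultimately show ?thesis by (simp add: prime_elem_def)
qed

section \<open>Prime factors and zeros\<close>

lemma mpoly_prime_factors:
  fixes p :: "(4, 'k::field) mpoly"
  assumes "p \<noteq> 0" "\<not> p dvd 1"
  shows "\<exists>F. p = prod_mset F \<and> (\<forall>q\<in>#F. prime_elem q)"
proof -
  have "nested_poly p \<noteq> 0" using assms(1) by (metis nested_poly_inj nested_poly_hom(4))
  moreover have "\<not> nested_poly p dvd 1" using assms(2) by (metis nested_poly_dvd_iff nested_poly_hom(1))
  ultimately obtain F where F: "mset_factors F (nested_poly p)" using mset_factors_exist by blast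
  obtain unnest where unnest: "\<And>q. nested_poly (unnest q) = (q :: 'k poly poly poly poly)"
    using nested_poly_surj by metis
  have "nested_poly (prod_mset (image_mset unnest G)) = prod_mset G" for G
    by (induction G) (auto simp: unnest nested_poly_hom)
  hence "nested_poly (prod_mset (image_mset unnest F)) = nested_poly p"
    using F by (simp add: mset_factors_def)
  hence "p = prod_mset (image_mset unnest F)" by (metis nested_poly_inj)
  moreover have "prime_elem q" if q: "q \<in># image_mset unnest F" for q
  proof -
    obtain f where "f \<in># F" "q = unnest f" using q by auto
    hence "prime_elem (nested_poly q)" using F by (simp add: mset_factors_def unnest)
    thus ?thesis by (simp only: nested_poly_prime_elem_iff)
  qed
  ultimately show ?thesis by (intro exI[of _ "image_mset unnest F"]) simp
qed

lemma prime_elem_dvd_prod_mset: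
  assumes "prime_elem (q :: 'a::comm_semiring_1)" "q dvd prod_mset F"
  shows "\<exists>f\<in>#F. q dvd f"
  using assms(2)
proof (induction F)
  case empty
  thus ?case using assms(1) by (auto simp: prime_elem_def)
next
  case (add f F)
  thus ?case using assms(1) by (auto simp: prime_elem_dvd_mult_iff)
qed

lemma prime_factors_dvd: "p = prod_mset F \<Longrightarrow> q \<in># F \<Longrightarrow> q dvd (p :: 'a::comm_semiring_1)"
  by (erule ssubst) (rule dvd_prod_mset)

text \<open>A product vanishes at a point only if some factor does. This replaces the choice of an
  irreducible component of the hypersurface \<open>p = 0\<close> through \<open>a\<close>.\<close>

lemma mpoly_prime_divisor_zero:
  fixes p :: "(4, 'k::field) mpoly"
  assumes "p \<noteq> 0" "peval a p = 0"
  shows "\<exists>q. prime_elem q \<and> q dvd p \<and> peval a q = 0"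
proof -
  have "\<not> p dvd 1"
  proof
    assume "p dvd 1"
    then obtain k where "1 = p * k" ..
    hence "peval a 1 = peval a p * peval a k" by (metis peval_hom(3))
    thus False using assms by simp
  qed
  then obtain F where F: "p = prod_mset F" "\<forall>q\<in>#F. prime_elem q"
    using mpoly_prime_factors[OF assms(1)] by blast
  have "peval a (prod_mset G) = 0 \<Longrightarrow> \<exists>q\<in>#G. peval a q = 0" for G
    by (induction G) auto
  then obtain q where q: "q \<in># F" "peval a q = 0" using assms(2) F(1) by metis
  thus ?thesis using prime_factors_dvd[OF F(1)] F(2) by metis
qed

text \<open>Up to units, each \<open>G x\<close> is one of the finitely many prime factors of
  \<open>p\<close>, so two of infinitely many coincide. All arguments of the kind "for almost every
  \<kappa>" end here, since different members of a pencil cannot share a prime.\<close>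

lemma finite_prime_divisors_pigeonhole:
  fixes p :: "(4, 'k::field) mpoly"
  assumes "p \<noteq> 0" "infinite I" "\<And>x. x \<in> I \<Longrightarrow> prime_elem (G x) \<and> G x dvd p"
  shows "\<exists>x\<in>I. \<exists>y\<in>I. x \<noteq> y \<and> G x dvd G y"
proof -
  have I: "I \<noteq> {}" using assms(2) by auto
  have "\<not> p dvd 1"
    using assms(3) I by (metis dvd_trans ex_in_conv prime_elem_not_unit)
  then obtain F where F: "p = prod_mset F" "\<forall>q\<in>#F. prime_elem q"
    using mpoly_prime_factors[OF assms(1)] by blast
  have "\<exists>f\<in>#F. G x dvd f" if "x \<in> I" for x
    using prime_elem_dvd_prod_mset assms(3)[OF that] F by metis
  then obtain f where f: "\<And>x. x \<in> I \<Longrightarrow> f x \<in># F \<and> G x dvd f x" by metis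
  have "finite (f ` I)" by (rule finite_subset[of _ "set_mset F"]) (use f in auto)
  then obtain q where q: "infinite {x\<in>I. f x = f q}" "q \<in> I"
    using pigeonhole_infinite[OF assms(2)] by blast
  have "\<exists>y\<in>{x\<in>I. f x = f q}. y \<noteq> q"
    using q by (metis (no_types, lifting) finite.emptyI finite_insert finite_subset insertI1 subsetI)
  then obtain y where y: "y \<in> I" "f y = f q" "y \<noteq> q" by blast
  have pr: "prime_elem (f q)" by (rule bspec[OF F(2) conjunct1[OF f[OF q(2)]]])
  have "G y dvd f q" using f[OF y(1)] unfolding y(2) by (rule conjunct2)
  then obtain k where k: "f q = G y * k" by (rule dvdE)
  have "f q dvd G y * k" by (simp only: k[symmetric] dvd_refl)
  hence "f q dvd G y \<or> f q dvd k" by (rule prime_elem_dvd_multD[OF pr])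
  \<comment> \<open>Otherwise the cofactor \<open>G y\<close> would be a unit.\<close>
  moreover have "\<not> f q dvd k"
  proof
    assume "f q dvd k"
    then obtain l where l: "k = f q * l" by (rule dvdE)
    have "f q * (G y * l) = f q"
      by (subst (2) k, subst l) (simp only: mult_ac)
    hence "f q * (1 - G y * l) = 0" by (simp only: right_diff_distrib mult_1_right diff_self)
    hence "1 - G y * l = 0" using prime_elem_not_zeroI[OF pr] by (metis mult_eq_0_iff)
    hence "1 = G y * l" by (simp only: right_minus_eq)
    hence "G y dvd 1" by (rule dvdI)
    thus False using assms(3)[OF y(1)] by (simp only: prime_elem_def) blast
  qed
  ultimately have "G q dvd G y" using f q by (metis dvd_trans)
  thus ?thesis using y q by metis
qed

lemma poly_eq_0_if_infinite_roots:
  assumes "infinite S" "\<And>x. x \<in> S \<Longrightarrow> poly p x = (0::'a::idom)"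
  shows "p = 0"
  using poly_roots_finite[of p] assms by (metis (mono_tags, lifting) finite_subset mem_Collect_eq subsetI)

lemma infinite_range_inj: "inj f \<Longrightarrow> infinite (UNIV :: 'a set) \<Longrightarrow> infinite (range (f :: 'a \<Rightarrow> 'b))"
  using finite_imageD by blast

text \<open>A polynomial over a domain with infinitely many roots is 0, and the constants provide
  infinitely many arguments at every layer. So the evaluations can be removed one at a time,
  beginning with \<open>x_1\<close>.\<close>

lemma mpoly_eq_0_if_peval_eq_0:
  fixes p :: "(4, 'k::field_char_0) mpoly"
  assumes "\<And>a. peval a p = 0"
  shows "p = 0"
proof -
  have ev: "poly (poly (poly (poly (nested_poly q) [:[:[:a 4:]:]:]) [:[:a 3:]:]) [:a 2:]) (a 1) = peval a q" for a q
  proof (rule ring_hom_fun_eqI[where p = q])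
    show "ring_hom_fun (\<lambda>q. poly (poly (poly (poly (nested_poly q) [:[:[:a 4:]:]:]) [:[:a 3:]:]) [:a 2:]) (a 1))"
      by (simp add: ring_hom_fun_def nested_poly_hom)
    show "poly (poly (poly (poly (nested_poly (mpoly_const b)) [:[:[:a 4:]:]:]) [:[:a 3:]:]) [:a 2:]) (a 1) =
         peval a (mpoly_const b)" for b
      by (simp add: nested_poly_def msub_const[OF ring_hom_fun_pCons4])
    show "poly (poly (poly (poly (nested_poly (mpoly_var i)) [:[:[:a 4:]:]:]) [:[:a 3:]:]) [:a 2:]) (a 1) =
         peval a (mpoly_var i)" for i
      using exhaust_4[of i] by (auto simp: nested_poly_def msub_var[OF ring_hom_fun_pCons4])
  qed simp
  have inf: "infinite (UNIV :: 'k set)" by (rule infinite_UNIV_char_0)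
  have i1: "infinite (range (\<lambda>a::'k. [:a:]))" 
    by (rule infinite_range_inj[OF _ inf]) (simp add: inj_def)
  have i2: "infinite (range (\<lambda>a::'k. [:[:a:]:]))"
    by (rule infinite_range_inj[OF _ inf]) (simp add: inj_def)
  have i3: "infinite (range (\<lambda>a::'k. [:[:[:a:]:]:]))"
    by (rule infinite_range_inj[OF _ inf]) (simp add: inj_def)
  have "poly (poly (poly (poly (nested_poly p) [:[:[:d:]:]:]) [:[:c:]:]) [:b:]) e = 0" for b c d e
    using ev[of p "\<lambda>i. if i = 1 then e else if i = 2 then b else if i = 3 then c else d"] assms
    by (simp add: neq_4)
  hence "poly (poly (poly (nested_poly p) [:[:[:d:]:]:]) [:[:c:]:]) [:b:] = 0" for b c d
    using inf by (intro poly_eq_0_if_infinite_roots[of UNIV]) auto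
  hence "poly (poly (nested_poly p) [:[:[:d:]:]:]) [:[:c:]:] = 0" for c d
    by (intro poly_eq_0_if_infinite_roots[OF i1]) auto
  hence "poly (nested_poly p) [:[:[:d:]:]:] = 0" for d
    by (intro poly_eq_0_if_infinite_roots[OF i2]) auto
  hence "nested_poly p = 0"
    by (intro poly_eq_0_if_infinite_roots[OF i3]) auto
  thus ?thesis by (metis nested_poly_inj nested_poly_hom(4))
qed

text \<open>An element of least degree in the ideal pseudo-divides both generators, so a prime factor
  of it of positive degree would divide both.\<close>

lemma poly_elimination:
  fixes u v :: "'r::ufd poly"
  assumes "u \<noteq> 0" and no_common: "\<And>q. prime_elem q \<Longrightarrow> q dvd u \<Longrightarrow> q dvd v \<Longrightarrow> False"
  shows "\<exists>a b r. r \<noteq> 0 \<and> [:r:] = a * u + b * v"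
proof -
  define I where "I = {g. \<exists>a b. g = a * u + b * v}"
  have uv: "u \<in> I" "v \<in> I"
    unfolding I_def by (auto intro: exI[of _ 1] exI[of _ 0])
  define g where "g = (ARG_MIN degree g. g \<in> I \<and> g \<noteq> 0)"
  have g: "g \<in> I" "g \<noteq> 0" and gmin: "\<And>w. w \<in> I \<Longrightarrow> w \<noteq> 0 \<Longrightarrow> degree g \<le> degree w"
    using arg_min_nat_lemma[of "\<lambda>g. g \<in> I \<and> g \<noteq> 0" u degree] uv assms(1) unfolding g_def by auto
  have closed: "smult c w - g * q \<in> I" if w: "w \<in> I" for c w q
  proof -
    obtain a b a' b' where "w = a * u + b * v" "g = a' * u + b' * v" using w g unfolding I_def by auto
    hence "smult c w - g * q = (smult c a - q * a') * u + (smult c b - q * b') * v"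
      by (simp add: algebra_simps smult_add_right)
    thus ?thesis unfolding I_def by blast
  qed
  have dv: "\<exists>k. g dvd smult (lead_coeff g ^ k) w" if "w \<in> I" for w
  proof -
    obtain q r where qr: "pseudo_divmod w g = (q, r)" by fastforce
    define k where "k = Suc (degree w) - degree g"
    have *: "smult (lead_coeff g ^ k) w = g * q + r" "r = 0 \<or> degree r < degree g"
      using pseudo_divmod[OF g(2) qr] by (auto simp: k_def)
    have "r = smult (lead_coeff g ^ k) w - g * q" using * by simp
    hence "r \<in> I" using closed[OF that] by simp
    hence "r = 0" using *(2) gmin by force
    hence "g dvd smult (lead_coeff g ^ k) w" using *(1) by (auto intro: dvdI)
    thus ?thesis ..
  qed
  show ?thesis
  proof (cases "degree g = 0")
    case True
    then obtain r where "g = [:r:]" by (metis degree_eq_zeroE)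
    thus ?thesis using g unfolding I_def by auto
  next
    case False
    have "\<not> g dvd 1" using False dvd_imp_degree_le[of g 1] by auto
    then obtain F where F: "mset_factors F g" using mset_factors_exist g(2) by blast
    have "\<exists>f\<in>#G. degree f \<noteq> 0" if "degree (prod_mset G) \<noteq> 0" for G :: "'r poly multiset"
      using that
    proof (induction G)
      case (add x G)
      thus ?case using degree_mult_le[of x "prod_mset G"] by fastforce
    qed simp
    then obtain f where f: "f \<in># F" "degree f \<noteq> 0" using F False by (auto simp: mset_factors_def)
    have pf: "prime_elem f" "f dvd g" using F f by (auto simp: mset_factors_def dvd_prod_mset)
    have fd: "f dvd w" if w: "w \<in> I" for w
    proof -
      obtain k where "g dvd smult (lead_coeff g ^ k) w" using dv[OF w] by blast
      hence "f dvd [:lead_coeff g ^ k:] * w" using pf by (auto intro: dvd_trans)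
      moreover have "\<not> f dvd [:lead_coeff g ^ k:]"
      proof
        assume "f dvd [:lead_coeff g ^ k:]"
        hence "degree f \<le> degree [:lead_coeff g ^ k:]" using g(2) by (intro dvd_imp_degree_le) auto
        thus False using f by simp
      qed
      ultimately show ?thesis using pf by (metis prime_elem_dvd_multD)
    qed
    show ?thesis by (rule FalseE[OF no_common[OF pf(1) fd[OF uv(1)] fd[OF uv(2)]]])
  qed
qed

text \<open>A constant of the outermost layer is the same as a polynomial without
  \<open>x_4\<close>, so the univariate elimination applies.\<close>

lemma mpoly_elimination:
  fixes u v :: "(4, 'k::field) mpoly"
  assumes "u \<noteq> 0" and no_common: "\<And>q. prime_elem q \<Longrightarrow> q dvd u \<Longrightarrow> q dvd v \<Longrightarrow> False"
  shows "\<exists>a b r. r \<noteq> 0 \<and> r = a * u + b * v \<and> (\<forall>m\<in>Poly_Mapping.keys r. Poly_Mapping.lookup m 4 = 0)"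
proof -
  have nz: "nested_poly u \<noteq> 0" using assms(1) by (metis nested_poly_inj nested_poly_hom(4))
  have nc: False if q: "prime_elem q" "q dvd nested_poly u" "q dvd nested_poly v" for q
  proof -
    obtain q' where "q = nested_poly q'" using nested_poly_surj by metis
    hence "prime_elem q'" "q' dvd u" "q' dvd v"
      using q by (simp_all only: nested_poly_dvd_iff nested_poly_prime_elem_iff)
    thus False by (rule no_common)
  qed
  have "\<exists>a b r. r \<noteq> 0 \<and> [:r:] = a * nested_poly u + b * nested_poly v"
    by (rule poly_elimination[OF nz]) (rule nc)
  then obtain a b r where r: "r \<noteq> 0" "[:r:] = a * nested_poly u + b * nested_poly v"
    by (elim exE conjE)
  obtain a' b' where ab: "a = nested_poly a'" "b = nested_poly b'" using nested_poly_surj by metis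
  define r' where "r' = a' * u + b' * v"
  have r': "nested_poly r' = [:r:]" using r ab by (simp add: r'_def nested_poly_hom)
  have nz': "r' \<noteq> 0"
  proof
    assume "r' = 0"
    hence "[:r:] = 0" using r' by (simp only: nested_poly_hom)
    thus False using r(1) by simp
  qed
  have  "Poly_Mapping.lookup m 4 = 0" if "m \<in> Poly_Mapping.keys r'" for m
  proof (rule ccontr)
    assume "Poly_Mapping.lookup m 4 \<noteq> 0"
    hence "coeff [:r:] (Poly_Mapping.lookup m 4) = 0" by (cases "Poly_Mapping.lookup m 4") auto
    hence "Poly_Mapping.lookup r' m = 0" using coeff_nested_poly[of r' m] by (simp add: r')
    thus False using that by (simp add: in_keys_iff)
  qed
  thus ?thesis using nz' r'_def by (intro exI[of _ a'] exI[of _ b'] exI[of _ r'] conjI ballI)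
qed

subsection \<open>Homogeneous components and the flow of a vector field\<close>

definition mdeg :: "('n::finite \<Rightarrow>\<^sub>0 nat) \<Rightarrow> nat" where
  "mdeg m = (\<Sum>i\<in>UNIV. Poly_Mapping.lookup m i)"

lemma mdeg_add: "mdeg (m + n) = mdeg m + mdeg n"
  by (simp add: mdeg_def lookup_add sum.distrib)

lemma mdeg_single: "mdeg (Poly_Mapping.single i k) = k"
  by (simp add: mdeg_def lookup_single when_def)

text \<open>\<open>grade p\<close> is $p(t x)$ as a polynomial in $t$; its coefficients are the homogeneous components.\<close>

definition grade :: "('n::finite, 'a::comm_ring_1) mpoly \<Rightarrow> ('n, 'a) mpoly poly" where
  "grade = msub (\<lambda>c. [:mpoly_const c:]) (\<lambda>i. monom (mpoly_var i) 1)"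

lemma ring_hom_fun_pCons_const [simp]: "ring_hom_fun (\<lambda>c::'a::comm_ring_1. [:mpoly_const c :: ('n, 'a) mpoly:])"
  by (rule ring_hom_fun_comp[of "\<lambda>x. [:x:]" mpoly_const]) simp_all

lemma ring_hom_fun_grade [simp]: "ring_hom_fun grade"
  unfolding grade_def by (rule ring_hom_fun_msub) simp

lemmas grade_hom = ring_hom_funD[OF ring_hom_fun_grade]

lemma grade_const: "grade (mpoly_const c) = [:mpoly_const c:]"
  by (simp add: grade_def msub_const)

lemma grade_var: "grade (mpoly_var i) = monom (mpoly_var i) 1"
  by (simp add: grade_def msub_var)

lemma prod_monom: "(\<Prod>i\<in>A. monom (f i) (k i)) = monom (\<Prod>i\<in>A. f i :: 'a::comm_semiring_1) (\<Sum>i\<in>A. k i)"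
  by (induction A rule: infinite_finite_induct) (auto simp: mult_monom)

lemma grade_single: "grade (Poly_Mapping.single m a) = monom (Poly_Mapping.single m a) (mdeg m)"
proof -
  have "grade (Poly_Mapping.single m a) =
      [:mpoly_const a:] * (\<Prod>i\<in>UNIV. monom (mpoly_var i ^ Poly_Mapping.lookup m i) (Poly_Mapping.lookup m i))"
    unfolding grade_def by (subst msub_single) (simp_all add: monom_power)
  also have "\<dots> = monom (mpoly_const a * (\<Prod>i\<in>UNIV. mpoly_var i ^ Poly_Mapping.lookup m i)) (mdeg m)"
    by (simp add: prod_monom mdeg_def smult_monom)
  finally show ?thesis by (simp only: single_eq_const_mult_vars)
qed

lemma lookup_coeff_grade:
  "Poly_Mapping.lookup (coeff (grade p) n) m = (if mdeg m = n then Poly_Mapping.lookup p m else 0)"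
proof -
  have g: "grade p = (\<Sum>k\<in>Poly_Mapping.keys p. grade (Poly_Mapping.single k (Poly_Mapping.lookup p k)))"
    by (subst mpoly_sum_monomials) (rule grade_hom)
  have "Poly_Mapping.lookup (coeff (grade p) n) m = (\<Sum>k\<in>Poly_Mapping.keys p.
      Poly_Mapping.lookup (coeff (monom (Poly_Mapping.single k (Poly_Mapping.lookup p k)) (mdeg k)) n) m)"
    by (subst g) (simp only: coeff_sum lookup_sum grade_single)
  also have "\<dots> = (\<Sum>k\<in>Poly_Mapping.keys p. if k = m then (if mdeg m = n then Poly_Mapping.lookup p m else 0) else 0)"
    by (rule sum.cong) (auto simp: coeff_monom lookup_single)
  finally show ?thesis by (simp add: in_keys_iff)
qed

lemma poly_grade_1: "poly (grade p) 1 = p"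
  by (rule ring_hom_fun_eqI[where \<psi> = "\<lambda>x. x"])
     (auto simp: ring_hom_fun_comp[OF ring_hom_fun_poly ring_hom_fun_grade] grade_const grade_var poly_monom)

lemma grade_inj: "grade p = grade q \<Longrightarrow> p = q"
  by (metis poly_grade_1)

lemma grade_eq_0_iff [simp]: "grade p = 0 \<longleftrightarrow> p = 0"
  by (metis grade_inj grade_hom(4))

lemma homogeneous_iff_lookup:
  "homogeneous_mpoly d p \<longleftrightarrow> (\<forall>m. mdeg m \<noteq> d \<longrightarrow> Poly_Mapping.lookup p m = 0)"
  by (auto simp: homogeneous_mpoly_def mdeg_def in_keys_iff)

lemma homogeneous_iff_grade: "homogeneous_mpoly d p \<longleftrightarrow> grade p = monom p d"
proof -
  have "grade p = monom p d \<longleftrightarrow>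
     (\<forall>n m. Poly_Mapping.lookup (coeff (grade p) n) m = Poly_Mapping.lookup (coeff (monom p d) n) m)"
    unfolding poly_eq_iff poly_mapping_eq_iff fun_eq_iff ..
  also have "\<dots> \<longleftrightarrow> homogeneous_mpoly d p"
    unfolding lookup_coeff_grade homogeneous_iff_lookup coeff_monom by auto
  finally show ?thesis ..
qed

lemma homogeneous_coeff_grade: "homogeneous_mpoly n (coeff (grade p) n)"
  by (simp add: homogeneous_iff_lookup lookup_coeff_grade)

lemma homogeneous_0 [simp]: "homogeneous_mpoly d 0"
  by (simp add: homogeneous_mpoly_def)

lemma homogeneous_add: "homogeneous_mpoly d p \<Longrightarrow> homogeneous_mpoly d q \<Longrightarrow> homogeneous_mpoly d (p + q)"
  by (simp add: homogeneous_iff_lookup lookup_add)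

lemma homogeneous_sum:
  "(\<And>a. a \<in> A \<Longrightarrow> homogeneous_mpoly d (f a)) \<Longrightarrow> homogeneous_mpoly d (sum f A)"
  by (induction A rule: infinite_finite_induct) (auto intro: homogeneous_add)

lemma homogeneous_mult:
  "homogeneous_mpoly d p \<Longrightarrow> homogeneous_mpoly e q \<Longrightarrow> homogeneous_mpoly (d + e) (p * (q :: ('n::finite, 'a::comm_ring_1) mpoly))"
  by (simp add: homogeneous_iff_grade grade_hom mult_monom)

lemma homogeneous_const: "homogeneous_mpoly 0 (mpoly_const c :: ('n::finite, 'a::comm_ring_1) mpoly)"
  by (simp add: homogeneous_iff_grade grade_const monom_0)

lemma homogeneous_const_mult:
  "homogeneous_mpoly d p \<Longrightarrow> homogeneous_mpoly d (mpoly_const c * (p :: ('n::finite, 'a::comm_ring_1) mpoly))"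
  using homogeneous_mult[OF homogeneous_const, of d p c] by simp

lemma homogeneous_degree_0:
  assumes "homogeneous_mpoly 0 (p :: ('n::finite, 'a::comm_ring_1) mpoly)"
  shows "p = mpoly_const (Poly_Mapping.lookup p 0)"
proof (rule poly_mapping_eqI)
  fix m :: "'n \<Rightarrow>\<^sub>0 nat"
  have "mdeg m = 0 \<longleftrightarrow> m = 0"
    by (auto simp: mdeg_def intro!: poly_mapping_eqI)
  thus "Poly_Mapping.lookup p m = Poly_Mapping.lookup (mpoly_const (Poly_Mapping.lookup p 0)) m"
    using assms by (auto simp: homogeneous_iff_lookup mpoly_const_def lookup_single when_def)
qed

lemma pderiv_coeff_grade:
  "mpoly_pderiv i (coeff (grade p) (Suc n)) = coeff (grade (mpoly_pderiv i p)) n"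
  by (rule poly_mapping_eqI) (simp add: lookup_mpoly_pderiv lookup_coeff_grade mdeg_add mdeg_single)

lemma pderiv_coeff_grade_0: "mpoly_pderiv i (coeff (grade p) 0) = 0"
  by (rule poly_mapping_eqI) (simp add: lookup_mpoly_pderiv lookup_coeff_grade mdeg_add mdeg_single)

lemma homogeneous_pderiv:
  "homogeneous_mpoly (Suc d) p \<Longrightarrow> homogeneous_mpoly d (mpoly_pderiv i (p :: ('n::finite, 'a::comm_ring_1) mpoly))"
  by (simp add: homogeneous_iff_lookup lookup_mpoly_pderiv mdeg_add mdeg_single)

section \<open>Directional derivatives and homogeneous factors\<close>

definition dir_deriv :: "('n::finite \<Rightarrow> ('n, 'a) mpoly) \<Rightarrow> ('n, 'a::comm_ring_1) mpoly \<Rightarrow> ('n, 'a) mpoly" where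
  "dir_deriv h p = (\<Sum>i\<in>UNIV. h i * mpoly_pderiv i p)"

lemma dir_deriv_0 [simp]: "dir_deriv h 0 = 0"
  by (simp add: dir_deriv_def)

lemma dir_deriv_add: "dir_deriv h (p + q) = dir_deriv h p + dir_deriv h q"
  by (simp add: dir_deriv_def mpoly_pderiv_add algebra_simps sum.distrib)

lemma dir_deriv_mult: "dir_deriv h (p * q) = dir_deriv h p * q + p * dir_deriv h q"
  by (simp add: dir_deriv_def mpoly_pderiv_mult algebra_simps sum.distrib sum_distrib_left)

lemma dir_deriv_const: "dir_deriv h (mpoly_const c) = 0"
  by (simp add: dir_deriv_def)

lemma dir_deriv_var: "dir_deriv h (mpoly_var i) = h i"
proof -
  have "(\<Sum>j\<in>UNIV. h j * mpoly_pderiv j (mpoly_var i)) = (\<Sum>j\<in>UNIV. if j = i then h j else 0)"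
    by (intro sum.cong) (auto simp: mpoly_pderiv_var)
  thus ?thesis by (simp add: dir_deriv_def)
qed

text \<open>Differentiation in a constant direction lowers the degree, and a non-zero multiple of
  \<open>p\<close> cannot have smaller degree than \<open>p\<close>.\<close>

lemma dvd_dir_deriv_const:
  fixes p :: "('n::{finite,linorder}, 'a::idom) mpoly"
  assumes "p dvd dir_deriv (\<lambda>i. mpoly_const (c i)) p"
  shows "dir_deriv (\<lambda>i. mpoly_const (c i)) p = 0"
proof (rule ccontr)
  let ?D = "dir_deriv (\<lambda>i. mpoly_const (c i))"
  assume nz: "?D p \<noteq> 0"
  obtain q where q: "?D p = p * q" using assms by (rule dvdE)
  have "grade (?D p) = grade p * grade q" by (simp only: q grade_hom)
  moreover have "grade p \<noteq> 0" "grade q \<noteq> 0" using nz q by auto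
  ultimately have le: "degree (grade p) \<le> degree (grade (?D p))"
    by (simp add: degree_mult_eq)
  let ?n = "degree (grade (?D p))"
  have "coeff (grade (?D p)) ?n = ?D (coeff (grade p) (Suc ?n))"
    by (simp add: dir_deriv_def grade_hom grade_const coeff_sum pderiv_coeff_grade)
  moreover have "coeff (grade p) (Suc ?n) = 0" using le by (intro coeff_eq_0) simp
  ultimately have "coeff (grade (?D p)) ?n = 0" by simp
  thus False using nz by simp
qed

lemma dvd_pderiv:
  fixes p :: "('n::{finite,linorder}, 'a::idom) mpoly"
  assumes "p dvd mpoly_pderiv j p"
  shows "mpoly_pderiv j p = 0"
proof -
  have "dir_deriv (\<lambda>i. mpoly_const (if i = j then 1 else 0)) p = (\<Sum>i\<in>UNIV. if i = j then mpoly_pderiv i p else 0)"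
    unfolding dir_deriv_def by (intro sum.cong) (auto simp: mpoly_const_def)
  hence "dir_deriv (\<lambda>i. mpoly_const (if i = j then 1 else 0)) p = mpoly_pderiv j p" by simp
  thus ?thesis using dvd_dir_deriv_const[of p "\<lambda>i. if i = j then 1 else 0"] assms by simp
qed

text \<open>Differentiate \<open>p(t x) = t^d p(x)\<close> by \<open>t\<close> and put
  \<open>t = 1\<close>.\<close>

lemma euler_identity:
  fixes p :: "('n::{finite,linorder}, 'a::idom) mpoly"
  assumes "homogeneous_mpoly d p"
  shows "(\<Sum>i\<in>UNIV. mpoly_pderiv i p * mpoly_var i) = of_nat d * p"
proof -
  have "poly (pderiv (grade p)) 1 = (\<Sum>i\<in>UNIV. mpoly_pderiv i p * poly (pderiv (grade (mpoly_var i))) 1)"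
  proof (rule derivation_chain_rule[where \<phi> = "\<lambda>x. x"])
    show "derivation_along (\<lambda>x. x) (\<lambda>p::('n, 'a) mpoly. poly (pderiv (grade p)) 1)"
      unfolding derivation_along_def
      by (auto simp: grade_hom Polynomial.pderiv_add Polynomial.pderiv_mult poly_grade_1 mult_ac)
  qed (simp_all add: grade_const)
  moreover have "poly (pderiv (grade p)) 1 = of_nat d * p"
    using assms by (simp add: homogeneous_iff_grade pderiv_monom poly_monom)
  moreover have "poly (pderiv (grade (mpoly_var i :: ('n, 'a) mpoly))) 1 = mpoly_var i" for i
    by (simp add: grade_var pderiv_monom poly_monom)
  ultimately show ?thesis by simp
qed

lemma homogeneous_eq_0_if_pderiv_eq_0:
  fixes p :: "('n::{finite,linorder}, 'a::{idom,ring_char_0}) mpoly"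
  assumes "homogeneous_mpoly d p" "d > 0" "\<And>i. mpoly_pderiv i p = 0"
  shows "p = 0"
  using euler_identity[OF assms(1)] assms(2,3) by simp

text \<open>The lowest and the highest term of a product are the products of the lowest and of the
  highest terms. If they coincide for the product, they coincide for each factor.\<close>

lemma monom_if_mult_eq_monom:
  fixes p q :: "'a::idom poly"
  assumes "p * q = monom c d" "c \<noteq> 0"
  shows "p = monom (lead_coeff p) (degree p)"
proof -
  have nz: "p \<noteq> 0" "q \<noteq> 0"
    using assms by (metis monom_eq_0_iff mult_zero_left mult_zero_right)+
  define i where "i = (LEAST i. coeff p i \<noteq> 0)"
  define j where "j = (LEAST j. coeff q j \<noteq> 0)"
  have "\<exists>k. coeff p k \<noteq> 0" using nz by (metis leading_coeff_0_iff)
  from LeastI_ex[OF this, folded i_def] not_less_Least[of _ "\<lambda>k. coeff p k \<noteq> 0", folded i_def]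
  have i: "coeff p i \<noteq> 0" "\<And>k. k < i \<Longrightarrow> coeff p k = 0" by blast+
  have "\<exists>k. coeff q k \<noteq> 0" using nz by (metis leading_coeff_0_iff)
  from LeastI_ex[OF this, folded j_def] not_less_Least[of _ "\<lambda>k. coeff q k \<noteq> 0", folded j_def]
  have j: "coeff q j \<noteq> 0" "\<And>k. k < j \<Longrightarrow> coeff q k = 0" by blast+
  have "coeff (p * q) (i + j) = (\<Sum>k\<le>i + j. if k = i then coeff p i * coeff q j else 0)"
    unfolding coeff_mult
  proof (rule sum.cong)
    fix k assume "k \<in> {..i + j}"
    thus "coeff p k * coeff q (i + j - k) = (if k = i then coeff p i * coeff q j else 0)"
      using i(2)[of k] j(2)[of "i + j - k"] by (cases "k < i"; cases "k = i") auto
  qed simp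
  also have "\<dots> = coeff p i * coeff q j" by simp
  finally have "coeff (monom c d) (i + j) \<noteq> 0" using i j assms by simp
  hence "d = i + j" by (auto simp: coeff_monom split: if_splits)
  moreover have "degree p + degree q = d"
    using degree_mult_eq[OF nz] assms by (simp add: degree_monom_eq)
  moreover have "i \<le> degree p" "j \<le> degree q" using i j by (auto intro: le_degree)
  ultimately have id: "i = degree p" by simp
  show ?thesis
  proof (rule poly_eqI)
    fix n
    show "coeff p n = coeff (monom (lead_coeff p) (degree p)) n"
      using i(2)[of n] coeff_eq_0[of p n] id by (cases n "degree p" rule: linorder_cases) auto
  qed
qed

text \<open>Through the grading, being homogeneous means being a monomial in \<open>t\<close>, and
  this is inherited by factors.\<close>

lemma homogeneous_factor:
  fixes p q :: "('n::{finite,linorder}, 'a::idom) mpoly"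
  assumes "homogeneous_mpoly d (p * q)" "p * q \<noteq> 0"
  shows "\<exists>k. homogeneous_mpoly k p"
proof -
  have "grade p * grade q = monom (p * q) d"
    using assms(1) by (simp only: homogeneous_iff_grade grade_hom)
  hence *: "grade p = monom (lead_coeff (grade p)) (degree (grade p))"
    using assms(2) by (rule monom_if_mult_eq_monom)
  have "lead_coeff (grade p) = p"
    using arg_cong[OF *, of "\<lambda>q. poly q 1"] by (simp add: poly_grade_1 poly_monom)
  thus ?thesis using * by (metis homogeneous_iff_grade)
qed

lemma homogeneous_cofactor:
  fixes p q :: "('n::{finite,linorder}, 'a::idom) mpoly"
  assumes "homogeneous_mpoly d (p * q)" "homogeneous_mpoly k p" "p \<noteq> 0"
  shows "homogeneous_mpoly (d - k) q"
proof (cases "q = 0")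
  case False
  hence nz: "q * p \<noteq> 0" using assms(3) by simp
  then obtain l where l: "homogeneous_mpoly l q" using homogeneous_factor[of d q p] assms(1) by (auto simp: mult.commute)
  have "monom (p * q) d = monom (p * q) (k + l)"
    using assms(1) homogeneous_mult[OF assms(2) l] by (simp add: homogeneous_iff_grade)
  from arg_cong[OF this, of "\<lambda>r. coeff r d"] have "d = k + l"
    using nz by (simp add: mult.commute split: if_splits)
  thus ?thesis using l by simp
qed simp

lemma peval_scale:
  assumes "homogeneous_mpoly d p"
  shows "peval (\<lambda>i. t * a i) p = t ^ d * peval a p"
proof -
  have "peval a (poly (grade p) (mpoly_const t)) = peval (\<lambda>i. t * a i) p" for p
    by (rule ring_hom_fun_eqI[OF ring_hom_fun_comp[OF ring_hom_fun_peval ring_hom_fun_comp[OF ring_hom_fun_poly ring_hom_fun_grade]]])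
       (simp_all add: grade_const grade_var poly_monom)
  from this[of p] show ?thesis using assms by (simp add: homogeneous_iff_grade poly_monom mult.commute)
qed

text \<open>\<open>flow h p\<close> is $p(x + t h(x))$ as a polynomial in $t$.\<close>

definition flow :: "('n::finite \<Rightarrow> ('n, 'a) mpoly) \<Rightarrow> ('n, 'a::comm_ring_1) mpoly \<Rightarrow> ('n, 'a) mpoly poly" where
  "flow h = msub (\<lambda>c. [:mpoly_const c:]) (\<lambda>i. [:mpoly_var i, h i:])"

lemma ring_hom_fun_flow [simp]: "ring_hom_fun (flow h)"
  unfolding flow_def by (rule ring_hom_fun_msub) simp

lemmas flow_hom = ring_hom_funD[OF ring_hom_fun_flow]

lemma flow_const: "flow h (mpoly_const c) = [:mpoly_const c:]"
  by (simp add: flow_def msub_const)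

lemma flow_var: "flow h (mpoly_var i) = [:mpoly_var i, h i:]"
  by (simp add: flow_def msub_var)

lemma coeff_flow_0: "coeff (flow h p) 0 = p"
proof -
  have "poly (flow h p) 0 = p"
    by (rule ring_hom_fun_eqI[OF ring_hom_fun_comp[OF ring_hom_fun_poly ring_hom_fun_flow] ring_hom_fun_id])
       (simp_all add: flow_const flow_var)
  thus ?thesis by (simp add: poly_0_coeff_0)
qed

lemma peval_flow: "peval a (poly (flow h p) (mpoly_const t)) = peval (\<lambda>i. a i + t * peval a (h i)) p"
  by (rule ring_hom_fun_eqI[OF ring_hom_fun_comp[OF ring_hom_fun_peval ring_hom_fun_comp[OF ring_hom_fun_poly ring_hom_fun_flow]]])
     (simp_all add: flow_const flow_var)

lemma map_poly_dir_deriv_add: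
  "map_poly (dir_deriv h) (p + q) = map_poly (dir_deriv h) p + map_poly (dir_deriv h) q"
  by (rule poly_eqI) (simp add: coeff_map_poly dir_deriv_add)

lemma map_poly_dir_deriv_pCons:
  "map_poly (dir_deriv h) (pCons a p) = pCons (dir_deriv h a) (map_poly (dir_deriv h) p)"
  by (rule poly_eqI) (simp add: coeff_map_poly coeff_pCons split: nat.splits)

lemma map_poly_dir_deriv_mult:
  "map_poly (dir_deriv h) (p * q) = map_poly (dir_deriv h) p * q + p * map_poly (dir_deriv h) q"
proof (rule poly_eqI)
  fix n
  have s: "dir_deriv h (sum f A) = (\<Sum>a\<in>A. dir_deriv h (f a))" for f :: "nat \<Rightarrow> _" and A
    by (induction A rule: infinite_finite_induct) (auto simp: dir_deriv_add)
  show "coeff (map_poly (dir_deriv h) (p * q)) n =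
     coeff (map_poly (dir_deriv h) p * q + p * map_poly (dir_deriv h) q) n"
    by (simp add: coeff_map_poly coeff_mult s dir_deriv_mult sum.distrib)
qed

text \<open>Both sides are derivations along \<open>flow h\<close> with the same values on the variables.\<close>

lemma pderiv_flow:
  fixes h :: "'n::{finite,linorder} \<Rightarrow> ('n, 'a::idom) mpoly"
  assumes "\<And>i. dir_deriv h (h i) = 0"
  shows "pderiv (flow h p) = map_poly (dir_deriv h) (flow h p)"
proof -
  have "pderiv (flow h p) = (\<Sum>i\<in>UNIV. flow h (mpoly_pderiv i p) * pderiv (flow h (mpoly_var i)))"
    by (rule derivation_chain_rule[where \<delta> = "\<lambda>p. pderiv (flow h p)"])
       (auto simp: derivation_along_def flow_hom Polynomial.pderiv_add Polynomial.pderiv_mult flow_const algebra_simps)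
  moreover have "map_poly (dir_deriv h) (flow h p) =
      (\<Sum>i\<in>UNIV. flow h (mpoly_pderiv i p) * map_poly (dir_deriv h) (flow h (mpoly_var i)))"
    by (rule derivation_chain_rule[where \<delta> = "\<lambda>p. map_poly (dir_deriv h) (flow h p)"])
       (auto simp: derivation_along_def flow_hom map_poly_dir_deriv_mult map_poly_dir_deriv_add map_poly_dir_deriv_pCons
         flow_const dir_deriv_const)
  moreover have "pderiv (flow h (mpoly_var i)) = map_poly (dir_deriv h) (flow h (mpoly_var i))" for i
    by (simp add: flow_var map_poly_dir_deriv_pCons assms dir_deriv_var Polynomial.pderiv_pCons)
  ultimately show ?thesis by simp
qed

text \<open>The flow is the exponential series of \<open>t D\<close>: comparing coefficients in the
  differential equation gives \<open>(n + 1) c_(n+1) = D c_n\<close>. Since \<open>D\<close> kills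
  all \<open>h i\<close>, the orbits are the straight lines \<open>x + t h(x)\<close>.\<close>

lemma flow_eq_const_iff:
  fixes h :: "'n::{finite,linorder} \<Rightarrow> ('n, 'a::{idom,ring_char_0}) mpoly"
  assumes "\<And>i. dir_deriv h (h i) = 0"
  shows "flow h p = [:p:] \<longleftrightarrow> dir_deriv h p = 0"
proof -
  have step: "of_nat (Suc n) * coeff (flow h p) (Suc n) = dir_deriv h (coeff (flow h p) n)" for n
    using arg_cong[OF pderiv_flow[OF assms, of p], of "\<lambda>q. coeff q n"]
    by (simp only: coeff_pderiv coeff_map_poly[where f = "dir_deriv h", OF dir_deriv_0])
  show ?thesis
  proof
    assume "flow h p = [:p:]"
    thus "dir_deriv h p = 0" using step[of 0] by simp
  next
    assume 0: "dir_deriv h p = 0"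
    have "coeff (flow h p) (Suc n) = 0" for n
    proof (induction n)
      case 0
      show ?case using step[of 0] \<open>dir_deriv h p = 0\<close> by (simp add: coeff_flow_0)
    next
      case (Suc n)
      have "of_nat (Suc (Suc n)) * coeff (flow h p) (Suc (Suc n)) = 0"
        unfolding step Suc by simp
      thus ?case by (simp only: mult_eq_0_iff of_nat_eq_0_iff) simp
    qed
    hence "coeff (flow h p) n = coeff [:p:] n" for n by (cases n) (auto simp: coeff_flow_0)
    thus "flow h p = [:p:]" by (intro poly_eqI)
  qed
qed

text \<open>Degrees in \<open>t\<close> add up over a domain, so a factor of a polynomial constant
  along the flow is constant along the flow. This is the factorial closedness of the kernel of a
  locally nilpotent derivation.\<close>

lemma dir_deriv_factor:
  fixes h :: "'n::{finite,linorder} \<Rightarrow> ('n, 'a::{idom,ring_char_0}) mpoly"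
  assumes h: "\<And>i. dir_deriv h (h i) = 0" and "dir_deriv h (p * q) = 0" "p * q \<noteq> 0"
  shows "dir_deriv h p = 0"
proof -
  have "flow h p * flow h q = [:p * q:]"
    using flow_eq_const_iff[OF h, of "p * q"] assms(2) by (simp only: flow_hom)
  moreover from this have "degree (flow h p) + degree (flow h q) = 0"
    using assms(3) by (metis degree_mult_eq degree_pCons_0 mult_zero_left mult_zero_right pCons_eq_0_iff)
  ultimately have "degree (flow h p) = 0" by simp
  hence "flow h p = [:p:]" using coeff_flow_0[of h p] by (metis coeff_pCons_0 degree_eq_zeroE)
  thus ?thesis by (simp only: flow_eq_const_iff[OF h])
qed

lemma coeff_mult_le_degree:
  fixes p q :: "'a::comm_semiring_1 poly"
  assumes "degree p \<le> a" "degree q \<le> b"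
  shows "coeff (p * q) (a + b) = coeff p a * coeff q b"
proof -
  have "coeff (p * q) (a + b) = (\<Sum>k\<le>a + b. if k = a then coeff p a * coeff q b else 0)"
    unfolding coeff_mult
  proof (rule sum.cong)
    fix k assume "k \<in> {..a + b}"
    thus "coeff p k * coeff q (a + b - k) = (if k = a then coeff p a * coeff q b else 0)"
      using assms coeff_eq_0[of p k] coeff_eq_0[of q "a + b - k"] by (cases "k < a"; cases "k = a") auto
  qed simp
  thus ?thesis by simp
qed

lemma coeff_prod_le_degree:
  fixes f :: "'i \<Rightarrow> 'a::comm_semiring_1 poly"
  assumes "\<And>i. i \<in> A \<Longrightarrow> degree (f i) \<le> d i" "finite A"
  shows "degree (prod f A) \<le> sum d A \<and> coeff (prod f A) (sum d A) = (\<Prod>i\<in>A. coeff (f i) (d i))"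
  using assms(2,1)
proof (induction A rule: finite_induct)
  case (insert x A)
  have "degree (f x * prod f A) \<le> degree (f x) + degree (prod f A)" by (rule degree_mult_le)
  thus ?case using insert by (auto simp: coeff_mult_le_degree intro: order_trans add_mono)
qed simp

lemma coeff_linear_power: "degree ([:a, b:] ^ k) \<le> k \<and> coeff ([:a, b:] ^ k) k = (b :: 'a::comm_semiring_1) ^ k"
  using coeff_prod_le_degree[of "{..<k}" "\<lambda>_. [:a, b:]" "\<lambda>_. 1"] by simp

text \<open>In a monomial of degree \<open>d\<close> the power \<open>t^d\<close> arises only by
  taking \<open>t h_i\<close> from every factor \<open>x_i + t h_i\<close>.\<close>

lemma coeff_flow_top:
  assumes "homogeneous_mpoly d p"
  shows "coeff (flow h p) d = msub mpoly_const h p"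
proof -
  have "coeff (flow h (Poly_Mapping.single m a)) d = msub mpoly_const h (Poly_Mapping.single m a)"
    if "mdeg m = d" for m a
  proof -
    have "coeff (\<Prod>i\<in>UNIV. [:mpoly_var i, h i:] ^ Poly_Mapping.lookup m i) (\<Sum>i\<in>UNIV. Poly_Mapping.lookup m i)
      = (\<Prod>i\<in>UNIV. h i ^ Poly_Mapping.lookup m i)"
      using coeff_prod_le_degree[of UNIV "\<lambda>i. [:mpoly_var i, h i:] ^ Poly_Mapping.lookup m i" "Poly_Mapping.lookup m"]
      by (simp add: coeff_linear_power)
    thus ?thesis using that by (simp add: flow_def msub_single mdeg_def)
  qed
  moreover have "mdeg m = d" if "m \<in> Poly_Mapping.keys p" for m
    using assms that by (simp add: homogeneous_mpoly_def mdeg_def)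
  ultimately show ?thesis
    by (subst (1 2) mpoly_sum_monomials) (simp add: flow_hom msub_hom coeff_sum)
qed

text \<open>Compare the coefficients of \<open>t^d\<close> in \<open>p(x + t h(x)) = p(x)\<close>.
  Applied to \<open>p = h i\<close>, this yields \<open>h(h(x)) = 0\<close>.\<close>

lemma msub_self_eq_0:
  fixes h :: "'n::{finite,linorder} \<Rightarrow> ('n, 'a::{idom,ring_char_0}) mpoly"
  assumes h: "\<And>i. dir_deriv h (h i) = 0" and "homogeneous_mpoly d p" "d > 0" "dir_deriv h p = 0"
  shows "msub mpoly_const h p = 0"
proof -
  have "coeff (flow h p) d = coeff [:p:] d"
    using flow_eq_const_iff[OF h, of p] assms(4) by simp
  thus ?thesis using coeff_flow_top[OF assms(2), of h] assms(3) by (simp add: coeff_pCons split: nat.splits)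
qed

lemma peval_translate:
  fixes p :: "('n::{finite,linorder}, 'a::{idom,ring_char_0}) mpoly"
  assumes "dir_deriv (\<lambda>i. mpoly_const (c i)) p = 0"
  shows "peval (\<lambda>i. a i + t * c i) p = peval a p"
proof -
  have "flow (\<lambda>i. mpoly_const (c i)) p = [:p:]"
    using assms by (subst flow_eq_const_iff) (simp_all add: dir_deriv_const)
  thus ?thesis using peval_flow[of a "\<lambda>i. mpoly_const (c i)" p t] by simp
qed

subsection \<open>The vector field of a form with zero Hessian\<close>

lemma vector_space_mpoly: "vector_space (\<lambda>c p. mpoly_const c * (p :: ('n, 'k::field) mpoly))"
  by unfold_locales (simp_all add: distrib_left distrib_right mult.assoc ring_hom_funD[OF ring_hom_fun_mpoly_const])

text \<open>Bounding every exponent separately, and not the total degree, makes the number of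
  monomials an exact power of \<open>N\<close>.\<close>

definition exponents_below :: "nat \<Rightarrow> ('n::finite \<Rightarrow>\<^sub>0 nat) set" where
  "exponents_below N = {m. \<forall>i. Poly_Mapping.lookup m i < N}"

lemma exponents_below_card:
  "finite (exponents_below N :: ('n::finite \<Rightarrow>\<^sub>0 nat) set) \<and>
   card (exponents_below N :: ('n \<Rightarrow>\<^sub>0 nat) set) = N ^ CARD('n)"
proof -
  let ?S = "PiE (UNIV :: 'n set) (\<lambda>_. {..<N})"
  have "bij_betw Poly_Mapping.lookup (exponents_below N :: ('n \<Rightarrow>\<^sub>0 nat) set) ?S"
  proof (rule bij_betwI[where g = Abs_poly_mapping])
    show "Poly_Mapping.lookup \<in> exponents_below N \<rightarrow> ?S"
      by (auto simp: exponents_below_def)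
    show "Abs_poly_mapping \<in> ?S \<rightarrow> (exponents_below N :: ('n \<Rightarrow>\<^sub>0 nat) set)"
      by (auto simp: exponents_below_def PiE_def Pi_def)
  qed auto
  moreover have "finite ?S" by (intro finite_PiE) auto
  moreover have "card ?S = N ^ CARD('n)" by (simp add: card_PiE)
  ultimately show ?thesis by (metis bij_betw_finite bij_betw_same_card)
qed

lemmas finite_exponents_below [simp] = exponents_below_card[THEN conjunct1]

definition exponents_le :: "nat \<Rightarrow> ('n, 'a::comm_ring_1) mpoly \<Rightarrow> bool" where
  "exponents_le B p \<longleftrightarrow> (\<forall>m\<in>Poly_Mapping.keys p. \<forall>i. Poly_Mapping.lookup m i \<le> B)"

lemma exponents_le_mult: "exponents_le A p \<Longrightarrow> exponents_le B q \<Longrightarrow> exponents_le (A + B) (p * q)"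
  using keys_mult[of p q] unfolding exponents_le_def
  by (force simp: lookup_add intro!: add_mono)

lemma exponents_le_1: "exponents_le 0 1"
  by (simp add: exponents_le_def)

lemma exponents_le_power: "exponents_le A p \<Longrightarrow> exponents_le (k * A) (p ^ k)"
  by (induction k) (auto simp: exponents_le_1 intro: exponents_le_mult)

lemma exponents_le_prod:
  "finite I \<Longrightarrow> (\<And>i. i \<in> I \<Longrightarrow> exponents_le (B i) (f i)) \<Longrightarrow> exponents_le (sum B I) (prod f I)"
  by (induction I rule: finite_induct) (auto simp: exponents_le_1 intro: exponents_le_mult)

lemma exponents_le_mono: "exponents_le A p \<Longrightarrow> A \<le> B \<Longrightarrow> exponents_le B p"
  unfolding exponents_le_def by (meson order_trans)

lemma exponents_le_exists: "\<exists>B. exponents_le B (p :: ('n::finite, 'a::comm_ring_1) mpoly)"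
proof -
  define B where "B = (\<Sum>m\<in>Poly_Mapping.keys p. mdeg m)"
  have "Poly_Mapping.lookup m i \<le> B" if "m \<in> Poly_Mapping.keys p" for m i
  proof -
    have "Poly_Mapping.lookup m i \<le> mdeg m"
      unfolding mdeg_def by (rule member_le_sum) auto
    also have "mdeg m \<le> B" unfolding B_def by (rule member_le_sum) (use that in auto)
    finally show ?thesis .
  qed
  thus ?thesis unfolding exponents_le_def by blast
qed

text \<open>Counting: the monomials in the \<open>g i\<close> with exponents below \<open>N\<close> number \<open>N\<^bsup>CARD('m)\<^esup>\<close>, while they
  lie in a space of dimension \<open>O(N\<^bsup>CARD('n)\<^esup>)\<close>.\<close>

lemma algebraic_dependence:
  fixes g :: "'m::finite \<Rightarrow> ('n::finite, 'k::field) mpoly"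
  assumes less: "CARD('n) < CARD('m)"
  shows "\<exists>P :: ('m, 'k) mpoly. P \<noteq> 0 \<and> msub mpoly_const g P = 0"
proof -
  interpret V: vector_space "\<lambda>c p. mpoly_const c * (p :: ('n, 'k) mpoly)" by (rule vector_space_mpoly)
  have "\<forall>i. \<exists>b. exponents_le b (g i)" by (intro allI exponents_le_exists)
  from choice[OF this] obtain B where B: "\<And>i. exponents_le (B i) (g i)" by blast
  define D where "D = (\<Sum>i\<in>UNIV. B i)"
  have D: "exponents_le D (g i)" for i
    by (rule exponents_le_mono[OF B]) (simp add: D_def member_le_sum)
  \<comment> \<open>A monomial in the \<open>g i\<close> with exponents below \<open>N\<close> has
    exponents at most \<open>CARD('m) * N * D\<close>, which is less than \<open>L = N * K\<close>.
    The choice \<open>N > K ^ CARD('n)\<close> makes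
    \<open>N ^ CARD('m) \<ge> N * N ^ CARD('n)\<close> exceed the number \<open>L ^ CARD('n)\<close>
    of available monomials.\<close>
  define K where "K = CARD('m) * D + 1"
  define N where "N = K ^ CARD('n) + 1"
  define L where "L = N * K"
  define M where "M m = (\<Prod>i\<in>UNIV. g i ^ Poly_Mapping.lookup m i)" for m
  let ?X = "exponents_below N :: ('m \<Rightarrow>\<^sub>0 nat) set"
  let ?Y = "exponents_below L :: ('n \<Rightarrow>\<^sub>0 nat) set"
  let ?T = "(\<lambda>m. Poly_Mapping.single m (1::'k)) ` ?Y"
  have msub_one: "msub mpoly_const g (Poly_Mapping.single m a) = mpoly_const a * M m" for m a
    by (simp add: msub_single M_def)
  have span: "M ` ?X \<subseteq> V.span ?T"
  proof (rule image_subsetI)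
    fix m assume m: "m \<in> ?X"
    have "exponents_le (\<Sum>i\<in>UNIV. Poly_Mapping.lookup m i * D) (M m)"
      unfolding M_def by (intro exponents_le_prod exponents_le_power D) auto
    moreover have "(\<Sum>i\<in>UNIV. Poly_Mapping.lookup m i * D) \<le> CARD('m) * (N * D)"
    proof -
      have "(\<Sum>i\<in>UNIV. Poly_Mapping.lookup m i * D) \<le> (\<Sum>i\<in>(UNIV::'m set). N * D)"
        using m by (intro sum_mono mult_right_mono) (auto simp: exponents_below_def intro: less_imp_le)
      thus ?thesis by simp
    qed
    moreover have "CARD('m) * (N * D) < L"
      unfolding L_def K_def by (simp add: N_def algebra_simps)
    ultimately have "\<forall>k\<in>Poly_Mapping.keys (M m). k \<in> ?Y"
      unfolding exponents_le_def exponents_below_def mem_Collect_eq by (meson le_less_trans)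
    hence "(\<Sum>k\<in>Poly_Mapping.keys (M m). mpoly_const (Poly_Mapping.lookup (M m) k) * Poly_Mapping.single k 1) \<in> V.span ?T"
      by (intro V.span_sum V.span_scale V.span_base) auto
    also have "(\<Sum>k\<in>Poly_Mapping.keys (M m). mpoly_const (Poly_Mapping.lookup (M m) k) * Poly_Mapping.single k 1) = M m"
      by (subst (4) mpoly_sum_monomials) (simp add: mpoly_const_def mult_single)
    finally show "M m \<in> V.span ?T" .
  qed
  show ?thesis
  proof (cases "inj_on M ?X")
    \<comment> \<open>Two equal monomials in the \<open>g i\<close> already are a relation. In the
      other case injectivity keeps the terms of a linear dependence from collapsing.\<close>
    case False
    then obtain m m' where m: "M m = M m'" "m \<noteq> m'" unfolding inj_on_def by blast
    define P where "P = Poly_Mapping.single m (1::'k) - Poly_Mapping.single m' 1"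
    have "Poly_Mapping.lookup P m = 1" using m(2) by (simp add: P_def lookup_minus lookup_single)
    hence "P \<noteq> 0" by auto
    moreover have "msub mpoly_const g P = 0" by (simp add: P_def msub_hom msub_one m(1))
    ultimately show ?thesis by blast
  next
    case True
    have fin: "finite (M ` ?X)" using exponents_below_card by blast
    have "V.dependent (M ` ?X)"
    proof (rule ccontr)
      assume "\<not> V.dependent (M ` ?X)"
      hence "card (M ` ?X) \<le> card ?T"
        using V.independent_span_bound[OF _ _ span] exponents_below_card by blast
      hence "N ^ CARD('m) \<le> card ?T" using True exponents_below_card by (metis card_image)
      also have "\<dots> \<le> L ^ CARD('n)" using card_image_le exponents_below_card by metis
      also have "\<dots> = N ^ CARD('n) * K ^ CARD('n)" by (simp add: L_def power_mult_distrib)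
      also have "\<dots> < N ^ CARD('n) * N" by (simp add: N_def)
      also have "\<dots> = N ^ Suc (CARD('n))" by simp
      also have "\<dots> \<le> N ^ CARD('m)" using less by (intro power_increasing) (auto simp: N_def)
      finally show False by simp
    qed
    then obtain u where u: "\<exists>v\<in>M ` ?X. u v \<noteq> 0" "(\<Sum>v\<in>M ` ?X. mpoly_const (u v) * v) = 0"
      unfolding V.dependent_finite[OF fin] by blast
    define P where "P = (\<Sum>m\<in>?X. Poly_Mapping.single m (u (M m)))"
    obtain m where m: "m \<in> ?X" "u (M m) \<noteq> 0" using u(1) by blast
    have "Poly_Mapping.lookup P m = (\<Sum>k\<in>?X. if k = m then u (M k) else 0)"
      unfolding P_def lookup_sum by (intro sum.cong) (auto simp: lookup_single)
    also have "\<dots> = u (M m)" using m by simp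
    finally have "P \<noteq> 0" using m by auto
    moreover have "msub mpoly_const g P = (\<Sum>m\<in>?X. mpoly_const (u (M m)) * M m)"
      by (simp add: P_def msub_hom msub_one)
    hence "msub mpoly_const g P = 0" using u(2) by (simp add: sum.reindex[OF True])
    ultimately show ?thesis by blast
  qed
qed

section \<open>Gordan-Noether vector fields\<close>

lemma ring_hom_fun_to_fract: "ring_hom_fun (to_fract :: 'a::idom \<Rightarrow> 'a fract)"
  by (simp add: ring_hom_fun_def)

text \<open>Over the fraction field a singular matrix has a kernel vector; the product of the
  denominators brings it back into the ring.\<close>

lemma det_eq_0_imp_kernel:
  fixes A :: "'a::idom ^ 'n ^ 'n"
  assumes "Determinants.det A = 0"
  shows "\<exists>v. (\<exists>i. v i \<noteq> 0) \<and> (\<forall>i. (\<Sum>j\<in>UNIV. A $ i $ j * v j) = 0)"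
proof -
  note hom = ring_hom_funD[OF ring_hom_fun_to_fract]
  define B :: "'a fract ^ 'n ^ 'n" where "B = (\<chi> i j. to_fract (A $ i $ j))"
  have "to_fract (of_int (sign p)) = (of_int (sign p) :: 'a fract)" for p :: "'n \<Rightarrow> 'n"
    by (simp add: sign_def hom)
  hence "Determinants.det B = to_fract (Determinants.det A)"
    by (simp add: Determinants.det_def B_def hom)
  hence "\<not> invertible B" using assms by (simp add: invertible_det_nz)
  hence "\<exists>x. B *v x = 0 \<and> x \<noteq> 0"
    using invertible_left_inverse[of B] matrix_left_invertible_ker[of B] by blast
  then obtain x where x: "B *v x = 0" "x \<noteq> 0" by blast
  have "\<exists>a b. b \<noteq> 0 \<and> x $ i * to_fract b = to_fract a" for i
  proof (cases "x $ i")
    case (Fract a b)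
    thus ?thesis by (intro exI[of _ a] exI[of _ b]) (simp add: Fract_conv_to_fract)
  qed
  then obtain a b where ab: "\<And>i. b i \<noteq> 0" "\<And>i. x $ i * to_fract (b i) = to_fract (a i)" by metis
  define c where "c = (\<Prod>i\<in>UNIV. b i)"
  have c: "c \<noteq> 0" using ab(1) by (simp add: c_def)
  define v where "v i = a i * (\<Prod>j\<in>UNIV - {i}. b j)" for i
  have v: "to_fract (v i) = x $ i * to_fract c" for i
  proof -
    have "c = b i * (\<Prod>j\<in>UNIV - {i}. b j)" unfolding c_def by (rule prod.remove) auto
    thus ?thesis by (simp add: v_def hom flip: ab(2))
  qed
  obtain i where "x $ i \<noteq> 0" using x(2) by (auto simp: Finite_Cartesian_Product.vec_eq_iff)
  hence "v i \<noteq> 0" using v[of i] c by (auto simp: hom)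
  moreover have "(\<Sum>j\<in>UNIV. A $ i $ j * v j) = 0" for i
  proof -
    have "to_fract (\<Sum>j\<in>UNIV. A $ i $ j * v j) = (\<Sum>j\<in>UNIV. B $ i $ j * x $ j) * to_fract c"
      by (simp add: hom v B_def sum_distrib_right mult.assoc)
    also have "\<dots> = 0" using x(1) by (simp add: matrix_vector_mult_def Finite_Cartesian_Product.vec_eq_iff)
    finally show ?thesis by (simp only: to_fract_eq_0_iff)
  qed
  ultimately show ?thesis by blast
qed

lemma derivation_msub:
  fixes g :: "'m::finite \<Rightarrow> ('n::finite, 'a::comm_ring_1) mpoly"
  assumes "derivation_along (\<lambda>x. x) \<delta>" "\<And>c. \<delta> (mpoly_const c) = 0"
  shows "\<delta> (msub mpoly_const g Q) = (\<Sum>i\<in>UNIV. msub mpoly_const g (mpoly_pderiv i Q) * \<delta> (g i))"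
proof -
  have "\<delta> (msub mpoly_const g Q) =
      (\<Sum>i\<in>UNIV. msub mpoly_const g (mpoly_pderiv i Q) * \<delta> (msub mpoly_const g (mpoly_var i)))"
    by (rule derivation_chain_rule[where \<delta> = "\<lambda>Q. \<delta> (msub mpoly_const g Q)"])
       (use assms in \<open>auto simp: ring_hom_fun_msub derivation_along_def msub_hom msub_const\<close>)
  thus ?thesis by (simp add: msub_var)
qed

lemma derivation_pderiv: "derivation_along (\<lambda>x. x) (mpoly_pderiv i :: ('n, 'a::comm_ring_1) mpoly \<Rightarrow> _)"
  by (simp add: derivation_along_def mpoly_pderiv_add mpoly_pderiv_mult)

lemma derivation_dir_deriv: "derivation_along (\<lambda>x. x) (dir_deriv h)"
  by (simp add: derivation_along_def dir_deriv_add dir_deriv_mult)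

lemma degree_grade_pderiv_less:
  assumes "mpoly_pderiv i (p :: ('n::finite, 'a::comm_ring_1) mpoly) \<noteq> 0"
  shows "degree (grade (mpoly_pderiv i p)) < degree (grade p)"
proof -
  let ?n = "degree (grade (mpoly_pderiv i p))"
  have "coeff (grade (mpoly_pderiv i p)) ?n \<noteq> 0" using assms by simp
  hence "coeff (grade p) (Suc ?n) \<noteq> 0" by (auto simp flip: pderiv_coeff_grade)
  thus ?thesis using le_degree by fastforce
qed

text \<open>In characteristic 0 the exponent of \<open>x_i\<close> is an invertible factor, so
  differentiation by \<open>x_i\<close> loses no monomial that contains \<open>x_i\<close>.\<close>

lemma lookup_eq_0_if_pderiv_eq_0:
  fixes p :: "('n, 'a::field_char_0) mpoly"
  assumes "mpoly_pderiv i p = 0" "Poly_Mapping.lookup m i \<noteq> 0"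
  shows "Poly_Mapping.lookup p m = 0"
proof -
  define n where "n = m - Poly_Mapping.single i 1"
  have "m = n + Poly_Mapping.single i 1"
    unfolding n_def
    by (rule poly_mapping_eqI) (use assms(2) in \<open>auto simp: lookup_add lookup_minus lookup_single when_def\<close>)
  hence "of_nat (Poly_Mapping.lookup n i + 1) * Poly_Mapping.lookup p m = 0"
    using assms(1) lookup_mpoly_pderiv[of i p n] by simp
  thus ?thesis by (simp only: mult_eq_0_iff of_nat_eq_0_iff) simp
qed

lemma pderiv_all_0_imp_const:
  fixes p :: "('n, 'a::field_char_0) mpoly"
  assumes "\<And>i. mpoly_pderiv i p = 0"
  shows "p = mpoly_const (Poly_Mapping.lookup p 0)"
proof (rule poly_mapping_eqI)
  fix m
  show "Poly_Mapping.lookup p m = Poly_Mapping.lookup (mpoly_const (Poly_Mapping.lookup p 0)) m"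
  proof (cases "m = 0")
    case False
    then obtain i where "Poly_Mapping.lookup m i \<noteq> 0" by (metis poly_mapping_eqI lookup_zero)
    hence "Poly_Mapping.lookup p m = 0" by (rule lookup_eq_0_if_pderiv_eq_0[OF assms])
    thus ?thesis using False by (simp add: mpoly_const_def lookup_single)
  qed (simp add: mpoly_const_def)
qed

lemma sum_UNIV_option: "(\<Sum>x\<in>UNIV. F x) = F None + (\<Sum>i\<in>(UNIV :: 'n::finite set). F (Some i) :: 'b::comm_monoid_add)"
  by (simp add: UNIV_option_conv sum.reindex)

text \<open>A relation of least degree between one variable \<open>x\<^sub>j\<close> and the partial derivatives of \<open>f\<close> does not
  involve \<open>x\<^sub>j\<close> if the \<open>j\<close>-th component of a kernel vector of the Hessian matrix is non-zero.\<close>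

lemma zero_hessian_vector_field:
  fixes f :: "('n::{finite,linorder}, 'k::field_char_0) mpoly"
  assumes "zero_hessian f"
  shows "\<exists>h. (\<exists>i. h i \<noteq> 0) \<and> (\<forall>i. dir_deriv h (mpoly_pderiv i f) = 0) \<and> (\<forall>i. dir_deriv h (h i) = 0)"
proof -
  obtain v where v: "\<exists>j. v j \<noteq> 0" "\<And>i. (\<Sum>j\<in>UNIV. hessian_matrix f $ i $ j * v j) = 0"
    using det_eq_0_imp_kernel[of "hessian_matrix f"] assms unfolding zero_hessian_def by blast
  have Ev: "dir_deriv v (mpoly_pderiv i f) = 0" for i
    using v(2)[of i] by (simp add: dir_deriv_def hessian_matrix_def mult.commute mpoly_pderiv_commute[of i])
  obtain j where j: "v j \<noteq> 0" using v(1) by blast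
  \<comment> \<open>One variable together with the derivatives gives one polynomial more than there
    are variables, so a relation exists for any \<open>f\<close>; the Hessian serves only to remove
    the variable from it.\<close>
  define g :: "'n option \<Rightarrow> ('n, 'k) mpoly"
    where "g x = (case x of None \<Rightarrow> mpoly_var j | Some i \<Rightarrow> mpoly_pderiv i f)" for x
  define rel where "rel P \<longleftrightarrow> P \<noteq> 0 \<and> msub mpoly_const g P = 0" for P
  have "\<exists>P. rel P" unfolding rel_def by (rule algebraic_dependence) (simp add: card_UNIV_option)
  then obtain P0 where "rel P0" ..
  define P where "P = (ARG_MIN (\<lambda>P. degree (grade P)) P. rel P)"
  have P: "rel P" and Pmin: "\<And>Q. rel Q \<Longrightarrow> degree (grade P) \<le> degree (grade Q)"
    using arg_min_nat_lemma[of rel P0 "\<lambda>P. degree (grade P)"] \<open>rel P0\<close> unfolding P_def by auto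
  \<comment> \<open>A non-zero derivative of \<open>P\<close> that vanishes at \<open>g\<close>
    would be a relation of smaller degree.\<close>
  have min: "mpoly_pderiv x P = 0" if "msub mpoly_const g (mpoly_pderiv x P) = 0" for x
    using that degree_grade_pderiv_less[of x P] Pmin[of "mpoly_pderiv x P"] unfolding rel_def
    by (meson not_le)
  have chain: "\<delta> (msub mpoly_const g Q) = msub mpoly_const g (mpoly_pderiv None Q) * \<delta> (mpoly_var j) +
      (\<Sum>i\<in>UNIV. msub mpoly_const g (mpoly_pderiv (Some i) Q) * \<delta> (mpoly_pderiv i f))"
    if "derivation_along (\<lambda>x. x) \<delta>" "\<And>c. \<delta> (mpoly_const c) = 0" for \<delta> Q
    by (simp add: derivation_msub[OF that] sum_UNIV_option g_def)
  \<comment> \<open>The derivation along \<open>v\<close> kills all partial derivatives of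
    \<open>f\<close>, so in the derivative of the relation only the term of \<open>x_j\<close>
    survives.\<close>
  have "msub mpoly_const g (mpoly_pderiv None P) * v j = dir_deriv v (msub mpoly_const g P)"
    by (simp add: chain[OF derivation_dir_deriv dir_deriv_const] dir_deriv_var Ev)
  hence "msub mpoly_const g (mpoly_pderiv None P) = 0" using j P by (simp add: rel_def)
  hence None0: "mpoly_pderiv None P = 0" by (rule min)
  define h where "h i = msub mpoly_const g (mpoly_pderiv (Some i) P)" for i
  have hf: "dir_deriv h (mpoly_pderiv k f) = 0" for k
  proof -
    \<comment> \<open>Differentiate \<open>P(f_1, ..., f_n) = 0\<close> by \<open>x_k\<close>; the
      symmetry of the second derivatives turns the result into \<open>D f_k\<close>.\<close>
    have "dir_deriv h (mpoly_pderiv k f) = mpoly_pderiv k (msub mpoly_const g P)"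
      by (simp add: chain[OF derivation_pderiv mpoly_pderiv_const] None0 msub_hom dir_deriv_def h_def mpoly_pderiv_commute[of k])
    thus ?thesis using P by (simp add: rel_def)
  qed
  have hh: "dir_deriv h (h i) = 0" for i
    unfolding h_def[of i]
    by (subst chain[OF derivation_dir_deriv dir_deriv_const])
       (simp add: hf mpoly_pderiv_commute[of None] None0 msub_hom)
  have "\<exists>i. h i \<noteq> 0"
  proof (rule ccontr)
    assume "\<not> (\<exists>i. h i \<noteq> 0)"
    \<comment> \<open>By minimality all derivatives of \<open>P\<close> would be 0, and a non-zero
      constant is not a relation.\<close>
    hence "mpoly_pderiv (Some i) P = 0" for i unfolding h_def by (intro min) blast
    hence "mpoly_pderiv x P = 0" for x using None0 by (cases x) auto
    hence c: "P = mpoly_const (Poly_Mapping.lookup P 0)" by (rule pderiv_all_0_imp_const)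
    have "msub mpoly_const g P = mpoly_const (Poly_Mapping.lookup P 0)"
      by (subst c) (simp add: msub_const)
    hence "Poly_Mapping.lookup (mpoly_const (Poly_Mapping.lookup P 0) :: ('n, 'k) mpoly) 0 = 0"
      using P by (simp add: rel_def)
    hence "P = mpoly_const 0" using c by (simp add: mpoly_const_def)
    thus False using P by (simp add: rel_def mpoly_const_def)
  qed
  thus ?thesis using hf hh by blast
qed

text \<open>Compare the components of degree \<open>e + n - 1\<close> in \<open>D q = 0\<close>. As
  \<open>e\<close> is only a bound, an \<open>h i\<close> of smaller degree simply contributes
  0.\<close>

lemma dir_deriv_top_component:
  fixes h :: "'n::finite \<Rightarrow> ('n, 'a::comm_ring_1) mpoly"
  assumes h: "\<And>i. degree (grade (h i)) \<le> e" and q: "degree (grade q) \<le> n" and 0: "dir_deriv h q = 0"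
  shows "dir_deriv (\<lambda>i. coeff (grade (h i)) e) (coeff (grade q) n) = 0"
proof (cases n)
  case 0
  thus ?thesis by (simp add: dir_deriv_def pderiv_coeff_grade_0)
next
  case (Suc l)
  have deg: "degree (grade (mpoly_pderiv i q)) \<le> l" for i
    using q Suc by (intro degree_le) (auto simp flip: pderiv_coeff_grade simp: coeff_eq_0)
  have "coeff (grade (dir_deriv h q)) (e + l) = (\<Sum>i\<in>UNIV. coeff (grade (h i)) e * coeff (grade (mpoly_pderiv i q)) l)"
    by (simp add: dir_deriv_def grade_hom coeff_sum coeff_mult_le_degree[OF h deg])
  moreover have "coeff (grade (dir_deriv h q)) (e + l) = 0" by (simp only: 0 grade_hom coeff_0)
  ultimately show ?thesis unfolding Suc by (simp only: dir_deriv_def pderiv_coeff_grade)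
qed

lemma zero_hessian_homogeneous_vector_field:
  fixes f :: "('n::{finite,linorder}, 'k::field_char_0) mpoly"
  assumes "zero_hessian f" "homogeneous_mpoly (Suc d) f"
  shows "\<exists>h e. (\<exists>i. h i \<noteq> 0) \<and> (\<forall>i. homogeneous_mpoly e (h i)) \<and>
     (\<forall>i. dir_deriv h (mpoly_pderiv i f) = 0) \<and> (\<forall>i. dir_deriv h (h i) = 0)"
proof -
  obtain h where h: "\<exists>i. h i \<noteq> 0" "\<And>i. dir_deriv h (mpoly_pderiv i f) = 0" "\<And>i. dir_deriv h (h i) = 0"
    using zero_hessian_vector_field[OF assms(1)] by blast
  \<comment> \<open>Zero polynomials also have degree 0; leaving them out ensures that the maximum
    is attained at some \<open>h k \<noteq> 0\<close>.\<close>
  define e where "e = Max ((\<lambda>i. degree (grade (h i))) ` {i. h i \<noteq> 0})"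
  have "e \<in> (\<lambda>i. degree (grade (h i))) ` {i. h i \<noteq> 0}"
    unfolding e_def using h(1) by (intro Max_in) auto
  then obtain k where k: "h k \<noteq> 0" "e = degree (grade (h k))" by blast
  have deg: "degree (grade (h i)) \<le> e" for i
    by (cases "h i = 0") (auto simp: e_def grade_hom intro: Max_ge)
  define h' where "h' = (\<lambda>i. coeff (grade (h i)) e)"
  have "h' k \<noteq> 0" using k by (simp add: h'_def)
  moreover have "homogeneous_mpoly e (h' i)" for i
    unfolding h'_def by (rule homogeneous_coeff_grade)
  moreover have "dir_deriv h' (mpoly_pderiv i f) = 0" for i
  proof -
    have "grade (mpoly_pderiv i f) = monom (mpoly_pderiv i f) d"
      using homogeneous_pderiv[OF assms(2)] by (simp only: homogeneous_iff_grade)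
    thus ?thesis
      using dir_deriv_top_component[OF deg _ h(2)[of i], of d] by (simp add: h'_def degree_monom_le)
  qed
  moreover have "dir_deriv h' (h' i) = 0" for i
    unfolding h'_def by (rule dir_deriv_top_component[OF deg deg h(3)])
  ultimately show ?thesis by blast
qed

text \<open>A prime \<open>G\<close> dividing all \<open>h i\<close> can be cancelled: the
  derivation along \<open>h\<close> is \<open>G\<close> times the one along \<open>h'\<close>, and
  \<open>h' j\<close> is killed as a factor of \<open>h j\<close>. Hence a field of least degree is
  primitive.\<close>

lemma zero_hessian_primitive_vector_field:
  fixes f :: "('n::{finite,linorder}, 'k::field_char_0) mpoly"
  assumes "zero_hessian f" "homogeneous_mpoly (Suc d) f"
  shows "\<exists>h e. (\<exists>i. h i \<noteq> 0) \<and> (\<forall>i. homogeneous_mpoly e (h i)) \<and>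
     (\<forall>i. dir_deriv h (mpoly_pderiv i f) = 0) \<and> (\<forall>i. dir_deriv h (h i) = 0) \<and>
     (\<forall>G. prime_elem G \<longrightarrow> \<not> (\<forall>i. G dvd h i))"
proof -
  define ok where "ok h e \<longleftrightarrow> (\<exists>i. h i \<noteq> 0) \<and> (\<forall>i. homogeneous_mpoly e (h i)) \<and>
     (\<forall>i. dir_deriv h (mpoly_pderiv i f) = 0) \<and> (\<forall>i. dir_deriv h (h i) = 0)" for h e
  have ex: "\<exists>e h. ok h e" using zero_hessian_homogeneous_vector_field[OF assms] unfolding ok_def by blast
  define e where "e = (LEAST e. \<exists>h. ok h e)"
  have "\<exists>h. ok h e" unfolding e_def by (rule LeastI_ex[OF ex])
  then obtain h where ok: "ok h e" ..
  have least: "e \<le> e'" if "ok h' e'" for h' e'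
    unfolding e_def by (rule Least_le) (use that in blast)
  note h = ok[unfolded ok_def]
  have "\<not> (\<forall>i. G dvd h i)" if G: "prime_elem G" for G
  proof
    assume "\<forall>i. G dvd h i"
    then obtain h' where h': "\<And>i. h i = G * h' i" unfolding dvd_def by metis
    have G0: "G \<noteq> 0" "\<not> G dvd 1" using G by (simp_all add: prime_elem_def)
    obtain i where i: "h i \<noteq> 0" using h by blast
    have hom: "homogeneous_mpoly e (G * h' j)" for j using h h' by metis
    obtain k where k: "homogeneous_mpoly k G"
      using homogeneous_factor[OF hom[of i]] i h' by metis
    have nonconst: False if "mpoly_const c \<noteq> 0" "G dvd mpoly_const c" for c
    proof -
      have "c \<noteq> 0" using that(1) by (auto simp: mpoly_const_def)
      hence "mpoly_const c * mpoly_const (1 / c) = (1 :: ('n, 'k) mpoly)"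
        by (simp add: mpoly_const_def mult_single)
      hence "G dvd 1" using that(2) by (metis dvd_mult2)
      thus False using G0 by blast
    qed
    have "k \<noteq> 0"
    proof
      assume "k = 0"
      hence "G = mpoly_const (Poly_Mapping.lookup G 0)" using k homogeneous_degree_0 by metis
      thus False using nonconst G0 by (metis dvd_refl)
    qed
    \<comment> \<open>Subtraction truncates, so \<open>e - k < e\<close> requires
      \<open>e > 0\<close> besides \<open>k > 0\<close>.\<close>
    moreover have "e \<noteq> 0"
    proof
      assume "e = 0"
      hence "h i = mpoly_const (Poly_Mapping.lookup (h i) 0)" using h homogeneous_degree_0 by metis
      thus False using nonconst i h' by (metis dvd_triv_left)
    qed
    moreover have "ok h' (e - k)"
      unfolding ok_def
    proof (intro conjI allI)
      show "\<exists>i. h' i \<noteq> 0" using i h' by (metis mult_zero_right)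
      show "homogeneous_mpoly (e - k) (h' j)" for j by (rule homogeneous_cofactor[OF hom k G0(1)])
      have D: "dir_deriv h q = G * dir_deriv h' q" for q
        by (simp add: dir_deriv_def h' sum_distrib_left mult.assoc)
      show "dir_deriv h' (mpoly_pderiv j f) = 0" for j
        using h D[of "mpoly_pderiv j f"] G0(1) by simp
      show "dir_deriv h' (h' j) = 0" for j
      proof (cases "h' j = 0")
        case False
        hence nz: "h' j * G \<noteq> 0" using G0 by simp
        have hh: "dir_deriv h (h i) = 0" for i using h by blast
        have "dir_deriv h (h' j * G) = 0" using hh[of j] by (simp only: h'[of j] mult.commute)
        hence "dir_deriv h (h' j) = 0" using nz by (rule dir_deriv_factor[OF hh])
        thus ?thesis using D[of "h' j"] G0(1) by simp
      qed simp
    qed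
    ultimately show False using least[of h' "e - k"] by simp
  qed
  thus ?thesis using h by blast
qed

subsection \<open>Relations modulo primes of a pencil\<close>

lemma homogeneous_power:
  "homogeneous_mpoly e p \<Longrightarrow> homogeneous_mpoly (e * k) ((p :: ('n::finite, 'a::comm_ring_1) mpoly) ^ k)"
  by (simp add: homogeneous_iff_grade grade_hom monom_power)

lemma homogeneous_prod:
  fixes f :: "'i \<Rightarrow> ('n::finite, 'a::comm_ring_1) mpoly"
  assumes "\<And>i. homogeneous_mpoly (d i) (f i)"
  shows "homogeneous_mpoly (\<Sum>i\<in>A. d i) (\<Prod>i\<in>A. f i)"
  using assms by (simp add: homogeneous_iff_grade grade_hom prod_monom)

lemma homogeneous_msub:
  fixes g :: "'m::finite \<Rightarrow> ('n::finite, 'a::comm_ring_1) mpoly"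
  assumes g: "\<And>i. homogeneous_mpoly e (g i)" and p: "homogeneous_mpoly N p"
  shows "homogeneous_mpoly (e * N) (msub mpoly_const g p)"
  unfolding msub_def
proof (rule homogeneous_sum)
  fix m assume "m \<in> Poly_Mapping.keys p"
  hence "N = (\<Sum>i\<in>UNIV. Poly_Mapping.lookup m i)" using p by (simp add: homogeneous_mpoly_def)
  moreover have "homogeneous_mpoly (\<Sum>i\<in>UNIV. e * Poly_Mapping.lookup m i) (\<Prod>i\<in>UNIV. g i ^ Poly_Mapping.lookup m i)"
    by (intro homogeneous_prod homogeneous_power g)
  ultimately show "homogeneous_mpoly (e * N) (mpoly_const (Poly_Mapping.lookup p m) * (\<Prod>i\<in>UNIV. g i ^ Poly_Mapping.lookup m i))"
    by (intro homogeneous_const_mult) (simp add: sum_distrib_left)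
qed

text \<open>The component of degree \<open>k\<close> is mapped to degree \<open>e * k\<close>. For
  \<open>e > 0\<close> these degrees are distinct, so the images of different components cannot
  cancel.\<close>

lemma msub_homogeneous_component:
  fixes g :: "'m::finite \<Rightarrow> ('n::finite, 'a::comm_ring_1) mpoly"
  assumes g: "\<And>i. homogeneous_mpoly e (g i)" "e > 0" and r: "msub mpoly_const g r = 0"
  shows "msub mpoly_const g (coeff (grade r) N) = 0"
proof (cases "N \<le> degree (grade r)")
  case True
  have "r = (\<Sum>k\<le>degree (grade r). coeff (grade r) k)"
    using poly_altdef[of "grade r" 1] by (simp add: poly_grade_1)
  hence "msub mpoly_const g r = (\<Sum>k\<le>degree (grade r). msub mpoly_const g (coeff (grade r) k))"
    by (metis msub_sum ring_hom_fun_mpoly_const)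
  hence "0 = grade (\<Sum>k\<le>degree (grade r). msub mpoly_const g (coeff (grade r) k))"
    using r by (simp add: grade_hom)
  also have "\<dots> = (\<Sum>k\<le>degree (grade r). monom (msub mpoly_const g (coeff (grade r) k)) (e * k))"
    unfolding grade_hom
    by (intro sum.cong) (simp_all flip: homogeneous_iff_grade add: homogeneous_msub[OF g(1) homogeneous_coeff_grade])
  finally have "0 = coeff (\<Sum>k\<le>degree (grade r). monom (msub mpoly_const g (coeff (grade r) k)) (e * k)) (e * N)"
    by simp
  also have "\<dots> = (\<Sum>k\<le>degree (grade r). if k = N then msub mpoly_const g (coeff (grade r) N) else 0)"
    unfolding coeff_sum using g(2) by (intro sum.cong) auto
  finally show ?thesis using True by simp
next
  case False
  thus ?thesis by (simp add: coeff_eq_0 msub_hom)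
qed

text \<open>The binary form \<open>u^N q(w / u)\<close>.\<close>

definition homogenize :: "nat \<Rightarrow> ('n, 'a) mpoly \<Rightarrow> ('n, 'a) mpoly \<Rightarrow> 'a::comm_ring_1 poly \<Rightarrow> ('n, 'a) mpoly" where
  "homogenize N u w q = (\<Sum>k\<le>N. mpoly_const (coeff q k) * u ^ (N - k) * w ^ k)"

lemmas mpoly_const_hom = ring_hom_funD[OF ring_hom_fun_mpoly_const]

lemma homogenize_add: "homogenize N u w (p + q) = homogenize N u w p + homogenize N u w q"
  by (simp add: homogenize_def mpoly_const_hom distrib_right sum.distrib)

lemma homogenize_0 [simp]: "homogenize N u w 0 = 0"
  by (simp add: homogenize_def mpoly_const_hom)

lemma homogenize_sum: "homogenize N u w (sum f A) = (\<Sum>a\<in>A. homogenize N u w (f a))"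
  by (induction A rule: infinite_finite_induct) (auto simp: homogenize_add)

lemma homogenize_smult: "homogenize N u w (smult c q) = mpoly_const c * homogenize N u w q"
  by (simp add: homogenize_def mpoly_const_hom sum_distrib_left mult.assoc)

lemma homogenize_pCons_0: "homogenize (Suc N) u w (pCons 0 q) = w * homogenize N u w q"
  unfolding homogenize_def sum.atMost_Suc_shift
  by (simp add: mpoly_const_hom sum_distrib_left mult_ac)

lemma homogenize_Suc:
  assumes "degree q \<le> N"
  shows "homogenize (Suc N) u w q = u * homogenize N u w q"
  using assms by (simp add: homogenize_def coeff_eq_0 mpoly_const_hom sum_distrib_left Suc_diff_le mult_ac)

lemma homogenize_monom:
  assumes "k \<le> N"
  shows "homogenize N u w (monom c k) = mpoly_const c * u ^ (N - k) * w ^ k"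
proof -
  have "homogenize N u w (monom c k) = (\<Sum>j\<le>N. if j = k then mpoly_const c * u ^ (N - k) * w ^ k else 0)"
    unfolding homogenize_def by (intro sum.cong) (auto simp: mpoly_const_hom)
  thus ?thesis using assms by simp
qed

text \<open>A binary form over an algebraically closed field splits into linear factors.\<close>

lemma prime_dvd_homogenize:
  fixes u w G :: "('n::{finite,linorder}, 'k::alg_closed_field) mpoly"
  assumes G: "prime_elem G" "\<not> G dvd u" and "q \<noteq> 0" "degree q \<le> N" "G dvd homogenize N u w q"
  shows "\<exists>c. G dvd w - mpoly_const c * u"
  using assms(3-5)
proof (induction N arbitrary: q)
  case base: 0
  then obtain a where q: "q = [:a:]" "a \<noteq> 0" by (metis degree_eq_zeroE le_zero_eq pCons_0_0)
  hence "G dvd mpoly_const a" using base by (simp add: homogenize_def)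
  hence "G dvd mpoly_const a * mpoly_const (1 / a)" by (rule dvd_mult2)
  also have "mpoly_const a * mpoly_const (1 / a) = (1 :: ('n, 'k) mpoly)"
    using q by (simp add: mpoly_const_def mult_single)
  finally show ?case using G by (simp add: prime_elem_def)
next
  case (Suc N)
  show ?case
  proof (cases "degree q \<le> N")
    \<comment> \<open>Here \<open>u\<close> is a linear factor of the form, and \<open>G\<close>
      does not divide it.\<close>
    case True
    hence "G dvd u * homogenize N u w q" using Suc.prems by (simp add: homogenize_Suc)
    hence "G dvd homogenize N u w q" using G by (metis prime_elem_dvd_multD)
    thus ?thesis using Suc.IH[of q] Suc.prems True by blast
  next
    case False
    hence "degree q > 0" by simp
    \<comment> \<open>A root \<open>c\<close> of \<open>q\<close> splits off the linear factor
      \<open>w - c u\<close>.\<close>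
    then obtain c where "poly q c = 0" using alg_closed_imp_poly_has_root by blast
    then obtain s where s: "q = [:- c, 1:] * s" by (metis poly_eq_0_iff_dvd dvdE)
    have s0: "s \<noteq> 0" using s Suc.prems by auto
    have "degree q = degree [:- c, 1:] + degree s"
      unfolding s by (rule degree_mult_eq) (use s0 in auto)
    hence deg: "degree s \<le> N" using Suc.prems by simp
    have "q = smult (- c) s + pCons 0 s" using s by simp
    hence "homogenize (Suc N) u w q = mpoly_const (- c) * (u * homogenize N u w s) + w * homogenize N u w s"
      by (simp only: homogenize_add homogenize_smult homogenize_pCons_0 homogenize_Suc[OF deg])
    also have "\<dots> = (w - mpoly_const c * u) * homogenize N u w s"
      by (simp add: mpoly_const_hom algebra_simps)
    finally have "G dvd (w - mpoly_const c * u) * homogenize N u w s" using Suc.prems by simp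
    hence "G dvd w - mpoly_const c * u \<or> G dvd homogenize N u w s"
      by (rule prime_elem_dvd_multD[OF G(1)])
    thus ?thesis using Suc.IH[OF s0 deg] by blast
  qed
qed

text \<open>Restriction of a form in \<open>x_1, x_2, x_3\<close> to the projective line
  \<open>x_2 = \<kappa> x_1\<close>, in the chart \<open>x_1 = 1\<close> with coordinate
  \<open>x_3\<close>.\<close>

definition dehomogenize :: "'k \<Rightarrow> (4, 'k::comm_ring_1) mpoly \<Rightarrow> 'k poly" where
  "dehomogenize \<kappa> = msub (\<lambda>c. [:c:])
     (\<lambda>i. if i = 1 then 1 else if i = 2 then [:\<kappa>:] else if i = 3 then [:0, 1:] else 0)"

lemma pCons_0_1_power: "pCons 0 1 ^ k = monom (1::'a::comm_ring_1) k"
proof -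
  have "pCons 0 1 = monom (1 :: 'a) 1" by (simp add: monom_altdef)
  thus ?thesis by (simp add: monom_power)
qed

lemma dehomogenize_single:
  assumes "Poly_Mapping.lookup m 4 = 0"
  shows "dehomogenize \<kappa> (Poly_Mapping.single m c) =
     monom (c * \<kappa> ^ Poly_Mapping.lookup m 2) (Poly_Mapping.lookup m 3)"
  unfolding dehomogenize_def using assms
  by (simp add: msub_single prod_4 neq_4 smult_monom mult_ac poly_const_pow pCons_0_1_power)

lemma homogeneous_sum_4:
  fixes r :: "(4, 'a::zero) mpoly"
  assumes "homogeneous_mpoly N r" "m \<in> Poly_Mapping.keys r" "Poly_Mapping.lookup m 4 = 0"
  shows "N = Poly_Mapping.lookup m 1 + Poly_Mapping.lookup m 2 + Poly_Mapping.lookup m 3"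
  using assms by (force simp: homogeneous_mpoly_def sum_4)

lemma degree_dehomogenize_le:
  fixes r :: "(4, 'a::comm_ring_1) mpoly"
  assumes r: "homogeneous_mpoly N r" "\<forall>m\<in>Poly_Mapping.keys r. Poly_Mapping.lookup m 4 = 0"
  shows "degree (dehomogenize \<kappa> r) \<le> N"
proof -
  have "dehomogenize \<kappa> r = (\<Sum>m\<in>Poly_Mapping.keys r. dehomogenize \<kappa> (Poly_Mapping.single m (Poly_Mapping.lookup r m)))"
    unfolding dehomogenize_def by (subst mpoly_sum_monomials) (simp add: msub_hom)
  also have "degree \<dots> \<le> N"
  proof (rule degree_sum_le)
    fix m assume m: "m \<in> Poly_Mapping.keys r"
    hence "Poly_Mapping.lookup m 4 = 0" using r by blast
    thus "degree (dehomogenize \<kappa> (Poly_Mapping.single m (Poly_Mapping.lookup r m))) \<le> N"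
      using homogeneous_sum_4[OF r(1) m] by (simp add: dehomogenize_single) (rule order_trans[OF degree_monom_le], simp)
  qed simp
  finally show ?thesis .
qed

text \<open>Nothing is lost in the chart: by homogeneity the exponent of \<open>u\<close> is
  \<open>N\<close> minus that of \<open>w\<close>.\<close>

lemma homogenize_dehomogenize:
  fixes r :: "(4, 'a::comm_ring_1) mpoly" and u w z :: "('n::finite, 'a) mpoly"
  assumes r: "homogeneous_mpoly N r" "\<forall>m\<in>Poly_Mapping.keys r. Poly_Mapping.lookup m 4 = 0"
  shows "homogenize N u w (dehomogenize \<kappa> r) =
     msub mpoly_const (\<lambda>i. if i = 1 then u else if i = 2 then mpoly_const \<kappa> * u else if i = 3 then w else z) r"
    (is "_ = msub _ ?g _")
proof -
  have "homogenize N u w (dehomogenize \<kappa> (Poly_Mapping.single m (Poly_Mapping.lookup r m))) =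
     mpoly_const (Poly_Mapping.lookup r m) * (\<Prod>i\<in>UNIV. ?g i ^ Poly_Mapping.lookup m i)"
    if m: "m \<in> Poly_Mapping.keys r" for m
  proof -
    have m4: "Poly_Mapping.lookup m 4 = 0" using r m by blast
    note N = homogeneous_sum_4[OF r(1) m m4]
    show ?thesis
      by (simp add: dehomogenize_single[OF m4] homogenize_monom N prod_4 neq_4 m4 mpoly_const_hom
          power_mult_distrib power_add mult_ac)
  qed
  moreover have "dehomogenize \<kappa> r = (\<Sum>m\<in>Poly_Mapping.keys r. dehomogenize \<kappa> (Poly_Mapping.single m (Poly_Mapping.lookup r m)))"
    unfolding dehomogenize_def by (subst mpoly_sum_monomials) (simp add: msub_hom)
  ultimately show ?thesis unfolding msub_def by (simp add: homogenize_sum)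
qed

text \<open>With \<open>\<kappa>\<close> as a second indeterminate the restriction becomes
  \<open>F\<close>. Different monomials of \<open>r\<close> remain different, because the exponent
  of \<open>x_1\<close> is \<open>N\<close> minus the others, so \<open>F \<noteq> 0\<close> has
  finitely many roots.\<close>

lemma finite_dehomogenize_eq_0:
  fixes r :: "(4, 'k::idom) mpoly"
  assumes r: "homogeneous_mpoly N r" "\<forall>m\<in>Poly_Mapping.keys r. Poly_Mapping.lookup m 4 = 0" and "r \<noteq> 0"
  shows "finite {\<kappa>. dehomogenize \<kappa> r = 0}"
proof -
  define c where "c = (\<lambda>a::'k. [:[:a:]:])"
  have c: "ring_hom_fun c" by (simp add: c_def ring_hom_fun_def)
  define g :: "4 \<Rightarrow> 'k poly poly" where
    "g = (\<lambda>i. if i = 1 then 1 else if i = 2 then [:0, 1:] else if i = 3 then [:[:0, 1:]:] else 0)"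
  define F where "F = msub c g r"
  have ev: "poly (msub c g p) [:\<kappa>:] = dehomogenize \<kappa> p" for p \<kappa>
  proof -
    have "poly (msub c g p) [:\<kappa>:] = msub (\<lambda>a. poly (c a) [:\<kappa>:]) (\<lambda>i. poly (g i) [:\<kappa>:]) p"
      by (rule hom_msub[OF ring_hom_fun_poly c])
    also have "(\<lambda>a. poly (c a) [:\<kappa>:]) = (\<lambda>a. [:a:])" by (simp add: c_def)
    also have "(\<lambda>i. poly (g i) [:\<kappa>:]) = (\<lambda>i. if i = 1 then 1 else if i = 2 then [:\<kappa>:] else if i = 3 then [:0, 1:] else 0)"
      by (auto simp: g_def)
    finally show ?thesis by (simp only: dehomogenize_def)
  qed
  have single: "msub c g (Poly_Mapping.single m a) = monom (monom a (Poly_Mapping.lookup m 3)) (Poly_Mapping.lookup m 2)"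
    if "Poly_Mapping.lookup m 4 = 0" for m a
    unfolding msub_single[OF c] prod_4
    using that by (simp add: neq_4 g_def c_def pCons_0_1_power poly_const_pow smult_monom mult_ac)
  have "\<exists>m. m \<in> Poly_Mapping.keys r" using \<open>r \<noteq> 0\<close> by (metis ex_in_conv keys_eq_empty)
  then obtain m where m: "m \<in> Poly_Mapping.keys r" ..
  have F: "F = (\<Sum>k\<in>Poly_Mapping.keys r. monom (monom (Poly_Mapping.lookup r k) (Poly_Mapping.lookup k 3)) (Poly_Mapping.lookup k 2))"
  proof -
    have "F = (\<Sum>k\<in>Poly_Mapping.keys r. msub c g (Poly_Mapping.single k (Poly_Mapping.lookup r k)))"
      unfolding F_def by (subst mpoly_sum_monomials) (simp add: msub_hom[OF c])
    also have "\<dots> = (\<Sum>k\<in>Poly_Mapping.keys r. monom (monom (Poly_Mapping.lookup r k) (Poly_Mapping.lookup k 3)) (Poly_Mapping.lookup k 2))"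
      by (rule sum.cong) (use r(2) single in auto)
    finally show ?thesis .
  qed
  have "coeff (coeff F (Poly_Mapping.lookup m 2)) (Poly_Mapping.lookup m 3) =
      (\<Sum>k\<in>Poly_Mapping.keys r. if k = m then Poly_Mapping.lookup r k else 0)"
    unfolding F coeff_sum
  proof (rule sum.cong)
    fix k assume k: "k \<in> Poly_Mapping.keys r"
    have k4: "Poly_Mapping.lookup k 4 = 0" "Poly_Mapping.lookup m 4 = 0" using k m r by auto
    have "k = m \<longleftrightarrow> Poly_Mapping.lookup k 2 = Poly_Mapping.lookup m 2 \<and> Poly_Mapping.lookup k 3 = Poly_Mapping.lookup m 3"
      unfolding poly_mapping_eq_iff fun_eq_iff forall_4
      using homogeneous_sum_4[OF r(1) k k4(1)] homogeneous_sum_4[OF r(1) m k4(2)] k4 by auto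
    thus "coeff (coeff (monom (monom (Poly_Mapping.lookup r k) (Poly_Mapping.lookup k 3)) (Poly_Mapping.lookup k 2))
        (Poly_Mapping.lookup m 2)) (Poly_Mapping.lookup m 3) = (if k = m then Poly_Mapping.lookup r k else 0)"
      by auto
  qed simp
  also have "\<dots> \<noteq> 0" using m by (simp add: in_keys_iff)
  finally have "F \<noteq> 0" by auto
  hence "finite {x. poly F x = 0}" by (rule poly_roots_finite)
  hence "finite ((\<lambda>\<kappa>. [:\<kappa>:]) -` {x. poly F x = 0})"
    by (rule finite_vimageI) (simp add: inj_def)
  moreover have "(\<lambda>\<kappa>. [:\<kappa>:]) -` {x. poly F x = 0} = {\<kappa>. dehomogenize \<kappa> r = 0}"
    by (auto simp: F_def ev)
  ultimately show ?thesis by simp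
qed

lemma peval_0_imp_not_unit: "peval a p = 0 \<Longrightarrow> \<not> p dvd (1 :: ('n::finite, 'a::idom) mpoly)"
proof
  assume "peval a p = 0" "p dvd 1"
  then obtain k where "1 = p * k" by (elim dvdE)
  hence "peval a 1 = peval a p * peval a k" by (metis peval_hom(3))
  thus False using \<open>peval a p = 0\<close> by simp
qed

text \<open>If every \<open>s\<close> failed, each would come with a prime factor of
  \<open>u\<close>, and one prime would serve two values of \<open>s\<close>. It then divides the
  difference, a non-zero multiple of \<open>c\<close>, and so both \<open>b\<close> and
  \<open>c\<close>.\<close>

lemma combination_avoiding_common_primes:
  fixes u b c :: "(4, 'k::field_char_0) mpoly"
  assumes "u \<noteq> 0"
  shows "\<exists>s. \<forall>q. prime_elem q \<longrightarrow> q dvd u \<longrightarrow> q dvd b + mpoly_const s * c \<longrightarrow> q dvd b \<and> q dvd c"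
proof (rule ccontr)
  assume "\<not> ?thesis"
  hence "\<forall>s. \<exists>q. prime_elem q \<and> q dvd u \<and> q dvd b + mpoly_const s * c \<and> \<not> (q dvd b \<and> q dvd c)"
    unfolding not_ex not_all not_imp .
  from choice[OF this] obtain G where G: "\<forall>s. prime_elem (G s) \<and> G s dvd u \<and>
    G s dvd b + mpoly_const s * c \<and> \<not> (G s dvd b \<and> G s dvd c)" ..
  have "infinite (UNIV :: 'k set)" by (rule infinite_UNIV_char_0)
  from finite_prime_divisors_pigeonhole[OF assms this, of G] G
  obtain x y where xy: "x \<noteq> y" "G x dvd G y" by metis
  have "G x dvd (b + mpoly_const x * c) - (b + mpoly_const y * c)"
    using G xy(2) by (intro dvd_diff) (metis dvd_trans)+
  also have "(b + mpoly_const x * c) - (b + mpoly_const y * c) = mpoly_const (x - y) * c"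
    by (simp add: mpoly_const_hom algebra_simps)
  finally have "G x dvd mpoly_const (1 / (x - y)) * (mpoly_const (x - y) * c)" by (rule dvd_mult)
  also have "mpoly_const (1 / (x - y)) * (mpoly_const (x - y) * c) = c"
    using xy(1) by (simp flip: mult.assoc mpoly_const_hom(3)) (simp add: mpoly_const_hom)
  finally have c: "G x dvd c" .
  hence "G x dvd mpoly_const x * c" by (rule dvd_mult)
  hence "G x dvd b" using G dvd_add_left_iff[of "G x" "mpoly_const x * c" b] by metis
  thus False using G c by metis
qed

text \<open>Elimination always removes the last variable. The coordinate change
  \<open>\<alpha>\<close> with inverse \<open>\<beta>\<close> decides which combinations of the
  \<open>h i\<close> the remaining relation connects.\<close>

lemma linear_change_relation:
  fixes u v :: "(4, 'k::field) mpoly" and h \<alpha> \<beta> :: "4 \<Rightarrow> (4, 'k) mpoly"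
  assumes u: "u \<noteq> 0" and nc: "\<And>q. prime_elem q \<Longrightarrow> q dvd u \<Longrightarrow> q dvd v \<Longrightarrow> False"
    and inv1: "\<And>i. msub mpoly_const \<alpha> (\<beta> i) = mpoly_var i"
    and inv2: "\<And>i. msub mpoly_const \<beta> (\<alpha> i) = mpoly_var i"
    and uh: "msub mpoly_const h u = 0" and vh: "msub mpoly_const h v = 0"
  shows "\<exists>r. r \<noteq> 0 \<and> (\<forall>m\<in>Poly_Mapping.keys r. Poly_Mapping.lookup m 4 = 0) \<and>
     msub mpoly_const (\<lambda>i. msub mpoly_const h (\<alpha> i)) r = 0"
proof -
  let ?A = "msub mpoly_const \<alpha>" and ?B = "msub mpoly_const \<beta>"
  have AB: "?A (?B p) = p" for p
    by (subst hom_msub) (simp_all add: ring_hom_fun_msub msub_const inv1)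
  have BA: "?B (?A p) = p" for p
    by (subst hom_msub) (simp_all add: ring_hom_fun_msub msub_const inv2)
  have dvd: "q dvd ?B p \<Longrightarrow> ?A q dvd p" for p q
  proof -
    assume "q dvd ?B p"
    then obtain k where "?B p = q * k" by (rule dvdE)
    from arg_cong[OF this, of ?A] have "p = ?A q * ?A k" by (simp add: msub_hom AB)
    thus "?A q dvd p" by (rule dvdI)
  qed
  have prime: "prime_elem (?A q)" if q: "prime_elem q" for q
  proof (rule prime_elemI)
    show "?A q \<noteq> 0"
    proof
      assume "?A q = 0"
      hence "q = ?B 0" by (metis BA)
      thus False using q by (simp add: msub_hom)
    qed
    show "\<not> ?A q dvd 1"
    proof
      assume "?A q dvd 1"
      then obtain k where "1 = ?A q * k" by (rule dvdE)
      from arg_cong[OF this, of ?B] have "1 = q * ?B k" by (simp add: msub_hom BA)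
      hence "q dvd 1" by (rule dvdI)
      thus False using q by (simp add: prime_elem_def)
    qed
    fix a b assume "?A q dvd a * b"
    then obtain k where "a * b = ?A q * k" by (rule dvdE)
    from arg_cong[OF this, of ?B] have "?B a * ?B b = q * ?B k" by (simp add: msub_hom BA)
    hence "q dvd ?B a * ?B b" by (rule dvdI)
    hence "q dvd ?B a \<or> q dvd ?B b" by (rule prime_elem_dvd_multD[OF q])
    thus "?A q dvd a \<or> ?A q dvd b" using dvd by blast
  qed
  have "?B u \<noteq> 0"
  proof
    assume "?B u = 0"
    hence "u = ?A 0" by (metis AB)
    thus False using u by (simp add: msub_hom)
  qed
  moreover have False if "prime_elem q" "q dvd ?B u" "q dvd ?B v" for q
    by (rule nc[OF prime[OF that(1)] dvd[OF that(2)] dvd[OF that(3)]])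
  ultimately have "\<exists>a b r. r \<noteq> 0 \<and> r = a * ?B u + b * ?B v \<and> (\<forall>m\<in>Poly_Mapping.keys r. Poly_Mapping.lookup m 4 = 0)"
    by (rule mpoly_elimination)
  then obtain a b r where r: "r \<noteq> 0" "r = a * ?B u + b * ?B v" "\<forall>m\<in>Poly_Mapping.keys r. Poly_Mapping.lookup m 4 = 0"
    by (elim exE conjE)
  \<comment> \<open>In the original coordinates the eliminant lies in the ideal of \<open>u\<close>
    and \<open>v\<close>, both of which vanish at \<open>h\<close>.\<close>
  have "?A r = ?A a * u + ?A b * v" by (simp add: r(2) msub_hom AB)
  hence "msub mpoly_const h (?A r) = 0" by (simp add: msub_hom uh vh)
  moreover have "msub mpoly_const h (?A r) = msub mpoly_const (\<lambda>i. msub mpoly_const h (\<alpha> i)) r"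
    by (subst hom_msub) (simp_all add: ring_hom_fun_msub msub_const)
  ultimately show ?thesis using r(1,3) by (intro exI[of _ r] conjI) simp_all
qed

text \<open>Modulo a prime factor of \<open>v - \<kappa> u\<close>, a homogeneous relation between \<open>u\<close>, \<open>v\<close>, \<open>w\<close> becomes a binary
  form in \<open>u\<close> and \<open>w\<close>.\<close>

lemma proportional_mod_prime:
  fixes u v w :: "(4, 'k::alg_closed_field) mpoly"
  assumes r: "homogeneous_mpoly N r" "\<forall>m\<in>Poly_Mapping.keys r. Poly_Mapping.lookup m 4 = 0"
    and rel: "msub mpoly_const g r = 0" and g: "g 1 = u" "g 2 = v" "g 3 = w"
    and \<kappa>: "dehomogenize \<kappa> r \<noteq> 0"
    and G: "prime_elem G" "\<not> G dvd u" "G dvd v - mpoly_const \<kappa> * u"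
  shows "\<exists>c. G dvd w - mpoly_const c * u"
proof (rule prime_dvd_homogenize[OF G(1,2) \<kappa> degree_dehomogenize_le[OF r]])
  \<comment> \<open>\<open>?g\<close> differs from \<open>g\<close> only at 2, where
    \<open>v\<close> is replaced by its residue \<open>\<kappa> u\<close>.\<close>
  let ?g = "\<lambda>i. if i = 1 then u else if i = 2 then mpoly_const \<kappa> * u else if i = 3 then w else g 4"
  have cong: "G dvd g i - ?g i" for i
    using exhaust_4[of i] g G(3) by (auto simp: neq_4)
  have "G dvd msub mpoly_const g r - msub mpoly_const ?g r"
  proof (rule hom_cong_dvd[where \<phi> = "msub mpoly_const g" and \<psi> = "msub mpoly_const ?g"])
    show "G dvd msub mpoly_const g (mpoly_var i) - msub mpoly_const ?g (mpoly_var i)" for i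
      unfolding msub_var[OF ring_hom_fun_mpoly_const] by (rule cong)
  qed (simp_all only: ring_hom_fun_msub ring_hom_fun_mpoly_const msub_const)
  hence "G dvd msub mpoly_const ?g r" by (simp only: rel diff_0 dvd_minus_iff)
  thus "G dvd homogenize N u w (dehomogenize \<kappa> r)"
    by (simp only: homogenize_dehomogenize[OF r, where z = "g 4"])
qed

subsection \<open>Zeros of the vector field\<close>

text \<open>The case \<open>e > 0\<close>, detached from the form: zeros and values of
  \<open>h\<close> are studied for the field alone, and \<open>f\<close> returns only in
  \<open>dir_deriv_eq_0\<close>.\<close>

locale self_annihilating_field =
  fixes h :: "4 \<Rightarrow> (4, 'k::{alg_closed_field, field_char_0}) mpoly" and e :: nat
  assumes homog: "homogeneous_mpoly e (h i)" and e_pos: "e > 0" and Dh: "dir_deriv h (h i) = 0"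
    and nonzero: "\<exists>i. h i \<noteq> 0" and primitive: "prime_elem G \<Longrightarrow> \<not> (\<forall>i. G dvd h i)"
begin

definition lincomb :: "(4 \<Rightarrow> 'k) \<Rightarrow> (4, 'k) mpoly" where
  "lincomb a = (\<Sum>i\<in>UNIV. mpoly_const (a i) * h i)"

lemma msub_h: "msub mpoly_const h (h i) = 0"
  by (rule msub_self_eq_0[OF Dh homog e_pos Dh])

lemma lincomb_homog: "homogeneous_mpoly e (lincomb a)"
  unfolding lincomb_def by (intro homogeneous_sum homogeneous_const_mult homog)

lemma msub_lincomb: "msub mpoly_const h (lincomb a) = 0"
  by (simp add: lincomb_def msub_hom msub_h)

lemma D_lincomb: "dir_deriv h (lincomb a) = 0"
proof -
  have "dir_deriv h (sum f A) = (\<Sum>a\<in>A. dir_deriv h (f a))" for f :: "4 \<Rightarrow> _" and A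
    by (induction A rule: infinite_finite_induct) (auto simp: dir_deriv_add)
  thus ?thesis by (simp add: lincomb_def dir_deriv_mult dir_deriv_const Dh)
qed

lemma homogeneous_peval_0: "homogeneous_mpoly e p \<Longrightarrow> peval (\<lambda>_. 0) p = 0"
  using peval_scale[of e p 0 "\<lambda>_. 0"] e_pos by (simp add: power_0_left)

definition pencil :: "(4, 'k) mpoly \<Rightarrow> (4, 'k) mpoly \<Rightarrow> bool" where
  "pencil u v \<longleftrightarrow> u \<in> range lincomb \<and> v \<in> range lincomb \<and> u \<noteq> 0 \<and>
     (\<forall>q. prime_elem q \<longrightarrow> q dvd u \<longrightarrow> \<not> q dvd v)"

definition good :: "(4, 'k) mpoly \<Rightarrow> (4, 'k) mpoly \<Rightarrow> 'k \<Rightarrow> bool" where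
  "good u v \<kappa> \<longleftrightarrow> (\<forall>G. prime_elem G \<longrightarrow> G dvd v - mpoly_const \<kappa> * u \<longrightarrow>
     (\<exists>c. \<forall>i. G dvd h i - mpoly_const (c i) * u))"

text \<open>The implication stands inside the quantifier so that \<open>s\<close> can be chosen
  before it is known which \<open>h i\<close> vanish.\<close>

lemma nonzero_combination: "\<exists>s. (b \<noteq> 0 \<or> c \<noteq> 0) \<longrightarrow> b + mpoly_const s * c \<noteq> (0 :: (4, 'k) mpoly)"
proof (cases "b = 0")
  case True
  thus ?thesis by (intro exI[of _ 1]) (simp add: mpoly_const_hom)
next
  case False
  thus ?thesis by (intro exI[of _ 0]) (simp add: mpoly_const_hom)
qed

text \<open>The coefficients 1 of \<open>h 1\<close> and \<open>h 2\<close> make \<open>u\<close>,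
  \<open>v\<close>, \<open>h 3\<close>, \<open>h 4\<close> a unitriangular change of the
  \<open>h i\<close>. The free coefficients serve to get \<open>u \<noteq> 0\<close> and to avoid
  common primes.\<close>

lemma pencil_coordinates:
  "\<exists>m2 m3 m4 l3 l4. h 1 + mpoly_const m2 * h 2 + mpoly_const m3 * h 3 + mpoly_const m4 * h 4 \<noteq> 0 \<and>
     (\<forall>q. prime_elem q \<longrightarrow> q dvd h 1 + mpoly_const m2 * h 2 + mpoly_const m3 * h 3 + mpoly_const m4 * h 4 \<longrightarrow>
       \<not> q dvd h 2 + mpoly_const l3 * h 3 + mpoly_const l4 * h 4)"
proof -
  obtain m2 where m2: "h 1 \<noteq> 0 \<or> h 2 \<noteq> 0 \<Longrightarrow> h 1 + mpoly_const m2 * h 2 \<noteq> 0"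
    using nonzero_combination[of "h 1" "h 2"] by blast
  obtain m3 where m3: "h 1 + mpoly_const m2 * h 2 \<noteq> 0 \<or> h 3 \<noteq> 0 \<Longrightarrow>
      h 1 + mpoly_const m2 * h 2 + mpoly_const m3 * h 3 \<noteq> 0"
    using nonzero_combination[of "h 1 + mpoly_const m2 * h 2" "h 3"] by blast
  obtain m4 where m4: "h 1 + mpoly_const m2 * h 2 + mpoly_const m3 * h 3 \<noteq> 0 \<or> h 4 \<noteq> 0 \<Longrightarrow>
      h 1 + mpoly_const m2 * h 2 + mpoly_const m3 * h 3 + mpoly_const m4 * h 4 \<noteq> 0"
    using nonzero_combination[of "h 1 + mpoly_const m2 * h 2 + mpoly_const m3 * h 3" "h 4"] by blast
  define u where "u = h 1 + mpoly_const m2 * h 2 + mpoly_const m3 * h 3 + mpoly_const m4 * h 4"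
  have "h 1 \<noteq> 0 \<or> h 2 \<noteq> 0 \<or> h 3 \<noteq> 0 \<or> h 4 \<noteq> 0"
    using nonzero forall_4[of "\<lambda>i. h i = 0"] by blast
  hence u: "u \<noteq> 0" using m2 m3 m4 unfolding u_def by blast
  obtain l3 where l3: "\<forall>q. prime_elem q \<longrightarrow> q dvd u \<longrightarrow> q dvd h 2 + mpoly_const l3 * h 3 \<longrightarrow> q dvd h 2 \<and> q dvd h 3"
    using combination_avoiding_common_primes[OF u] by metis
  obtain l4 where l4: "\<forall>q. prime_elem q \<longrightarrow> q dvd u \<longrightarrow> q dvd h 2 + mpoly_const l3 * h 3 + mpoly_const l4 * h 4 \<longrightarrow>
      q dvd h 2 + mpoly_const l3 * h 3 \<and> q dvd h 4"
    using combination_avoiding_common_primes[OF u] by metis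
  have "False" if q: "prime_elem q" "q dvd u" "q dvd h 2 + mpoly_const l3 * h 3 + mpoly_const l4 * h 4" for q
  proof -
    \<comment> \<open>By the choice of \<open>l3\<close> and \<open>l4\<close>, a common prime
      divides \<open>h 2\<close>, \<open>h 3\<close> and \<open>h 4\<close>; by the shape of
      \<open>u\<close> it then divides \<open>h 1\<close>.\<close>
    have d: "q dvd h 2" "q dvd h 3" "q dvd h 4" using l3 l4 q by metis+
    have "q dvd mpoly_const m2 * h 2 + (mpoly_const m3 * h 3 + mpoly_const m4 * h 4)"
      by (intro dvd_add dvd_mult d)
    moreover have "u = (mpoly_const m2 * h 2 + (mpoly_const m3 * h 3 + mpoly_const m4 * h 4)) + h 1"
      by (simp add: u_def)
    ultimately have "q dvd h 1" using q(2) dvd_add_right_iff by metis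
    hence "\<forall>i. q dvd h i" using d by (simp add: forall_4)
    thus False using primitive[OF q(1)] by blast
  qed
  hence "\<forall>q. prime_elem q \<longrightarrow> q dvd u \<longrightarrow> \<not> q dvd h 2 + mpoly_const l3 * h 3 + mpoly_const l4 * h 4"
    by metis
  with u have "u \<noteq> 0 \<and> (\<forall>q. prime_elem q \<longrightarrow> q dvd u \<longrightarrow> \<not> q dvd h 2 + mpoly_const l3 * h 3 + mpoly_const l4 * h 4)"
    by (rule conjI)
  thus ?thesis unfolding u_def by (intro exI)
qed

text \<open>The exceptional \<open>\<kappa>\<close> are among those for which the relation vanishes
  identically on \<open>x_2 = \<kappa> x_1\<close>. For all others it gives a non-zero binary form
  modulo \<open>G\<close>.\<close>

lemma pencil_relation:
  fixes \<alpha> \<beta> :: "4 \<Rightarrow> (4, 'k) mpoly"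
  assumes pencil: "pencil u v" and uv: "msub mpoly_const h (\<alpha> 1) = u" "msub mpoly_const h (\<alpha> 2) = v"
    and \<alpha>: "\<And>i. msub mpoly_const h (\<alpha> i) \<in> range lincomb"
    and inv: "\<And>i. msub mpoly_const \<alpha> (\<beta> i) = mpoly_var i" "\<And>i. msub mpoly_const \<beta> (\<alpha> i) = mpoly_var i"
  shows "finite {\<kappa>. \<exists>G. prime_elem G \<and> \<not> G dvd u \<and> G dvd v - mpoly_const \<kappa> * u \<and>
     \<not> (\<exists>c. G dvd msub mpoly_const h (\<alpha> 3) - mpoly_const c * u)}"
proof -
  let ?g = "\<lambda>i. msub mpoly_const h (\<alpha> i)"
  have "\<exists>r. r \<noteq> 0 \<and> (\<forall>m\<in>Poly_Mapping.keys r. Poly_Mapping.lookup m 4 = 0) \<and> msub mpoly_const ?g r = 0"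
  proof (rule linear_change_relation[where u = u and v = v])
    show "u \<noteq> 0" using pencil by (simp add: pencil_def)
    show False if "prime_elem q" "q dvd u" "q dvd v" for q using pencil that unfolding pencil_def by metis
    show "msub mpoly_const h u = 0" "msub mpoly_const h v = 0"
      using pencil unfolding pencil_def by (auto simp: msub_lincomb)
  qed (fact inv)+
  then obtain r where r: "r \<noteq> 0" "\<forall>m\<in>Poly_Mapping.keys r. Poly_Mapping.lookup m 4 = 0" "msub mpoly_const ?g r = 0"
    by (elim exE conjE)
  have "grade r \<noteq> 0" using r(1) by simp
  then obtain N where N: "coeff (grade r) N \<noteq> 0" by (metis leading_coeff_0_iff)
  \<comment> \<open>Passage to a binary form needs a homogeneous relation; each component of
    \<open>r\<close> is a relation because \<open>e > 0\<close>.\<close>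
  define s where "s = coeff (grade r) N"
  have s: "homogeneous_mpoly N s" unfolding s_def by (rule homogeneous_coeff_grade)
  have s4: "\<forall>m\<in>Poly_Mapping.keys s. Poly_Mapping.lookup m 4 = 0"
    using r(2) by (auto simp: s_def in_keys_iff lookup_coeff_grade split: if_splits)
  have "homogeneous_mpoly e (?g i)" for i using \<alpha>[of i] lincomb_homog by auto
  hence rel: "msub mpoly_const ?g s = 0" unfolding s_def by (rule msub_homogeneous_component[OF _ e_pos r(3)])
  have "{\<kappa>. \<exists>G. prime_elem G \<and> \<not> G dvd u \<and> G dvd v - mpoly_const \<kappa> * u \<and>
     \<not> (\<exists>c. G dvd msub mpoly_const h (\<alpha> 3) - mpoly_const c * u)} \<subseteq> {\<kappa>. dehomogenize \<kappa> s = 0}" (is "?bad \<subseteq> _")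
  proof
    fix \<kappa> assume "\<kappa> \<in> ?bad"
    then obtain G where G: "prime_elem G" "\<not> G dvd u" "G dvd v - mpoly_const \<kappa> * u"
      "\<not> (\<exists>c. G dvd msub mpoly_const h (\<alpha> 3) - mpoly_const c * u)"
      by (elim CollectE exE conjE)
    show "\<kappa> \<in> {\<kappa>. dehomogenize \<kappa> s = 0}"
    proof (rule CollectI, rule ccontr)
      assume "dehomogenize \<kappa> s \<noteq> 0"
      from G(4) proportional_mod_prime[OF s s4 rel uv refl this G(1-3)] show False by (rule notE)
    qed
  qed
  moreover have "finite {\<kappa>. dehomogenize \<kappa> s = 0}"
    by (rule finite_dehomogenize_eq_0[OF s s4]) (use N in \<open>simp add: s_def\<close>)
  ultimately show ?thesis by (rule finite_subset)
qed

lemma not_dvd_if_dvd_pencil_member: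
  assumes "pencil u v" "prime_elem G" "G dvd v - mpoly_const \<kappa> * u"
  shows "\<not> G dvd u"
proof
  assume "G dvd u"
  hence "G dvd mpoly_const \<kappa> * u" by (rule dvd_mult)
  from dvd_add[OF assms(3) this] have "G dvd v" by simp
  thus False using assms(1,2) \<open>G dvd u\<close> unfolding pencil_def by metis
qed

lemma ex_good_pencil: "\<exists>u v. pencil u v \<and> finite {\<kappa>. \<not> good u v \<kappa>}"
proof -
  obtain m2 m3 m4 l3 l4 where *:
    "h 1 + mpoly_const m2 * h 2 + mpoly_const m3 * h 3 + mpoly_const m4 * h 4 \<noteq> 0"
    "\<forall>q. prime_elem q \<longrightarrow> q dvd h 1 + mpoly_const m2 * h 2 + mpoly_const m3 * h 3 + mpoly_const m4 * h 4 \<longrightarrow>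
       \<not> q dvd h 2 + mpoly_const l3 * h 3 + mpoly_const l4 * h 4"
    using pencil_coordinates by (elim exE conjE)
  define u where "u = h 1 + mpoly_const m2 * h 2 + mpoly_const m3 * h 3 + mpoly_const m4 * h 4"
  define v where "v = h 2 + mpoly_const l3 * h 3 + mpoly_const l4 * h 4"
  have u: "u = lincomb (\<lambda>i. if i = 1 then 1 else if i = 2 then m2 else if i = 3 then m3 else m4)"
    by (simp add: lincomb_def sum_4 neq_4 u_def mpoly_const_hom)
  have v: "v = lincomb (\<lambda>i. if i = 1 then 0 else if i = 2 then 1 else if i = 3 then l3 else l4)"
    by (simp add: lincomb_def sum_4 neq_4 v_def mpoly_const_hom)
  have h: "h j = lincomb (\<lambda>i. if i = j then 1 else 0)" for j
  proof -
    have "lincomb (\<lambda>i. if i = j then 1 else 0) = (\<Sum>i\<in>UNIV. if i = j then h i else 0)"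
      unfolding lincomb_def by (intro sum.cong) (auto simp: mpoly_const_hom)
    thus ?thesis by simp
  qed
  have pencil: "pencil u v"
    unfolding pencil_def
  proof (intro conjI)
    show "u \<in> range lincomb" "v \<in> range lincomb" unfolding u v by (rule rangeI)+
  qed (use * in \<open>simp_all only: u_def v_def not_False_eq_True simp_thms\<close>)
  define A1 :: "(4, 'k) mpoly" where
    "A1 = mpoly_var 1 + mpoly_const m2 * mpoly_var 2 + mpoly_const m3 * mpoly_var 3 + mpoly_const m4 * mpoly_var 4"
  define A2 :: "(4, 'k) mpoly" where "A2 = mpoly_var 2 + mpoly_const l3 * mpoly_var 3 + mpoly_const l4 * mpoly_var 4"
  have A: "msub mpoly_const h A1 = u" "msub mpoly_const h A2 = v"
    by (simp_all add: A1_def A2_def u_def v_def msub_hom msub_var msub_const)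
  let ?bad = "\<lambda>w. {\<kappa>. \<exists>G. prime_elem G \<and> \<not> G dvd u \<and> G dvd v - mpoly_const \<kappa> * u \<and> \<not> (\<exists>c. G dvd w - mpoly_const c * u)}"
  \<comment> \<open>Coordinates belonging to \<open>u\<close>, \<open>v\<close>, \<open>h 3\<close>,
    \<open>h 4\<close>; the inverse \<open>\<beta>\<close> is found by back substitution in a
    unitriangular system.\<close>
  define \<alpha> where "\<alpha> = (\<lambda>i::4. if i = 1 then A1 else if i = 2 then A2 else if i = 3 then mpoly_var 3 else mpoly_var 4)"
  define \<beta> where "\<beta> = (\<lambda>i::4. if i = 1 then mpoly_var 1
      - mpoly_const m2 * (mpoly_var 2 - mpoly_const l3 * mpoly_var 3 - mpoly_const l4 * mpoly_var 4)
      - mpoly_const m3 * mpoly_var 3 - mpoly_const m4 * (mpoly_var 4 :: (4, 'k) mpoly)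
    else if i = 2 then mpoly_var 2 - mpoly_const l3 * mpoly_var 3 - mpoly_const l4 * mpoly_var 4
    else if i = 3 then mpoly_var 3 else mpoly_var 4)"
  have "finite (?bad (msub mpoly_const h (\<alpha> 3)))"
  proof (rule pencil_relation[OF pencil])
    show "msub mpoly_const h (\<alpha> i) \<in> range lincomb" for i
      using exhaust_4[of i] u v h by (auto simp: \<alpha>_def neq_4 A msub_var)
    show "msub mpoly_const \<alpha> (\<beta> i) = mpoly_var i" for i
      using exhaust_4[of i] by (auto simp: \<alpha>_def \<beta>_def A1_def A2_def msub_hom msub_var msub_const neq_4 algebra_simps)
    show "msub mpoly_const \<beta> (\<alpha> i) = mpoly_var i" for i
      using exhaust_4[of i] by (auto simp: \<alpha>_def \<beta>_def A1_def A2_def msub_hom msub_var msub_const neq_4 algebra_simps)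
  qed (simp_all add: \<alpha>_def A neq_4)
  hence fin3: "finite (?bad (h 3))" by (simp add: \<alpha>_def neq_4 msub_var)
  \<comment> \<open>The same with the last two coordinates exchanged, so that the relation concerns
    \<open>h 4\<close> in place of \<open>h 3\<close>.\<close>
  define \<alpha>' where "\<alpha>' = (\<lambda>i::4. if i = 1 then A1 else if i = 2 then A2 else if i = 3 then mpoly_var 4 else mpoly_var 3)"
  define \<beta>' where "\<beta>' = (\<lambda>i::4. if i = 1 then mpoly_var 1
      - mpoly_const m2 * (mpoly_var 2 - mpoly_const l3 * mpoly_var 4 - mpoly_const l4 * mpoly_var 3)
      - mpoly_const m3 * mpoly_var 4 - mpoly_const m4 * (mpoly_var 3 :: (4, 'k) mpoly)
    else if i = 2 then mpoly_var 2 - mpoly_const l3 * mpoly_var 4 - mpoly_const l4 * mpoly_var 3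
    else if i = 3 then mpoly_var 4 else mpoly_var 3)"
  have "finite (?bad (msub mpoly_const h (\<alpha>' 3)))"
  proof (rule pencil_relation[OF pencil])
    show "msub mpoly_const h (\<alpha>' i) \<in> range lincomb" for i
      using exhaust_4[of i] u v h by (auto simp: \<alpha>'_def neq_4 A msub_var)
    show "msub mpoly_const \<alpha>' (\<beta>' i) = mpoly_var i" for i
      using exhaust_4[of i] by (auto simp: \<alpha>'_def \<beta>'_def A1_def A2_def msub_hom msub_var msub_const neq_4 algebra_simps)
    show "msub mpoly_const \<beta>' (\<alpha>' i) = mpoly_var i" for i
      using exhaust_4[of i] by (auto simp: \<alpha>'_def \<beta>'_def A1_def A2_def msub_hom msub_var msub_const neq_4 algebra_simps)
  qed (simp_all add: \<alpha>'_def A neq_4)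
  hence fin4: "finite (?bad (h 4))" by (simp add: \<alpha>'_def neq_4 msub_var)
  have "{\<kappa>. \<not> good u v \<kappa>} \<subseteq> ?bad (h 3) \<union> ?bad (h 4)"
  proof
    fix \<kappa> assume "\<kappa> \<in> {\<kappa>. \<not> good u v \<kappa>}"
    hence "\<not> good u v \<kappa>" by (rule CollectD)
    then obtain G where G: "prime_elem G" "G dvd v - mpoly_const \<kappa> * u" "\<not> (\<exists>c. \<forall>i. G dvd h i - mpoly_const (c i) * u)"
      unfolding good_def not_all not_imp by (elim exE conjE)
    have nu: "\<not> G dvd u" using not_dvd_if_dvd_pencil_member[OF pencil G(1,2)] .
    have ex: "\<exists>c. G dvd w - mpoly_const c * u" if w: "\<kappa> \<notin> ?bad w" for w
    proof (rule ccontr)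
      assume "\<not> (\<exists>c. G dvd w - mpoly_const c * u)"
      hence "\<kappa> \<in> ?bad w" using G(1,2) nu by (intro CollectI exI[of _ G] conjI)
      with w show False by (rule notE)
    qed
    show "\<kappa> \<in> ?bad (h 3) \<union> ?bad (h 4)"
    proof (rule ccontr)
      assume nb: "\<kappa> \<notin> ?bad (h 3) \<union> ?bad (h 4)"
      obtain c3 where c3: "G dvd h 3 - mpoly_const c3 * u" using ex[OF contrapos_nn[OF nb UnI1]] ..
      obtain c4 where c4: "G dvd h 4 - mpoly_const c4 * u" using ex[OF contrapos_nn[OF nb UnI2]] ..
      note c = c3 c4
      \<comment> \<open>Modulo \<open>G\<close>, \<open>v\<close> is \<open>\<kappa> u\<close>, and
        \<open>h 3\<close>, \<open>h 4\<close> are multiples of \<open>u\<close>. Solving the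
        definitions of \<open>v\<close> and \<open>u\<close> for \<open>h 2\<close> and
        \<open>h 1\<close> gives \<open>c2\<close> and \<open>c1\<close>.\<close>
      define c2 where "c2 = \<kappa> - l3 * c3 - l4 * c4"
      define c1 where "c1 = 1 - m2 * c2 - m3 * c3 - m4 * c4"
      have "h 2 - mpoly_const c2 * u = (v - mpoly_const \<kappa> * u) -
          (mpoly_const l3 * (h 3 - mpoly_const c3 * u) + mpoly_const l4 * (h 4 - mpoly_const c4 * u))"
        by (simp add: v_def c2_def mpoly_const_hom algebra_simps)
      hence 2: "G dvd h 2 - mpoly_const c2 * u"
        using dvd_diff[OF G(2) dvd_add[OF dvd_mult[OF c(1)] dvd_mult[OF c(2)]]] by (simp only:)
      have "h 1 - mpoly_const c1 * u = - (mpoly_const m2 * (h 2 - mpoly_const c2 * u) +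
          (mpoly_const m3 * (h 3 - mpoly_const c3 * u) + mpoly_const m4 * (h 4 - mpoly_const c4 * u)))"
        by (subst (1 2 3 4) u_def) (simp add: c1_def mpoly_const_hom algebra_simps)
      hence 1: "G dvd h 1 - mpoly_const c1 * u"
        using dvd_add[OF dvd_mult[OF 2] dvd_add[OF dvd_mult[OF c(1)] dvd_mult[OF c(2)]]] by (simp only: dvd_minus_iff)
      have "\<forall>i. G dvd h i - mpoly_const ((if i = 1 then c1 else if i = 2 then c2 else if i = 3 then c3 else c4)) * u"
        unfolding forall_4 using 1 2 c by (simp add: neq_4)
      hence "\<exists>c. \<forall>i. G dvd h i - mpoly_const (c i) * u"
        by (rule exI[of _ "\<lambda>i. if i = 1 then c1 else if i = 2 then c2 else if i = 3 then c3 else c4"])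
      with G(3) show False by (rule notE)
    qed
  qed
  hence "finite {\<kappa>. \<not> good u v \<kappa>}" using fin3 fin4 by (meson finite_UnI finite_subset)
  with pencil show ?thesis by (intro exI conjI)
qed

text \<open>If \<open>v = \<kappa> u\<close>, a prime factor of \<open>u\<close> would divide
  \<open>v\<close>. Such a factor exists because \<open>u\<close>, a form of positive degree,
  vanishes at the origin.\<close>

lemma pencil_member_nonzero:
  assumes "pencil u v"
  shows "v - mpoly_const \<kappa> * u \<noteq> 0"
proof
  assume 0: "v - mpoly_const \<kappa> * u = 0"
  have "homogeneous_mpoly e u" using assms lincomb_homog unfolding pencil_def by auto
  then obtain q where q: "prime_elem q" "q dvd u"
    using mpoly_prime_divisor_zero[of u "\<lambda>_. 0"] homogeneous_peval_0 assms unfolding pencil_def by metis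
  have "q dvd v - mpoly_const \<kappa> * u" by (simp add: 0)
  thus False using not_dvd_if_dvd_pencil_member[OF assms q(1)] q(2) by blast
qed

text \<open>\<open>D\<close> kills \<open>v - \<kappa> u\<close> and hence its factor
  \<open>G\<close>. Modulo \<open>G\<close> it is \<open>u\<close> times the derivative along
  \<open>c\<close>, and \<open>G\<close> does not divide \<open>u\<close>; so \<open>G\<close>
  divides its own derivative along \<open>c\<close>.\<close>

lemma prime_factor_invariant:
  assumes pencil: "pencil u v" and G: "prime_elem G" "G dvd v - mpoly_const \<kappa> * u"
    and c: "\<And>i. G dvd h i - mpoly_const (c i) * u"
  shows "dir_deriv (\<lambda>i. mpoly_const (c i)) G = 0"
proof -
  obtain a b where ab: "u = lincomb a" "v = lincomb b" using pencil unfolding pencil_def by auto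
  obtain k where k: "v - mpoly_const \<kappa> * u = G * k" using G(2) by (rule dvdE)
  have "v - mpoly_const \<kappa> * u = v + mpoly_const (- \<kappa>) * u" by (simp add: mpoly_const_hom)
  hence "dir_deriv h (G * k) = 0"
    unfolding k[symmetric] by (simp only: dir_deriv_add dir_deriv_mult dir_deriv_const ab D_lincomb) simp
  moreover have "G * k \<noteq> 0" using pencil_member_nonzero[OF pencil, of \<kappa>] k by simp
  ultimately have DG: "dir_deriv h G = 0" by (rule dir_deriv_factor[OF Dh])
  have "\<forall>i. \<exists>l. h i - mpoly_const (c i) * u = G * l" using c by (auto elim: dvdE)
  from choice[OF this] obtain l where l: "\<forall>i. h i - mpoly_const (c i) * u = G * l i" ..
  have "dir_deriv h G = u * dir_deriv (\<lambda>i. mpoly_const (c i)) G + G * dir_deriv l G"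
  proof -
    have "h i = mpoly_const (c i) * u + G * l i" for i using l by (metis diff_eq_eq add.commute)
    hence "dir_deriv h G = (\<Sum>i\<in>UNIV. (mpoly_const (c i) * u + G * l i) * mpoly_pderiv i G)"
      unfolding dir_deriv_def by (intro sum.cong) simp_all
    thus ?thesis by (simp add: dir_deriv_def algebra_simps sum.distrib sum_distrib_left)
  qed
  hence "u * dir_deriv (\<lambda>i. mpoly_const (c i)) G = G * (- dir_deriv l G)"
    using DG by (simp add: eq_neg_iff_add_eq_0)
  hence "G dvd u * dir_deriv (\<lambda>i. mpoly_const (c i)) G" by (rule dvdI)
  hence "G dvd dir_deriv (\<lambda>i. mpoly_const (c i)) G"
    using prime_elem_dvd_multD[OF G(1)] not_dvd_if_dvd_pencil_member[OF pencil G] by blast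
  thus ?thesis by (rule dvd_dir_deriv_const)
qed

text \<open>Fix a zero \<open>a\<close> of \<open>h\<close>. For almost every \<open>\<kappa>\<close>, some prime factor \<open>G\<close> of \<open>v - \<kappa> u\<close> vanishes at \<open>a\<close>; it
  is invariant under translation by the constant vector \<open>c\<close> to which \<open>h\<close> is proportional modulo \<open>G\<close>. Hence
  \<open>h (a + t h(z))\<close> and \<open>h(z)\<close> are proportional modulo infinitely many primes.\<close>

lemma parallel_at_zero:
  assumes a: "\<And>i. peval a (h i) = 0"
  shows "peval (\<lambda>l. a l + t * peval z (h l)) (h i) * peval z (h j) =
     peval (\<lambda>l. a l + t * peval z (h l)) (h j) * peval z (h i)"
proof -
  obtain u v where pencil: "pencil u v" and fin: "finite {\<kappa>. \<not> good u v \<kappa>}"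
    using ex_good_pencil by (elim exE conjE)
  define T where "T = (\<lambda>l. mpoly_const (a l) + mpoly_const t * h l)"
  \<comment> \<open>A 2 x 2 minor of \<open>h(a + t h)\<close> and \<open>h\<close>, kept as a
    polynomial so that primes can divide it.\<close>
  define R where "R = msub mpoly_const T (h i) * h j - msub mpoly_const T (h j) * h i"
  have inf: "infinite {\<kappa>. good u v \<kappa>}"
  proof
    assume "finite {\<kappa>. good u v \<kappa>}"
    with fin have "finite ({\<kappa>. \<not> good u v \<kappa>} \<union> {\<kappa>. good u v \<kappa>})" by (rule finite_UnI)
    moreover have "{\<kappa>. \<not> good u v \<kappa>} \<union> {\<kappa>. good u v \<kappa>} = UNIV" by blast
    ultimately show False using infinite_UNIV_char_0[where 'a = 'k] by simp
  qed
  have ua: "peval a (lincomb b) = 0" for b by (simp add: lincomb_def a)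
  have "\<exists>G. prime_elem G \<and> G dvd v - mpoly_const \<kappa> * u \<and> G dvd R" if good: "good u v \<kappa>" for \<kappa>
  proof -
    have "peval a (v - mpoly_const \<kappa> * u) = 0"
      using pencil ua unfolding pencil_def by auto
    from mpoly_prime_divisor_zero[OF pencil_member_nonzero[OF pencil] this]
    obtain G where G: "prime_elem G" "G dvd v - mpoly_const \<kappa> * u" "peval a G = 0"
      by (elim exE conjE)
    from good[unfolded good_def, rule_format, OF G(1,2)]
    obtain c where c': "\<forall>i. G dvd h i - mpoly_const (c i) * u" ..
    note c = c'[rule_format]
    have inv: "dir_deriv (\<lambda>i. mpoly_const (c i)) G = 0"
      by (rule prime_factor_invariant[OF pencil G(1,2) c])
    \<comment> \<open>\<open>G\<close> vanishes at \<open>a\<close> and is invariant under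
      translation by \<open>c\<close>, so it vanishes on the whole line; there \<open>h\<close> is
      \<open>u\<close> times \<open>c\<close>.\<close>
    have line: "peval (\<lambda>l. a l + s * c l) (h i) = c i * peval (\<lambda>l. a l + s * c l) u" for s i
    proof -
      obtain k where k: "h i - mpoly_const (c i) * u = G * k" using c by (rule dvdE)
      have "peval (\<lambda>l. a l + s * c l) G = 0" using peval_translate[OF inv, of a s] G(3) by simp
      hence "peval (\<lambda>l. a l + s * c l) (h i - mpoly_const (c i) * u) = 0" unfolding k by simp
      thus ?thesis by simp
    qed
    \<comment> \<open>Modulo \<open>G\<close> the point \<open>a + t h(x)\<close> becomes
      \<open>a + t u(x) c\<close>, which lies on that line for every \<open>x\<close>.\<close>
    define S where "S = (\<lambda>l. mpoly_const (a l) + mpoly_const t * (mpoly_const (c l) * u))"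
    have TS: "G dvd msub mpoly_const T p - msub mpoly_const S p" for p
    proof (rule hom_cong_dvd[where \<phi> = "msub mpoly_const T" and \<psi> = "msub mpoly_const S"])
      fix l
      have "T l - S l = mpoly_const t * (h l - mpoly_const (c l) * u)"
        by (simp add: T_def S_def algebra_simps)
      thus "G dvd msub mpoly_const T (mpoly_var l) - msub mpoly_const S (mpoly_var l)"
        unfolding msub_var[OF ring_hom_fun_mpoly_const] using c[of l] by (simp only: dvd_mult)
    qed (simp_all only: ring_hom_fun_msub ring_hom_fun_mpoly_const msub_const)
    have S0: "msub mpoly_const S (h i) * mpoly_const (c j) - msub mpoly_const S (h j) * mpoly_const (c i) = 0"
    proof (rule mpoly_eq_0_if_peval_eq_0)
      fix x
      have "(\<lambda>l. peval x (S l)) = (\<lambda>l. a l + (t * peval x u) * c l)"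
        by (simp add: S_def mult_ac)
      thus "peval x (msub mpoly_const S (h i) * mpoly_const (c j) - msub mpoly_const S (h j) * mpoly_const (c i)) = 0"
        by (simp add: peval_msub line)
    qed
    have "R = (msub mpoly_const T (h i) - msub mpoly_const S (h i)) * h j
        - (msub mpoly_const T (h j) - msub mpoly_const S (h j)) * h i
        + msub mpoly_const S (h i) * (h j - mpoly_const (c j) * u)
        - msub mpoly_const S (h j) * (h i - mpoly_const (c i) * u)
        + (msub mpoly_const S (h i) * mpoly_const (c j) - msub mpoly_const S (h j) * mpoly_const (c i)) * u"
      by (simp add: R_def algebra_simps)
    moreover have "G dvd \<dots>"
      by (intro dvd_add dvd_diff) (simp_all only: S0 mult_zero_left dvd_0_right dvd_mult dvd_mult2 TS c)
    ultimately have "G dvd R" by (simp only:)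
    with G show ?thesis by (intro exI[of _ G] conjI)
  qed
  hence "\<forall>\<kappa>. \<exists>G. good u v \<kappa> \<longrightarrow> prime_elem G \<and> G dvd v - mpoly_const \<kappa> * u \<and> G dvd R" by metis
  from choice[OF this] obtain G where
    G: "\<forall>\<kappa>. good u v \<kappa> \<longrightarrow> prime_elem (G \<kappa>) \<and> G \<kappa> dvd v - mpoly_const \<kappa> * u \<and> G \<kappa> dvd R" ..
  \<comment> \<open>Otherwise one prime would divide two different members of the pencil, and
    therefore \<open>u\<close>.\<close>
  have "R = 0"
  proof (rule ccontr)
    assume "R \<noteq> 0"
    have "\<exists>x\<in>{\<kappa>. good u v \<kappa>}. \<exists>y\<in>{\<kappa>. good u v \<kappa>}. x \<noteq> y \<and> G x dvd G y"
      by (rule finite_prime_divisors_pigeonhole[OF \<open>R \<noteq> 0\<close> inf]) (use G in simp)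
    then obtain x y where xy: "good u v x" "good u v y" "x \<noteq> y" "G x dvd G y" by blast
    note Gx = spec[OF G, THEN mp, OF xy(1)] and Gy = spec[OF G, THEN mp, OF xy(2)]
    note px = conjunct1[OF Gx] conjunct1[OF conjunct2[OF Gx]]
    have "G x dvd v - mpoly_const y * u"
      by (rule dvd_trans[OF xy(4) conjunct1[OF conjunct2[OF Gy]]])
    hence "G x dvd (v - mpoly_const y * u) - (v - mpoly_const x * u)" using px(2) by (rule dvd_diff)
    also have "(v - mpoly_const y * u) - (v - mpoly_const x * u) = mpoly_const (x - y) * u"
      by (simp add: mpoly_const_hom algebra_simps)
    finally have "G x dvd mpoly_const (1 / (x - y)) * (mpoly_const (x - y) * u)" by (rule dvd_mult)
    also have "mpoly_const (1 / (x - y)) * (mpoly_const (x - y) * u) = u"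
      using xy(3) by (simp flip: mult.assoc mpoly_const_hom(3)) (simp add: mpoly_const_hom)
    finally have "G x dvd u" .
    with not_dvd_if_dvd_pencil_member[OF pencil px] show False by (rule notE)
  qed
  hence "peval z R = 0" by simp
  moreover have "(\<lambda>l. peval z (T l)) = (\<lambda>l. a l + t * peval z (h l))" by (simp add: T_def)
  ultimately show ?thesis by (simp add: R_def peval_msub)
qed

end

subsection \<open>Linear span of the values\<close>

text \<open>Extend to a linear map that sends \<open>b0\<close> to a unit vector and the rest of
  \<open>B\<close> to 0; a row of its matrix is the functional.\<close>

lemma coordinate_functional:
  fixes B :: "('k::field ^ 'n) set"
  assumes "vec.independent B"
  shows "\<exists>l. \<forall>b\<in>B. (\<Sum>j\<in>UNIV. l j * b $ j) = (if b = b0 then 1 else 0)"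
proof -
  fix i0 :: 'n
  obtain g where g: "Vector_Spaces.linear (*s) (*s) g" "\<forall>x\<in>B. g x = (if x = b0 then axis i0 1 else 0)"
    using vec.linear_independent_extend[OF assms, of "\<lambda>x. if x = b0 then axis i0 (1 :: 'k) else 0"] by metis
  have "(\<Sum>j\<in>UNIV. matrix g $ i0 $ j * b $ j) = g b $ i0" for b
    using matrix_works[OF g(1), of b] by (simp add: matrix_vector_mult_def Finite_Cartesian_Product.vec_eq_iff)
  thus ?thesis using g(2) by (intro exI[of _ "\<lambda>j. matrix g $ i0 $ j"]) (simp add: axis_def)
qed

lemma functional_eq_0_on_span:
  fixes B :: "('k::field ^ 'n) set"
  assumes "\<And>b. b \<in> B \<Longrightarrow> (\<Sum>j\<in>UNIV. l j * b $ j) = 0" "x \<in> vec.span B"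
  shows "(\<Sum>j\<in>UNIV. l j * x $ j) = 0"
  using assms(2)
proof (induction rule: vec.span_induct_alt)
  case base
  show ?case by simp
next
  case (step c x y)
  have "(\<Sum>j\<in>UNIV. l j * (c *s x + y) $ j) = c * (\<Sum>j\<in>UNIV. l j * x $ j) + (\<Sum>j\<in>UNIV. l j * y $ j)"
    by (simp add: algebra_simps sum.distrib sum_distrib_left)
  thus ?case using step assms(1) by simp
qed

lemma independent_extend_by:
  fixes B :: "('k::field ^ 'n) set"
  assumes "vec.independent B" "card B + k \<le> CARD('n)"
  shows "\<exists>C. B \<subseteq> C \<and> vec.independent C \<and> card C = card B + k"
  using assms(2)
proof (induction k)
  case 0
  thus ?case using assms(1) by (intro exI[of _ B]) simp
next
  case (Suc k)
  then obtain C where C: "B \<subseteq> C" "vec.independent C" "card C = card B + k" by auto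
  have "vec.span C \<noteq> UNIV"
  proof
    assume "vec.span C = UNIV"
    hence "card C = CARD('n)"
      using vec.dim_eq_card_independent[OF C(2)] vec.dim_span[of C] vec_dim_card[where 'a = 'k and 'n = 'n] by simp
    thus False using C(3) Suc.prems by simp
  qed
  then obtain x where x: "x \<notin> vec.span C" by auto
  have "card (insert x C) = card B + Suc k"
    using C x vec.finiteI_independent[OF C(2)] vec.span_base[of x C] by (auto simp: card_insert_if)
  thus ?case using C x vec.independent_insertI[OF x C(2)] by (intro exI[of _ "insert x C"]) auto
qed

text \<open>\<open>T\<close> projects onto the hyperplane by solving its equation for
  \<open>x_k\<close>. Modulo the linear form \<open>p\<close> equals its composition with
  \<open>T\<close>, and that vanishes at every point.\<close>

lemma linear_form_dvd:
  fixes p :: "(4, 'k::field_char_0) mpoly"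
  assumes l: "l k \<noteq> 0" and p: "\<And>a. (\<Sum>j\<in>UNIV. l j * a j) = 0 \<Longrightarrow> peval a p = 0"
  shows "(\<Sum>j\<in>UNIV. mpoly_const (l j) * mpoly_var j) dvd p"
proof -
  let ?L = "\<Sum>j\<in>UNIV. mpoly_const (l j) * mpoly_var j :: (4, 'k) mpoly"
  define T where "T = (\<lambda>i. if i = k then mpoly_var k - mpoly_const (1 / l k) * ?L else mpoly_var i)"
  have "?L dvd msub mpoly_const mpoly_var p - msub mpoly_const T p"
  proof (rule hom_cong_dvd[where \<phi> = "msub mpoly_const mpoly_var" and \<psi> = "msub mpoly_const T"])
    fix i
    have "mpoly_var i - T i = (if i = k then mpoly_const (1 / l k) * ?L else 0)" by (simp add: T_def)
    thus "?L dvd msub mpoly_const mpoly_var (mpoly_var i) - msub mpoly_const T (mpoly_var i)"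
      unfolding msub_var[OF ring_hom_fun_mpoly_const] by (simp only: split: if_split) (simp only: dvd_triv_right dvd_0_right simp_thms)
  qed (simp_all only: ring_hom_fun_msub ring_hom_fun_mpoly_const msub_const)
  moreover have "msub mpoly_const T p = 0"
  proof (rule mpoly_eq_0_if_peval_eq_0)
    fix a
    define s where "s = (\<Sum>j\<in>UNIV. l j * a j)"
    have T: "peval a (T i) = (if i = k then a k - s / l k else a i)" for i
      by (simp add: T_def s_def)
    have "(\<Sum>j\<in>UNIV. l j * peval a (T j)) = (\<Sum>j\<in>UNIV. l j * a j - (if j = k then s else 0))"
      using l by (intro sum.cong) (auto simp: T right_diff_distrib)
    also have "\<dots> = 0" by (simp add: sum_subtractf s_def)
    finally show "peval a (msub mpoly_const T p) = 0" by (simp only: peval_msub p)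
  qed
  ultimately show ?thesis by simp
qed

text \<open>Euclid's lemma for a divisor coprime to \<open>v\<close>, one prime at a time.\<close>

lemma prod_mset_primes_dvd_cancel:
  fixes x v :: "'a::idom"
  assumes "\<And>q. q \<in># F \<Longrightarrow> prime_elem q \<and> \<not> q dvd v" "prod_mset F dvd v * x"
  shows "prod_mset F dvd x"
  using assms
proof (induction F arbitrary: x)
  case (add q F)
  have q: "prime_elem q" "\<not> q dvd v" using add.prems(1) by auto
  have "q dvd v * x" using add.prems(2) by (metis dvd_mult_left prod_mset.add_mset)
  hence "q dvd x" using prime_elem_dvd_multD[OF q(1)] q(2) by metis
  then obtain y where y: "x = q * y" by (rule dvdE)
  have "q * prod_mset F dvd q * (v * y)" using add.prems(2) by (simp add: y mult_ac)
  hence d: "prod_mset F dvd v * y" using q(1) by (simp add: prime_elem_def)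
  have pr: "prime_elem r \<and> \<not> r dvd v" if "r \<in># F" for r using add.prems(1) that by simp
  have "prod_mset F dvd y" by (rule add.IH[OF pr d])
  thus ?case by (simp add: y)
qed simp

context self_annihilating_field
begin

definition H :: "'k ^ 4 \<Rightarrow> 'k ^ 4" where
  "H x = (\<chi> i. peval (vec_nth x) (h i))"

lemma H_scale: "H (k *s x) = k ^ e *s H x"
proof -
  have "vec_nth (k *s x) = (\<lambda>i. k * x $ i)" by (rule ext) simp
  thus ?thesis by (simp add: H_def Finite_Cartesian_Product.vec_eq_iff peval_scale[OF homog])
qed

lemma H_0: "H 0 = 0"
  using H_scale[of 0 0] e_pos by (simp add: power_0_left)

lemma H_H: "H (H z) = 0"
proof -
  have "peval (vec_nth (H z)) (h i) = peval (vec_nth z) (msub mpoly_const h (h i))" for i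
  proof -
    have "vec_nth (H z) = (\<lambda>i. peval (vec_nth z) (h i))" by (rule ext) (simp add: H_def)
    thus ?thesis by (simp add: peval_msub)
  qed
  thus ?thesis by (simp add: H_def[of "H z"] msub_h Finite_Cartesian_Product.vec_eq_iff)
qed

lemma H_parallel:
  assumes "H a = 0"
  shows "H (a + t *s H z) $ i * H z $ j = H (a + t *s H z) $ j * H z $ i"
proof -
  have a: "peval (vec_nth a) (h i) = 0" for i
    using assms by (simp add: H_def Finite_Cartesian_Product.vec_eq_iff)
  have "vec_nth (a + t *s H z) = (\<lambda>l. a $ l + t * peval (vec_nth z) (h l))"
    by (rule ext) (simp add: H_def)
  thus ?thesis using parallel_at_zero[OF a, where t = t and z = "vec_nth z"] by (simp add: H_def)
qed

lemma scalar_multiple_if_parallel: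
  fixes x b :: "'k ^ 4"
  assumes "\<And>i j. x $ i * b $ j = x $ j * b $ i" "x \<noteq> 0"
  shows "\<exists>s. b = s *s x"
proof -
  obtain i where i: "x $ i \<noteq> 0" using assms(2) by (auto simp: Finite_Cartesian_Product.vec_eq_iff)
  have "b = (b $ i / x $ i) *s x"
    unfolding Finite_Cartesian_Product.vec_eq_iff using i assms(1)[of i] by (simp add: field_simps)
  thus ?thesis ..
qed

text \<open>Removing the component along \<open>b \<in> B\<close> leaves a zero of \<open>H\<close> by induction, so \<open>H w\<close> is parallel to every
  \<open>b \<in> B\<close>.\<close>

lemma H_eq_0_on_span:
  assumes "finite B" "B \<subseteq> range H" "vec.independent B" "w \<in> vec.span B"
  shows "H w = 0"
  using assms
proof (induction "card B" arbitrary: B w rule: less_induct)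
  case less
  have par: "H w $ i * b $ j = H w $ j * b $ i" if b: "b \<in> B" for b i j
  proof -
    have "w \<in> vec.span (insert b (B - {b}))" using less.prems(4) b by (simp add: insert_absorb)
    then obtain k where k: "w - k *s b \<in> vec.span (B - {b})" using vec.span_breakdown_eq by blast
    have "card (B - {b}) < card B" using less.prems(1) b by (rule card_Diff1_less)
    hence "H (w - k *s b) = 0"
      using less.hyps[of "B - {b}"] less.prems k vec.independent_mono[of B "B - {b}"] by auto
    moreover obtain z where "b = H z" using less.prems(2) b by auto
    ultimately show ?thesis using H_parallel[of "w - k *s b" k z i j] by simp
  qed
  \<comment> \<open>Parallelism gives a contradiction only with two different basis vectors; the
    smaller cases rest on \<open>H_H\<close> and homogeneity.\<close>
  consider "B = {}" | b where "B = {b}" | b b' where "b \<in> B" "b' \<in> B" "b \<noteq> b'" by blast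
  thus ?case
  proof cases
    case 1
    thus ?thesis using less.prems(4) H_0 by simp
  next
    case 2
    then obtain k where k: "w = k *s b" using less.prems(4) by (auto simp: vec.span_singleton)
    obtain z where "b = H z" using less.prems(2) 2 by auto
    thus ?thesis by (simp add: k H_scale H_H)
  next
    case 3
    show ?thesis
    proof (rule ccontr)
      assume nz: "H w \<noteq> 0"
      obtain s where s: "b = s *s H w" using scalar_multiple_if_parallel[OF par[OF 3(1)] nz] ..
      obtain s' where s': "b' = s' *s H w" using scalar_multiple_if_parallel[OF par[OF 3(2)] nz] ..
      have "b \<noteq> 0" using less.prems(3) 3(1) vec.dependent_zero by auto
      hence "s \<noteq> 0" using s by auto
      hence "b' = (s' / s) *s b" using s s' by (simp add: vector_smult_assoc)
      hence "b' \<in> vec.span (B - {b'})"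
        using 3 vec.span_scale[OF vec.span_base[of b "B - {b'}"]] by simp
      thus False using less.prems(3) 3(2) unfolding vec.dependent_def by blast
    qed
  qed
qed

lemma H_nonzero: "\<exists>x. H x \<noteq> 0"
proof (rule ccontr)
  assume "\<nexists>x. H x \<noteq> 0"
  hence H0: "H x = 0" for x by simp
  have "h i = 0" for i
  proof (rule mpoly_eq_0_if_peval_eq_0)
    fix a
    have "peval a (h i) = H (vec_lambda a) $ i" by (simp add: H_def vec_lambda_inverse)
    thus "peval a (h i) = 0" by (simp add: H0)
  qed
  thus False using nonzero by simp
qed

text \<open>Otherwise \<open>h\<close> would vanish on a hyperplane, whose equation would divide all \<open>h i\<close>.\<close>

lemma range_H_dim_less_3:
  assumes B: "B \<subseteq> range H" "vec.independent B"
  shows "card B < 3"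
proof (rule ccontr)
  assume "\<not> card B < 3"
  have fin: "finite B" by (rule vec.finiteI_independent[OF B(2)])
  have "vec.span B \<noteq> UNIV"
  proof
    assume "vec.span B = UNIV"
    hence "H x = 0" for x using H_eq_0_on_span[OF fin B, of x] by simp
    thus False using H_nonzero by blast
  qed
  then obtain x where x: "x \<notin> vec.span B" by auto
  have ind: "vec.independent (insert x B)" by (rule vec.independent_insertI[OF x B(2)])
  have "x \<notin> B" using x vec.span_base by auto
  hence "card (insert x B) = Suc (card B)" using fin by simp
  hence "vec.dim (UNIV :: ('k ^ 4) set) \<le> card (insert x B)"
    using \<open>\<not> card B < 3\<close> vec_dim_card[where 'a = 'k and 'n = 4] by simp
  hence full: "UNIV \<subseteq> vec.span (insert x B)" by (rule vec.card_ge_dim_independent[OF subset_UNIV ind])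
  \<comment> \<open>Three vectors of \<open>B\<close> and \<open>x\<close> fill the space, so
    \<open>span B\<close> is a hyperplane; \<open>l\<close> is its equation, with value 1 at
    \<open>x\<close>.\<close>
  obtain l where l: "\<forall>b\<in>insert x B. (\<Sum>j\<in>UNIV. l j * b $ j) = (if b = x then 1 else 0)"
    using coordinate_functional[OF ind, of x] by blast
  have lx: "(\<Sum>j\<in>UNIV. l j * x $ j) = 1" using l by simp
  have lB: "(\<Sum>j\<in>UNIV. l j * b $ j) = 0" if "b \<in> B" for b using l that \<open>x \<notin> B\<close> by auto
  have ker: "y \<in> vec.span B" if y: "(\<Sum>j\<in>UNIV. l j * y $ j) = 0" for y
  proof -
    have "y \<in> vec.span (insert x B)" using full by auto
    then obtain k where k: "y - k *s x \<in> vec.span B" using vec.span_breakdown_eq by blast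
    have "(\<Sum>j\<in>UNIV. l j * (y - k *s x) $ j) = 0" by (rule functional_eq_0_on_span[OF lB k])
    moreover have "(\<Sum>j\<in>UNIV. l j * (y - k *s x) $ j) = (\<Sum>j\<in>UNIV. l j * y $ j) - k * (\<Sum>j\<in>UNIV. l j * x $ j)"
      by (simp add: algebra_simps sum_subtractf sum_distrib_left)
    ultimately have "k = 0" using y lx by simp
    thus ?thesis using k by simp
  qed
  obtain k where k: "l k \<noteq> 0"
  proof -
    have "\<exists>k. l k \<noteq> 0"
    proof (rule ccontr)
      assume "\<nexists>k. l k \<noteq> 0"
      thus False using lx by simp
    qed
    thus ?thesis using that by blast
  qed
  let ?L = "\<Sum>j\<in>UNIV. mpoly_const (l j) * mpoly_var j :: (4, 'k) mpoly"
  have dvd: "?L dvd h i" for i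
  proof (rule linear_form_dvd[of l, OF k])
    fix a assume "(\<Sum>j\<in>UNIV. l j * a j) = 0"
    hence "H (vec_lambda a) = 0"
      by (intro H_eq_0_on_span[OF fin B] ker) (simp add: vec_lambda_inverse)
    hence "H (vec_lambda a) $ i = 0" by simp
    thus "peval a (h i) = 0" by (simp add: H_def vec_lambda_inverse)
  qed
  have "peval (vec_nth x) ?L = 1" using lx by simp
  hence "?L \<noteq> 0" by (metis peval_hom(4) zero_neq_one)
  moreover have "peval (\<lambda>_. 0) ?L = 0" by simp
  ultimately have "\<exists>q. prime_elem q \<and> q dvd ?L \<and> peval (\<lambda>_. 0) q = 0" by (rule mpoly_prime_divisor_zero)
  then obtain q where q: "prime_elem q" "q dvd ?L" by (elim exE conjE)
  have "\<forall>i. q dvd h i" using dvd_trans[OF q(2) dvd] by (rule allI)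
  with primitive[OF q(1)] show False by (rule notE)
qed

text \<open>\<open>l\<close> and \<open>l'\<close> are dual to \<open>b\<close> and
  \<open>b'\<close>. A basis with fewer than two vectors is padded, so that no case distinction
  remains.\<close>

lemma H_two_dimensional:
  "\<exists>b b' l l'. b \<noteq> 0 \<and> (\<forall>z. H z = (\<Sum>j\<in>UNIV. l j * H z $ j) *s b + (\<Sum>j\<in>UNIV. l' j * H z $ j) *s b')"
proof -
  obtain B where B: "B \<subseteq> range H" "vec.independent B" "range H \<subseteq> vec.span B"
    using vec.maximal_independent_subset by metis
  have "card B < 3" by (rule range_H_dim_less_3[OF B(1,2)])
  hence "card B + (2 - card B) = 2" by simp
  moreover from this have "card B + (2 - card B) \<le> CARD(4)" by simp
  ultimately obtain C where C: "B \<subseteq> C" "vec.independent C" "card C = 2"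
    using independent_extend_by[OF B(2), of "2 - card B"] by metis
  then obtain b b' where bb: "C = {b, b'}" "b \<noteq> b'" by (meson card_2_iff)
  obtain l where l: "\<forall>x\<in>C. (\<Sum>j\<in>UNIV. l j * x $ j) = (if x = b then 1 else 0)"
    using coordinate_functional[OF C(2), of b] by blast
  obtain l' where l': "\<forall>x\<in>C. (\<Sum>j\<in>UNIV. l' j * x $ j) = (if x = b' then 1 else 0)"
    using coordinate_functional[OF C(2), of b'] by blast
  have "b \<noteq> 0" using C(2) vec.dependent_zero unfolding bb by auto
  moreover have "H z = (\<Sum>j\<in>UNIV. l j * H z $ j) *s b + (\<Sum>j\<in>UNIV. l' j * H z $ j) *s b'" for z
  proof -
    have "H z \<in> vec.span (insert b {b'})" using B(3) vec.span_mono[OF C(1)] unfolding bb by auto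
    then obtain s where "H z - s *s b \<in> vec.span {b'}" using vec.span_breakdown_eq by blast
    then obtain t where "H z - s *s b = t *s b'" by (auto simp: vec.span_singleton)
    hence Hz: "H z = s *s b + t *s b'" by (simp add: algebra_simps)
    have lin: "(\<Sum>j\<in>UNIV. f j * H z $ j) = s * (\<Sum>j\<in>UNIV. f j * b $ j) + t * (\<Sum>j\<in>UNIV. f j * b' $ j)" for f
      unfolding Hz by (simp add: algebra_simps sum.distrib sum_distrib_left)
    show ?thesis unfolding lin using l l' bb by (simp add: Hz)
  qed
  ultimately show ?thesis by blast
qed

text \<open>If \<open>F \<noteq> 0\<close>, all Wronskians of \<open>p\<close> and \<open>q\<close>
  vanish, hence also those of a coprime pair \<open>u\<close>, \<open>v\<close> in their span. This
  forces \<open>u\<close> to divide its own derivatives, which is impossible in positive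
  degree.\<close>

lemma dir_deriv_eq_0:
  assumes f: "dir_deriv h f = 0" and fi: "\<And>i. dir_deriv h (mpoly_pderiv i f) = 0"
  shows "\<exists>c. (\<exists>i. c i \<noteq> 0) \<and> dir_deriv (\<lambda>i. mpoly_const (c i)) f = 0"
proof -
  obtain b b' l l' where b: "b \<noteq> 0" and
    H: "\<forall>z. H z = (\<Sum>j\<in>UNIV. l j * H z $ j) *s b + (\<Sum>j\<in>UNIV. l' j * H z $ j) *s b'"
    using H_two_dimensional by (elim exE conjE)
  define p where "p = lincomb l"
  define q where "q = lincomb l'"
  have hpq: "h i = mpoly_const (b $ i) * p + mpoly_const (b' $ i) * q" for i
  proof -
    have "h i - (mpoly_const (b $ i) * p + mpoly_const (b' $ i) * q) = 0"
    proof (rule mpoly_eq_0_if_peval_eq_0)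
      fix a
      have Ha: "H (vec_lambda a) $ j = peval a (h j)" for j by (simp add: H_def vec_lambda_inverse)
      have "H (vec_lambda a) $ i = ((\<Sum>j\<in>UNIV. l j * H (vec_lambda a) $ j) *s b + (\<Sum>j\<in>UNIV. l' j * H (vec_lambda a) $ j) *s b') $ i"
        using H by metis
      hence "peval a (h i) = (\<Sum>j\<in>UNIV. l j * peval a (h j)) * b $ i + (\<Sum>j\<in>UNIV. l' j * peval a (h j)) * b' $ i"
        by (simp only: Ha vector_add_component vector_smult_component)
      thus "peval a (h i - (mpoly_const (b $ i) * p + mpoly_const (b' $ i) * q)) = 0"
        by (simp add: p_def q_def lincomb_def mult.commute)
    qed
    thus ?thesis by simp
  qed
  define F where "F = dir_deriv (\<lambda>i. mpoly_const (b $ i)) f"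
  define F' where "F' = dir_deriv (\<lambda>i. mpoly_const (b' $ i)) f"
  have comb: "(\<Sum>i\<in>UNIV. (mpoly_const (b $ i) * x + mpoly_const (b' $ i) * y) * mpoly_pderiv i f) = x * F + y * F'" for x y
    by (simp add: F_def F'_def dir_deriv_def algebra_simps sum.distrib sum_distrib_left)
  have 1: "p * F + q * F' = 0"
    using f unfolding dir_deriv_def hpq comb .
  \<comment> \<open>In the derivative of \<open>D f = 0\<close> by \<open>x_j\<close> the
    second-order part is \<open>D f_j = 0\<close>; only derivatives of \<open>h\<close>
    remain.\<close>
  have 2: "mpoly_pderiv j p * F + mpoly_pderiv j q * F' = 0" for j
  proof -
    have "mpoly_pderiv j (dir_deriv h f) =
        (\<Sum>i\<in>UNIV. mpoly_pderiv j (h i) * mpoly_pderiv i f) + dir_deriv h (mpoly_pderiv j f)"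
      by (simp add: dir_deriv_def mpoly_pderiv_sum mpoly_pderiv_mult sum.distrib mpoly_pderiv_commute[of j])
    hence "(\<Sum>i\<in>UNIV. mpoly_pderiv j (h i) * mpoly_pderiv i f) = 0" using f fi by simp
    moreover have "mpoly_pderiv j (h i) = mpoly_const (b $ i) * mpoly_pderiv j p + mpoly_const (b' $ i) * mpoly_pderiv j q" for i
      by (subst hpq) (simp add: mpoly_pderiv_add mpoly_pderiv_mult)
    ultimately show ?thesis by (simp add: comb)
  qed
  have "F = 0"
  proof (rule ccontr)
    assume F: "F \<noteq> 0"
    have W: "p * mpoly_pderiv j q - q * mpoly_pderiv j p = 0" for j
    proof -
      have "(p * mpoly_pderiv j q - q * mpoly_pderiv j p) * F =
          mpoly_pderiv j q * (p * F + q * F') - q * (mpoly_pderiv j p * F + mpoly_pderiv j q * F')"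
        by (simp add: algebra_simps)
      hence "(p * mpoly_pderiv j q - q * mpoly_pderiv j p) * F = 0" by (simp only: 1 2 mult_zero_right diff_self)
      thus ?thesis using F by (simp only: mult_eq_0_iff) simp
    qed
    obtain u v where uv: "pencil u v" using ex_good_pencil by (elim exE conjE)
    obtain x y where xy: "u = lincomb x" "v = lincomb y" using uv unfolding pencil_def by auto
    have lc: "\<exists>s t. lincomb z = mpoly_const s * p + mpoly_const t * q" for z
    proof -
      have "lincomb z = mpoly_const (\<Sum>i\<in>UNIV. z i * b $ i) * p + mpoly_const (\<Sum>i\<in>UNIV. z i * b' $ i) * q"
        unfolding lincomb_def hpq
        by (simp add: mpoly_const_hom algebra_simps sum.distrib sum_distrib_left sum_distrib_right)
      thus ?thesis by blast
    qed
    obtain s t where st: "u = mpoly_const s * p + mpoly_const t * q" using lc[of x] unfolding xy by (elim exE)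
    obtain s' t' where st': "v = mpoly_const s' * p + mpoly_const t' * q" using lc[of y] unfolding xy by (elim exE)
    have u0: "u \<noteq> 0" using uv by (simp add: pencil_def)
    have hu: "homogeneous_mpoly e u" unfolding xy by (rule lincomb_homog)
    have "mpoly_pderiv j u = 0" for j
    proof (rule dvd_pderiv)
      \<comment> \<open>The Wronskian is bilinear and alternating, so passing from \<open>p\<close>,
        \<open>q\<close> to \<open>u\<close>, \<open>v\<close> multiplies it by a
        determinant.\<close>
      have "u * mpoly_pderiv j v - v * mpoly_pderiv j u =
          (mpoly_const s * mpoly_const t' - mpoly_const t * mpoly_const s') * (p * mpoly_pderiv j q - q * mpoly_pderiv j p)"
        unfolding st st' by (simp add: mpoly_pderiv_add mpoly_pderiv_mult algebra_simps)
      hence "v * mpoly_pderiv j u = u * mpoly_pderiv j v" by (simp only: W mult_zero_right right_minus_eq)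
      hence dvd: "u dvd v * mpoly_pderiv j u" by (rule dvdI)
      have "\<exists>M. u = prod_mset M \<and> (\<forall>q\<in>#M. prime_elem q)"
        by (rule mpoly_prime_factors[OF u0 peval_0_imp_not_unit[OF homogeneous_peval_0[OF hu]]])
      then obtain M where M: "u = prod_mset M" "\<forall>q\<in>#M. prime_elem q" by (elim exE conjE)
      have pr: "prime_elem q \<and> \<not> q dvd v" if q: "q \<in># M" for q
      proof -
        have "prime_elem q" using M(2) q by (rule bspec)
        moreover have "q dvd u" using M(1) q by (rule prime_factors_dvd)
        ultimately show ?thesis using uv unfolding pencil_def by metis
      qed
      have "prod_mset M dvd v * mpoly_pderiv j u" unfolding M(1)[symmetric] by (rule dvd)
      from prod_mset_primes_dvd_cancel[OF pr this] show "u dvd mpoly_pderiv j u" unfolding M(1)[symmetric] .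
    qed
    hence "u = 0" using homogeneous_eq_0_if_pderiv_eq_0[OF hu e_pos] by blast
    thus False using u0 by contradiction
  qed
  moreover obtain i where "b $ i \<noteq> 0" using b by (auto simp: Finite_Cartesian_Product.vec_eq_iff)
  ultimately show ?thesis unfolding F_def by blast
qed

end

lemma zero_hessian_dir_deriv_eq_0:
  fixes f :: "(4, 'k::{alg_closed_field, field_char_0}) mpoly"
  assumes d: "d \<ge> 2" and f: "homogeneous_mpoly d f" and hess: "zero_hessian f"
  shows "\<exists>c. (\<exists>i. c i \<noteq> 0) \<and> dir_deriv (\<lambda>i. mpoly_const (c i)) f = 0"
proof -
  define n where "n = d - 2"
  have n: "d = Suc (Suc n)" using d by (simp add: n_def)
  have "\<exists>h e. (\<exists>i. h i \<noteq> 0) \<and> (\<forall>i. homogeneous_mpoly e (h i)) \<and>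
     (\<forall>i. dir_deriv h (mpoly_pderiv i f) = 0) \<and> (\<forall>i. dir_deriv h (h i) = 0) \<and>
     (\<forall>G. prime_elem G \<longrightarrow> \<not> (\<forall>i. G dvd h i))"
    by (rule zero_hessian_primitive_vector_field[OF hess]) (use f n in simp)
  then obtain h e where h: "\<exists>i. h i \<noteq> 0" "\<forall>i. homogeneous_mpoly e (h i)"
    "\<forall>i. dir_deriv h (mpoly_pderiv i f) = 0" "\<forall>i. dir_deriv h (h i) = 0"
    "\<forall>G. prime_elem G \<longrightarrow> \<not> (\<forall>i. G dvd h i)"
    by - ((erule exE)+, elim conjE)
  have fi: "dir_deriv h (mpoly_pderiv i f) = 0" for i using h(3) by (rule spec)
  have Df: "dir_deriv h f = 0"
  proof -
    \<comment> \<open>Each \<open>f_i\<close> has degree \<open>d - 1\<close>, so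
      \<open>(d - 1) D f\<close> is the sum of all \<open>x_j D f_j\<close>, hence 0; the factor
      \<open>d - 1 > 0\<close> cancels.\<close>
    have euler: "(\<Sum>j\<in>UNIV. mpoly_pderiv j (mpoly_pderiv i f) * mpoly_var j) = of_nat (Suc n) * mpoly_pderiv i f" for i
      by (rule euler_identity[OF homogeneous_pderiv]) (use f n in simp)
    have "of_nat (Suc n) * dir_deriv h f =
        (\<Sum>i\<in>UNIV. h i * (\<Sum>j\<in>UNIV. mpoly_pderiv j (mpoly_pderiv i f) * mpoly_var j))"
      unfolding euler dir_deriv_def sum_distrib_left by (intro sum.cong) (simp_all only: mult_ac)
    also have "\<dots> = (\<Sum>j\<in>UNIV. mpoly_var j * dir_deriv h (mpoly_pderiv j f))"
      unfolding dir_deriv_def sum_distrib_left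
      by (subst sum.swap) (intro sum.cong, simp_all only: mult_ac mpoly_pderiv_commute)
    finally have "of_nat (Suc n) * dir_deriv h f = 0" by (simp only: fi mult_zero_right sum.neutral_const)
    thus ?thesis by (simp only: mult_eq_0_iff of_nat_eq_0_iff) simp
  qed
  show ?thesis
  proof (cases "e = 0")
    case True
    define c where "c i = Poly_Mapping.lookup (h i) 0" for i
    have hc: "h i = mpoly_const (c i)" for i
      unfolding c_def by (rule homogeneous_degree_0) (use h(2) True in simp)
    hence "h = (\<lambda>i. mpoly_const (c i))" by (rule ext)
    hence "dir_deriv (\<lambda>i. mpoly_const (c i)) f = 0" using Df by simp
    moreover have "\<exists>i. c i \<noteq> 0" using h(1) hc by (metis mpoly_const_hom(4))
    ultimately show ?thesis by blast
  next
    case False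
    have "self_annihilating_field h e"
    proof
      show "\<not> (\<forall>i. G dvd h i)" if "prime_elem G" for G using h(5) that by metis
    qed (use h False in simp_all)
    thus ?thesis using Df fi by (rule self_annihilating_field.dir_deriv_eq_0)
  qed
qed

section \<open>From a constant direction to a change of variables\<close>

lemma invertible_with_column_4:
  fixes c :: "4 \<Rightarrow> 'k::field"
  assumes "c k \<noteq> 0"
  shows "\<exists>B :: 'k ^ 4 ^ 4. invertible B \<and> (\<forall>i. B $ i $ 4 = c i)"
proof -
  \<comment> \<open>The identity with \<open>c\<close> put in column 4 and the unit vector
    \<open>e_4\<close> moved to column \<open>k\<close>; it is regular since
    \<open>c k \<noteq> 0\<close>.\<close>
  define B :: "'k ^ 4 ^ 4" where
    "B = (\<chi> i j. if j = 4 then c i else if j = k then (if i = 4 then 1 else 0) else if i = j then 1 else 0)"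
  have "x = 0" if x: "B *v x = 0" for x
  proof -
    have row: "(\<Sum>j\<in>UNIV. B $ i $ j * x $ j) = 0" for i
      using x by (simp add: matrix_vector_mult_def Finite_Cartesian_Product.vec_eq_iff)
    show ?thesis
      using row[of 1] row[of 2] row[of 3] row[of 4] exhaust_4[of k] assms
      by (auto simp: B_def sum_4 neq_4 Finite_Cartesian_Product.vec_eq_iff forall_4)
  qed
  hence "invertible B" by (simp add: invertible_left_inverse matrix_left_invertible_ker)
  thus ?thesis by (intro exI[of _ B]) (simp add: B_def)
qed

lemma ex_matrix_inv_eq:
  fixes B :: "'k::field ^ 'n ^ 'n"
  assumes "invertible B"
  shows "\<exists>A. invertible A \<and> matrix_inv A = B"
proof -
  obtain A where A: "B ** A = Finite_Cartesian_Product.mat 1" "A ** B = Finite_Cartesian_Product.mat 1" using assms unfolding invertible_def by blast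
  have "A ** matrix_inv A = Finite_Cartesian_Product.mat 1 \<and> matrix_inv A ** A = Finite_Cartesian_Product.mat 1"
    unfolding matrix_inv_def by (rule someI[of _ B]) (use A in simp)
  hence "matrix_inv A = B" using A by (metis matrix_mul_assoc matrix_mul_lid matrix_mul_rid)
  thus ?thesis using A unfolding invertible_def by blast
qed

theorem theorem7p1:
  fixes f :: "(4, 'k::{alg_closed_field, field_char_0}) mpoly" and d :: nat
  assumes "d \<ge> 2"
    and "homogeneous_mpoly d f"
    and "zero_hessian f"
  shows "\<exists>A :: 'k ^ 4 ^ 4. invertible A \<and>
           mpoly_linear_subst (matrix_inv A) f \<in> mpolys_in {1, 2, 3}"
proof -
  obtain c where c: "\<exists>i. c i \<noteq> 0" "dir_deriv (\<lambda>i. mpoly_const (c i)) f = 0"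
    using zero_hessian_dir_deriv_eq_0[OF assms] by - (erule exE, elim conjE)
  obtain k where "c k \<noteq> 0" using c(1) ..
  \<comment> \<open>With \<open>c\<close> as fourth column, a change of \<open>x_4\<close> moves the
    point \<open>B x\<close> in the direction \<open>c\<close>, along which \<open>f\<close> is
    constant.\<close>
  then obtain B :: "'k ^ 4 ^ 4" where B: "invertible B" "\<forall>i. B $ i $ 4 = c i"
    using invertible_with_column_4 by metis
  define g :: "4 \<Rightarrow> (4, 'k) mpoly" where "g i = (\<Sum>j\<in>UNIV. mpoly_const (B $ i $ j) * mpoly_var j)" for i
  define p where "p = mpoly_linear_subst B f"
  have p: "p = msub mpoly_const g f"
    by (simp add: p_def mpoly_linear_subst_def mpoly_subst_eq_msub g_def[abs_def])
  have g4: "mpoly_pderiv 4 (g i) = mpoly_const (c i)" for i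
    by (simp add: g_def sum_4 mpoly_pderiv_add mpoly_pderiv_mult mpoly_pderiv_var B(2))
  have "mpoly_pderiv 4 p = (\<Sum>i\<in>UNIV. msub mpoly_const g (mpoly_pderiv i f) * mpoly_const (c i))"
    unfolding p by (simp add: derivation_msub[OF derivation_pderiv mpoly_pderiv_const] g4)
  also have "\<dots> = msub mpoly_const g (dir_deriv (\<lambda>i. mpoly_const (c i)) f)"
    by (simp add: dir_deriv_def msub_hom msub_const mult.commute)
  finally have p4: "mpoly_pderiv 4 p = 0" by (simp add: c(2) msub_hom)
  have "p \<in> mpolys_in {1, 2, 3}"
    unfolding mpolys_in_def
  proof (intro CollectI ballI subsetI)
    fix m i assume "m \<in> Poly_Mapping.keys p" "i \<in> Poly_Mapping.keys m"
    hence "i \<noteq> 4" using lookup_eq_0_if_pderiv_eq_0[OF p4, of m] by (auto simp: in_keys_iff)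
    thus "i \<in> {1, 2, 3}" using exhaust_4[of i] by auto
  qed
  moreover obtain A where A: "invertible A" "matrix_inv A = B" using ex_matrix_inv_eq[OF B(1)] by metis
  ultimately show ?thesis unfolding p_def by metis
qed

end
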